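(* Let $D$ be an open subset of $\mathbb R^d$. Suppose that there is a decreasing function $\Theta:(0,\infty)\to(0,\infty)$ with $\int_s^\infty\frac{\Theta^{-1}(r)}{r}\,dr<\infty$ for large $s>0$, such that the Dirichlet heat kernel satisfies $p^D(t,x,y)\le\Theta(t)$ for all $t>0$ and $x,y\in D$. If $$\big|\{x\in D:V_D(x)<r\}\big|<\infty\quad\text{for every }r>0,$$ where $V_D(x)=\int_{D^c}J(x,y)\,dy$, then the semigroup $(P_t^D)_{t\ge0}$ is compact on $L^2(D;dx)$.
   Context: $|A|$ denotes Lebesgue measure; $\Theta^{-1}(r)=\inf\{s>0:\Theta(s)\le r\}$ with $\inf\emptyset=\infty$. Setting. $J\ge0$ is a symmetric Borel function on $\mathbb R^d\times\mathbb R^d\setminus\{(x,x):x\in\mathbb R^d\}$ with $\sup_x\int_{y\ne x}\min\{1,|x-y|^2\}J(x,y)\,dy<\infty$. Let $\mathcal E(f,f)=\iint_{x\ne y}(f(x)-f(y))^2J(x,y)\,dx\,dy$ and let $\mathcal F$ be the closure of $C_c^\infty(\mathbb R^d)$ under $(\mathcal E(f,f)+\int f^2dx)^{1/2}$; $(\mathcal E,\mathcal F)$ is a regular Dirichlet form on $L^2(\mathbb R^d;dx)$ with associated symmetric Hunt process $X=(X_t)_{t\ge0}$. Standing assumptions: $X$ can be started from every $x\in\mathbb R^d$ (law $\mathbb P^x$, expectation $\mathbb E^x$) and has a transition density $p(t,x,y)\ge0$, i.e. $\mathbb E^xf(X_t)=\int p(t,x,y)f(y)\,dy$. For open $D\subset\mathbb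 R^d$ let $\tau_D=\inf\{t>0:X_t\notin D\}$. The process $X^D$ killed upon exiting $D$ has transition density (Dirichlet heat kernel) $p^D(t,x,y)=p(t,x,y)-\mathbb E^x[p(t-\tau_D,X_{\tau_D},y)1_{\{t\ge\tau_D\}}]$ for $x,y\in D$, and Dirichlet semigroup $P_t^Df(x)=\int_Dp^D(t,x,y)f(y)\,dy$ on $L^2(D;dx)$. Standing assumption: for every $t>0$, $p^D(t,\cdot,\cdot)$ is bounded, continuous and strictly positive on $D\times D$. *)

theory Defs
  imports "HOL-Probability.Probability"
begin

text \<open>
  The state space \<open>\<real>\<^sup>d\<close> is a type of class \<open>euclidean_space\<close>. The cemetery \<open>\<Delta>\<close> is \<^term>\<open>None\<close>, and a
  function \<open>f\<close> on \<open>\<real>\<^sup>d\<close> is extended by \<open>f(\<Delta>) = 0\<close>. The time axis \<open>[0,\<infinity>]\<close> of the processes is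
  \<^typ>\<open>ennreal\<close>.
\<close>

section \<open>Function spaces\<close>

fun C_k :: "nat \<Rightarrow> ('a::euclidean_space \<Rightarrow> real) \<Rightarrow> bool" where
  "C_k 0 f \<longleftrightarrow> continuous_on UNIV f"
| "C_k (Suc k) f \<longleftrightarrow>
     (\<exists>f'. (\<forall>x. (f has_derivative f' x) (at x)) \<and> (\<forall>b\<in>Basis. C_k k (\<lambda>x. f' x b)))"

definition Cc_infinity :: "('a::euclidean_space \<Rightarrow> real) set" where
  "Cc_infinity = {f. (\<forall>k. C_k k f) \<and> compact (closure {x. f x \<noteq> 0})}"

text \<open>Elements of \<open>L\<^sup>2\<close> are handled through measurable representatives.\<close>

definition L2 :: "'a measure \<Rightarrow> ('a \<Rightarrow> real) set" where
  "L2 N = {f \<in> borel_measurable N. integrable N (\<lambda>x. (f x)\<^sup>2)}"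

text \<open>
  \<open>T\<close> maps \<open>L\<^sup>2\<close> to itself, and the image of every \<open>L\<^sup>2\<close>-bounded sequence has a subsequence that
  converges in \<open>L\<^sup>2\<close>. Linearity is not part of the definition; it is only applied to integral
  operators.
\<close>

definition compact_operator_L2 :: "'a measure \<Rightarrow> (('a \<Rightarrow> real) \<Rightarrow> 'a \<Rightarrow> real) \<Rightarrow> bool" where
  "compact_operator_L2 N T \<longleftrightarrow>
     (\<forall>f\<in>L2 N. T f \<in> L2 N) \<and>
     (\<forall>f :: nat \<Rightarrow> 'a \<Rightarrow> real. \<forall>C::real.
        (\<forall>n. f n \<in> L2 N \<and> (\<integral>x. (f n x)\<^sup>2 \<partial>N) \<le> C) \<longrightarrow>
        (\<exists>r g. strict_mono (r :: nat \<Rightarrow> nat) \<and> g \<in> L2 N \<and>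
           (\<lambda>n. \<integral>x. (T (f (r n)) x - g x)\<^sup>2 \<partial>N) \<longlonglongrightarrow> 0))"

section \<open>The jump kernel and its Dirichlet form\<close>

definition jump_kernel :: "('a::euclidean_space \<Rightarrow> 'a \<Rightarrow> real) \<Rightarrow> bool" where
  "jump_kernel J \<longleftrightarrow>
     (\<lambda>(x, y). J x y) \<in> borel_measurable (restrict_space borel {(x, y). x \<noteq> y}) \<and>
     (\<forall>x y. x \<noteq> y \<longrightarrow> J x y \<ge> 0 \<and> J x y = J y x) \<and>
     (SUP x. \<integral>\<^sup>+ y\<in>{y. y \<noteq> x}. ennreal (min 1 ((norm (x - y))\<^sup>2) * J x y) \<partial>lborel) < \<infinity>"

definition energy :: "('a::euclidean_space \<Rightarrow> 'a \<Rightarrow> real) \<Rightarrow> ('a \<Rightarrow> real) \<Rightarrow> ennreal" where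
  "energy J f =
     (\<integral>\<^sup>+ z\<in>{(x, y). x \<noteq> y}.
        ennreal ((f (fst z) - f (snd z))\<^sup>2 * J (fst z) (snd z)) \<partial>(lborel \<Otimes>\<^sub>M lborel))"

text \<open>
  Closure of \<^const>\<open>Cc_infinity\<close> in \<open>L\<^sup>2\<close> under the norm whose square is
  \<open>\<E>(f,f) + \<integral> f\<^sup>2 dx\<close>.
\<close>

definition form_domain :: "('a::euclidean_space \<Rightarrow> 'a \<Rightarrow> real) \<Rightarrow> ('a \<Rightarrow> real) set" where
  "form_domain J =
     {f \<in> L2 lborel. \<forall>\<epsilon>>0. \<exists>\<phi>\<in>Cc_infinity.
        energy J (\<lambda>x. f x - \<phi> x) + (\<integral>\<^sup>+ x. ennreal ((f x - \<phi> x)\<^sup>2) \<partial>lborel) < \<epsilon>}"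

definition killing_rate ::
  "('a::euclidean_space \<Rightarrow> 'a \<Rightarrow> real) \<Rightarrow> 'a set \<Rightarrow> 'a \<Rightarrow> ennreal" where
  "killing_rate J D x = (\<integral>\<^sup>+ y\<in>- D. ennreal (J x y) \<partial>lborel)"

section \<open>Hunt processes\<close>

abbreviation cemetery_top :: "'a::euclidean_space option topology" where
  "cemetery_top \<equiv> Alexandroff_compactification euclidean"

definition cemetery_borel :: "'a::euclidean_space option measure" where
  "cemetery_borel = sigma UNIV {U. openin cemetery_top U}"

text \<open>
  A Hunt process \<open>(\<Omega>, \<M>, \<M>\<^sub>t, X\<^sub>t, \<theta>\<^sub>t, P\<^sup>x)\<close> in the sense of Blumenthal--Getoor and
  Fukushima--Oshima--Takeda, where \<open>P\<^sup>x\<close> is given for every \<open>x\<close> in \<open>\<real>\<^sup>d \<union> {\<Delta>}\<close>. The strong Markov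
  property contains the simple one (constant stopping times). Both the strong Markov property and
  quasi-left-continuity are asserted under every \<open>P\<^sup>x\<close>; by integration in \<open>x\<close> this gives them under
  every initial law, for stopping times of the right-continuous natural filtration.
\<close>

locale hunt_process = filtration "space M" Fl
  for M :: "'w measure" and Fl :: "ennreal \<Rightarrow> 'w measure" +
  fixes X :: "ennreal \<Rightarrow> 'w \<Rightarrow> 'a::euclidean_space option"
    and \<theta> :: "ennreal \<Rightarrow> 'w \<Rightarrow> 'w"
    and P :: "'a option \<Rightarrow> 'w measure"
  assumes prob_space_P: "\<And>x. prob_space (P x)"
    and sets_P: "\<And>x. sets (P x) = sets M"
    and sets_Fl: "\<And>t. sets (Fl t) \<subseteq> sets M"
    and Fl_right_continuous: "\<And>t. t < \<infinity> \<Longrightarrow> sets (Fl t) = (\<Inter>s\<in>{t<..}. sets (Fl s))"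
    and adapted: "\<And>t. X t \<in> Fl t \<rightarrow>\<^sub>M cemetery_borel"
    and kernel: "\<And>t E. E \<in> sets cemetery_borel \<Longrightarrow>
          (\<lambda>x. measure (P x) {\<omega> \<in> space M. X t \<omega> \<in> E}) \<in> borel_measurable cemetery_borel"
    and normal: "\<And>x. AE \<omega> in P x. X 0 \<omega> = x"
    and X_infinity: "\<And>\<omega>. \<omega> \<in> space M \<Longrightarrow> X \<infinity> \<omega> = None"
    and absorbing: "\<And>s t \<omega>. \<omega> \<in> space M \<Longrightarrow> s \<le> t \<Longrightarrow> X s \<omega> = None \<Longrightarrow> X t \<omega> = None"
    and shift_space: "\<And>t \<omega>. \<omega> \<in> space M \<Longrightarrow> \<theta> t \<omega> \<in> space M"
    and shift: "\<And>s t \<omega>. \<omega> \<in> space M \<Longrightarrow> X s (\<theta> t \<omega>) = X (s + t) \<omega>"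
    and right_continuous: "\<And>t \<omega>. \<omega> \<in> space M \<Longrightarrow> t < \<infinity> \<Longrightarrow>
          limitin cemetery_top (\<lambda>s. X s \<omega>) (X t \<omega>) (at_right t)"
    and left_limits: "\<And>t \<omega>. \<omega> \<in> space M \<Longrightarrow> 0 < t \<Longrightarrow> t < \<infinity> \<Longrightarrow>
          \<exists>l. limitin cemetery_top (\<lambda>s. X s \<omega>) l (at_left t)"
    and strong_markov: "\<And>x \<sigma> s E. stopping_time Fl \<sigma> \<Longrightarrow> E \<in> sets cemetery_borel \<Longrightarrow>
          AE \<omega> in P x.
            real_cond_exp (P x) (pre_sigma \<sigma>) (indicator {\<omega> \<in> space M. X (\<sigma> \<omega> + s) \<omega> \<in> E}) \<omega>
            = measure (P (X (\<sigma> \<omega>) \<omega>)) {\<omega>' \<in> space M. X s \<omega>' \<in> E}"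
    and quasi_left_continuous: "\<And>x \<sigma>n \<sigma>.
          (\<And>n::nat. stopping_time Fl (\<sigma>n n)) \<Longrightarrow>
          (\<And>\<omega>. \<omega> \<in> space M \<Longrightarrow> incseq (\<lambda>n. \<sigma>n n \<omega>) \<and> \<sigma> \<omega> = (SUP n. \<sigma>n n \<omega>)) \<Longrightarrow>
          AE \<omega> in P x. \<sigma> \<omega> < \<infinity> \<longrightarrow>
            limitin cemetery_top (\<lambda>n. X (\<sigma>n n \<omega>) \<omega>) (X (\<sigma> \<omega>) \<omega>) sequentially"

definition semigroup ::
  "('a option \<Rightarrow> 'w measure) \<Rightarrow> (ennreal \<Rightarrow> 'w \<Rightarrow> 'a::euclidean_space option)
     \<Rightarrow> real \<Rightarrow> ('a \<Rightarrow> real) \<Rightarrow> 'a \<Rightarrow> real" where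
  "semigroup P X t f x = (\<integral>\<omega>. case_option 0 f (X (ennreal t) \<omega>) \<partial>P (Some x))"

text \<open>
  The process is symmetric with respect to Lebesgue measure, and \<open>(\<E>, \<F>)\<close> is the Dirichlet form of
  its \<open>L\<^sup>2\<close>-semigroup: \<open>\<F>\<close> consists of the \<open>u \<in> L\<^sup>2\<close> for which
  \<open>lim\<^bsub>t\<down>0\<^esub> (u - P\<^sub>t u, u) / t\<close> is finite, and \<open>\<E>(u,u)\<close> is this limit. On the rest of \<open>L\<^sup>2\<close> the
  (monotone) limit is \<open>\<infinity>\<close>.
\<close>

definition associated_with_form ::
  "('a option \<Rightarrow> 'w measure) \<Rightarrow> (ennreal \<Rightarrow> 'w \<Rightarrow> 'a::euclidean_space option)
     \<Rightarrow> (('a \<Rightarrow> real) \<Rightarrow> ennreal) \<Rightarrow> ('a \<Rightarrow> real) set \<Rightarrow> bool" where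
  "associated_with_form P X \<E> \<F> \<longleftrightarrow>
     (\<forall>t>0. \<forall>f\<in>L2 lborel. \<forall>g\<in>L2 lborel.
        (\<integral>x. semigroup P X t f x * g x \<partial>lborel) = (\<integral>x. f x * semigroup P X t g x \<partial>lborel)) \<and>
     (\<forall>u\<in>L2 lborel.
        ((\<lambda>t. ennreal ((\<integral>x. (u x - semigroup P X t u x) * u x \<partial>lborel) / t))
           \<longlongrightarrow> (if u \<in> \<F> then \<E> u else \<infinity>)) (at_right 0))"

text \<open>
  The last clause fixes the value at time \<open>0\<close>, which enters the definition of the Dirichlet heat
  kernel on \<open>{\<tau>\<^sub>D = t}\<close>, off the diagonal, in accordance with \<open>p(0,x,\<cdot>) = \<delta>\<^sub>x\<close>.
\<close>

definition transition_density ::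
  "('a option \<Rightarrow> 'w measure) \<Rightarrow> (ennreal \<Rightarrow> 'w \<Rightarrow> 'a::euclidean_space option)
     \<Rightarrow> (real \<Rightarrow> 'a \<Rightarrow> 'a \<Rightarrow> real) \<Rightarrow> bool" where
  "transition_density P X p \<longleftrightarrow>
     (\<lambda>(t, x, y). p t x y) \<in> borel_measurable (restrict_space borel ({0<..} \<times> UNIV)) \<and>
     (\<forall>t>0. \<forall>x y. p t x y \<ge> 0) \<and>
     (\<forall>t>0. \<forall>x. \<forall>f :: 'a \<Rightarrow> ennreal. f \<in> borel_measurable borel \<longrightarrow>
        (\<integral>\<^sup>+ \<omega>. case_option 0 f (X (ennreal t) \<omega>) \<partial>P (Some x))
          = (\<integral>\<^sup>+ y. ennreal (p t x y) * f y \<partial>lborel)) \<and>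
     (\<forall>x y. x \<noteq> y \<longrightarrow> p 0 x y = 0)"

section \<open>The process killed upon exiting \<open>D\<close>\<close>

definition exit_time ::
  "(ennreal \<Rightarrow> 'w \<Rightarrow> 'a::euclidean_space option) \<Rightarrow> 'a set \<Rightarrow> 'w \<Rightarrow> ennreal" where
  "exit_time X D \<omega> = Inf {t. 0 < t \<and> X t \<omega> \<notin> Some ` D}"

text \<open>
  The expectation is taken with respect to the completion of \<open>P\<^sup>x\<close>, because \<open>\<tau>\<^sub>D\<close> is in general only
  measurable up to null sets.
\<close>

definition dirichlet_heat_kernel ::
  "('a option \<Rightarrow> 'w measure) \<Rightarrow> (ennreal \<Rightarrow> 'w \<Rightarrow> 'a::euclidean_space option)
     \<Rightarrow> (real \<Rightarrow> 'a \<Rightarrow> 'a \<Rightarrow> real) \<Rightarrow> 'a set \<Rightarrow> real \<Rightarrow> 'a \<Rightarrow> 'a \<Rightarrow> real" where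
  "dirichlet_heat_kernel P X p D t x y =
     p t x y -
     (\<integral>\<omega>. (let \<tau> = exit_time X D \<omega> in
            if \<tau> \<le> ennreal t then case_option 0 (\<lambda>z. p (t - enn2real \<tau>) z y) (X \<tau> \<omega>) else 0)
        \<partial>completion (P (Some x)))"

definition dirichlet_semigroup ::
  "('a option \<Rightarrow> 'w measure) \<Rightarrow> (ennreal \<Rightarrow> 'w \<Rightarrow> 'a::euclidean_space option)
     \<Rightarrow> (real \<Rightarrow> 'a \<Rightarrow> 'a \<Rightarrow> real) \<Rightarrow> 'a set \<Rightarrow> real \<Rightarrow> ('a \<Rightarrow> real) \<Rightarrow> 'a \<Rightarrow> real" where
  "dirichlet_semigroup P X p D t f x =
     (\<integral>y. dirichlet_heat_kernel P X p D t x y * f y \<partial>restrict_space lborel D)"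

section \<open>Generalized inverse\<close>

definition Theta_inv :: "(real \<Rightarrow> real) \<Rightarrow> real \<Rightarrow> ennreal" where
  "Theta_inv \<Theta> r = (INF s\<in>{s. 0 < s \<and> \<Theta> s \<le> r}. ennreal s)"

end

theory Submission
  imports Defs "HOL-Complex_Analysis.Great_Picard"
begin

text \<open>
  Let \<open>Q\<^sub>h f = 1\<^sub>D P\<^sub>h (1\<^sub>D f)\<close>, a symmetric contraction of \<open>L\<^sup>2\<close>. For \<open>h = t/n\<close> and \<open>f \<ge> 0\<close> the strong
  Markov property at the exit time gives \<open>P\<^sub>t\<^sup>D f \<le> Q\<^sub>h\<^sup>n f\<close>. The sequence \<open>\<parallel>Q\<^sub>h\<^sup>k f\<parallel>\<^sup>2\<close> is convex and decreasing
  in \<open>k\<close>, and \<open>P\<^sub>s \<ge> Q\<^sub>h\<^sup>m\<close> for \<open>s = mh\<close>, so \<open>u = Q\<^sub>h\<^sup>n f\<close> satisfies \<open>(u - P\<^sub>s u, u) / s \<le> \<parallel>f\<parallel>\<^sup>2 / (2t)\<close> for even \<open>m\<close>. Refining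
  \<open>h\<close> dyadically and then letting \<open>s\<close> tend to \<open>0\<close> yields a function \<open>v \<ge> P\<^sub>t\<^sup>D f\<close> vanishing off \<open>D\<close> with
  \<open>\<E>(v,v) \<le> \<parallel>f\<parallel>\<^sup>2 / (2t)\<close>. As \<open>\<E>(v,v) \<ge> \<integral>\<^sub>D v\<^sup>2 V\<^sub>D\<close>, the mass of \<open>(P\<^sub>t\<^sup>D f)\<^sup>2\<close> on \<open>{V\<^sub>D \<ge> r}\<close> is at most
  \<open>\<parallel>f\<parallel>\<^sup>2 / (2tr)\<close>. On \<open>{V\<^sub>D < r}\<close>, which has finite measure, the functions \<open>P\<^sub>t\<^sup>D f\<^sub>n\<close> are uniformly bounded when
  \<open>(f\<^sub>n)\<close> is bounded in \<open>L\<^sup>2\<close>, and along a subsequence they converge pointwise.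
\<close>

section \<open>Processes at random times\<close>

text \<open>Spectral calculus for \<open>P_t^D\<close> itself would give an energy bound directly,
  but only after symmetry of the Dirichlet heat kernel and the form of the killed process have been
  established. The operators \<open>Q_h\<close> are symmetric because \<open>P_h\<close> is, and
  they touch the killed process only through a pointwise inequality for nonnegative functions. This
  suffices because the integral of \<open>v^2 V_D\<close> is monotone in \<open>v >= 0\<close>.

  The evenness of \<open>m\<close> comes from symmetry: \<open>(Q^(2k) u, u)\<close> is the squared
  norm of \<open>Q^k u\<close>, so only even powers lead back to the sequence of squared norms. Over
  \<open>m = 2k\<close> further steps of length \<open>t/n\<close> this yields a difference of at
  most \<open>k/(n+1)\<close> times the squared norm of \<open>f\<close>, for a time lag
  \<open>s = 2kt/n\<close>; the quotient of the two coefficients is below \<open>1/(2t)\<close> for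
  all \<open>k\<close> and \<open>n\<close>.

  The order of the limits is forced. For a fixed mesh \<open>h\<close> the estimate is available
  only at multiples of \<open>2h\<close>, whereas the form is a limit as \<open>s\<close> tends to
  \<open>0\<close>. The mesh is therefore refined first, with \<open>s\<close> fixed, and halving it
  makes the functions decrease, so that a limit exists pointwise.\<close>

lemma space_cemetery_borel [simp]: "space cemetery_borel = UNIV"
  unfolding cemetery_borel_def by (simp add: space_measure_of_conv)

lemma openin_imp_cemetery_borel: "openin cemetery_top U \<Longrightarrow> U \<in> sets cemetery_borel"
  unfolding cemetery_borel_def by (subst sets_measure_of) (auto intro: sigma_sets.Basic)

lemma Some_image_in_cemetery_borel:
  fixes B :: "'a::euclidean_space set"
  assumes "B \<in> sets borel"
  shows "Some ` B \<in> sets cemetery_borel"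
proof -
  have "B \<in> sigma_sets UNIV {S. open S}"
    using assms by (simp add: borel_def)
  then show ?thesis
  proof induction
    case (Basic a)
    then show ?case by (intro openin_imp_cemetery_borel) auto
  next
    case Empty
    then show ?case by simp
  next
    case (Compl a)
    have "Some ` (UNIV :: 'a set) \<in> sets cemetery_borel"
      by (intro openin_imp_cemetery_borel) simp
    moreover have "Some ` (UNIV - a) = Some ` UNIV - Some ` a" by auto
    ultimately show ?case using Compl by auto
  next
    case (Union a)
    then show ?case by (simp add: image_UN)
  qed
qed

lemma None_in_cemetery_borel: "{None :: 'a::euclidean_space option} \<in> sets cemetery_borel"
proof -
  have "{None :: 'a option} = space cemetery_borel - Some ` UNIV"
    using notin_range_Some by fastforce
  then show ?thesis using Some_image_in_cemetery_borel[of "UNIV :: 'a set"] by (metis sets.compl_sets sets.top space_borel)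
qed

lemma measurable_case_option_cemetery [measurable]:
  fixes f :: "'a::euclidean_space \<Rightarrow> 'b"
  assumes f: "f \<in> borel \<rightarrow>\<^sub>M N" and c: "c \<in> space N"
  shows "(\<lambda>z. case_option c f z) \<in> cemetery_borel \<rightarrow>\<^sub>M N"
proof (rule measurableI)
  fix z :: "'a option" assume "z \<in> space cemetery_borel"
  then show "case_option c f z \<in> space N"
    using c measurable_space[OF f] by (cases z) auto
next
  fix A assume A: "A \<in> sets N"
  have 1: "Some ` (f -` A) \<in> sets cemetery_borel"
    using measurable_sets[OF f A] by (intro Some_image_in_cemetery_borel) simp
  have "case_option c f -` A \<inter> space cemetery_borel = (if c \<in> A then {None} else {}) \<union> Some ` (f -` A)"
    by (auto split: option.splits)
  then show "case_option c f -` A \<inter> space cemetery_borel \<in> sets cemetery_borel"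
    using 1 sets.Un[OF None_in_cemetery_borel 1] by (cases "c \<in> A") simp_all
qed

text \<open>Open sets of finite points suffice as tests: an open neighbourhood of
  \<open>None\<close> is the complement of a closed set \<open>C\<close> of finite points, and
  \<open>C\<close> consists of all finite points except those of the open set
  \<open>- C\<close>.\<close>

lemma measurable_cemeteryI:
  fixes Y :: "'w \<Rightarrow> 'a::euclidean_space option"
  assumes "\<And>U. open U \<Longrightarrow> {\<omega> \<in> space M. Y \<omega> \<in> Some ` U} \<in> sets M"
  shows "Y \<in> M \<rightarrow>\<^sub>M cemetery_borel"
  unfolding cemetery_borel_def
proof (rule measurable_measure_of)
  fix V :: "'a option set" assume "V \<in> {U. openin cemetery_top U}"
  then consider U where "open U" "V = Some ` U"
    | C where "closed C" "V = insert None (Some ` (UNIV - C))"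
    by (auto simp: openin_Alexandroff_compactification)
  then show "Y -` V \<inter> space M \<in> sets M"
  proof cases
    case 1
    then show ?thesis using assms[of U] by (simp add: vimage_def Int_def conj_commute)
  next
    case 2
    have "Y -` V \<inter> space M =
      space M - ({\<omega> \<in> space M. Y \<omega> \<in> Some ` UNIV} - {\<omega> \<in> space M. Y \<omega> \<in> Some ` (- C)})"
      unfolding 2 by auto
    then show ?thesis using assms[of UNIV] assms[of "- C"] 2 by auto
  qed
qed auto

lemma limitin_eventually_mem:
  "limitin X f l F \<Longrightarrow> openin X U \<Longrightarrow> l \<in> U \<Longrightarrow> \<forall>\<^sub>F x in F. f x \<in> U"
  by (simp add: limitin_def)

text \<open>The limit lies in \<open>U\<close> exactly when the sequence eventually stays in one
  member of a compact exhaustion of \<open>U\<close>. A limit in \<open>U\<close> is interior to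
  some \<open>C m\<close>; conversely, a compact set of finite points is closed in the
  compactification, so the limit cannot leave it.\<close>

lemma measurable_limitin_cemetery:
  fixes Y :: "'w \<Rightarrow> 'a::euclidean_space option"
  assumes meas: "\<And>n::nat. Z n \<in> M \<rightarrow>\<^sub>M cemetery_borel"
    and lim: "\<And>\<omega>. \<omega> \<in> space M \<Longrightarrow> limitin cemetery_top (\<lambda>n. Z n \<omega>) (Y \<omega>) sequentially"
  shows "Y \<in> M \<rightarrow>\<^sub>M cemetery_borel"
proof (rule measurable_cemeteryI)
  fix U :: "'a set" assume "open U"
  then obtain C where C: "\<And>n. compact (C n)" "\<And>n. C n \<subseteq> U" "\<And>n. C n \<subseteq> interior (C (Suc n))" "\<Union>(range C) = U"
    by (rule open_Union_compact_subsets) blast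
  have mC: "{\<omega> \<in> space M. Z n \<omega> \<in> Some ` C m} \<in> sets M" for n m
    using measurable_sets[OF meas[of n] Some_image_in_cemetery_borel[of "C m"]] C(1)[of m]
    by (simp add: vimage_def Int_def conj_commute borel_compact)
  have "{\<omega> \<in> space M. Y \<omega> \<in> Some ` U} = (\<Union>m. \<Union>k. \<Inter>n\<in>{k..}. {\<omega> \<in> space M. Z n \<omega> \<in> Some ` C m})" (is "?L = ?R")
  proof (intro equalityI subsetI)
    fix \<omega> assume "\<omega> \<in> ?L"
    then obtain z where z: "\<omega> \<in> space M" "Y \<omega> = Some z" "z \<in> U" by auto
    then obtain m where "z \<in> C m" using C(4) by auto
    then have "Y \<omega> \<in> Some ` interior (C (Suc m))" using C(3) z by auto
    moreover have "openin cemetery_top (Some ` interior (C (Suc m)))" by simp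
    ultimately have "\<forall>\<^sub>F n in sequentially. Z n \<omega> \<in> Some ` interior (C (Suc m))"
      by (intro limitin_eventually_mem[OF lim[OF z(1)]])
    then obtain k where "\<forall>n\<ge>k. Z n \<omega> \<in> Some ` interior (C (Suc m))"
      by (auto simp: eventually_sequentially)
    then have "\<forall>n\<ge>k. Z n \<omega> \<in> Some ` C (Suc m)"
      using image_mono[OF interior_subset[of "C (Suc m)"], of Some] by (auto simp del: image_mono)
    then have "\<omega> \<in> (\<Inter>n\<in>{k..}. {\<omega> \<in> space M. Z n \<omega> \<in> Some ` C (Suc m)})"
      using z(1) by simp
    then show "\<omega> \<in> ?R" by (intro UN_I[OF UNIV_I])
  next
    fix \<omega> assume "\<omega> \<in> ?R"
    then obtain m k where mk: "\<And>n. n \<ge> k \<Longrightarrow> \<omega> \<in> space M \<and> Z n \<omega> \<in> Some ` C m" by auto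
    then have w: "\<omega> \<in> space M" by blast
    have "Y \<omega> \<in> Some ` C m"
    proof (rule ccontr)
      assume "Y \<omega> \<notin> Some ` C m"
      moreover have "closedin cemetery_top (Some ` C m)"
        using C(1)[of m] by (simp add: compact_imp_closed)
      then have "openin cemetery_top (topspace cemetery_top - Some ` C m)" by blast
      moreover have "Y \<omega> \<in> topspace cemetery_top" using lim[OF w] by (simp add: limitin_def)
      ultimately have "\<forall>\<^sub>F n in sequentially. Z n \<omega> \<in> topspace cemetery_top - Some ` C m"
        by (intro limitin_eventually_mem[OF lim[OF w]]) blast+
      then have "\<forall>\<^sub>F n in sequentially. False"
        using eventually_ge_at_top[of k] by eventually_elim (metis DiffD2 mk)
      then show False by simp
    qed
    then show "\<omega> \<in> ?L" using w C(2)[of m] by auto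
  qed
  also have "?R \<in> sets M"
    using mC by (intro sets.countable_UN sets.countable_INT') auto
  finally show "{\<omega> \<in> space M. Y \<omega> \<in> Some ` U} \<in> sets M" .
qed

text \<open>Floor plus one instead of the ceiling: the value exceeds \<open>r\<close> strictly, also
  when \<open>r\<close> is a grid point, as convergence in \<open>at_right\<close> demands. The grid
  is countable, which reduces random times to deterministic ones.\<close>

definition dyadic_above :: "nat \<Rightarrow> real \<Rightarrow> real" where
  "dyadic_above n r = real (nat \<lfloor>2 ^ n * r\<rfloor> + 1) / 2 ^ n"

lemma dyadic_above_gt: "r < dyadic_above n r"
proof -
  have "2 ^ n * r < real (nat \<lfloor>2 ^ n * r\<rfloor> + 1)" by linarith
  then show ?thesis unfolding dyadic_above_def by (simp add: field_simps)
qed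

lemma dyadic_above_pos: "0 < dyadic_above n r"
  unfolding dyadic_above_def by simp

lemma dyadic_above_le: "0 \<le> r \<Longrightarrow> dyadic_above n r \<le> r + (1/2) ^ n"
proof -
  assume "0 \<le> r"
  then have "0 \<le> 2 ^ n * r" by simp
  then have "real (nat \<lfloor>2 ^ n * r\<rfloor> + 1) \<le> 2 ^ n * r + 1" by linarith
  then show ?thesis unfolding dyadic_above_def by (simp add: field_simps)
qed

lemma dyadic_above_tendsto: "0 \<le> r \<Longrightarrow> (\<lambda>n. dyadic_above n r) \<longlonglongrightarrow> r"
proof (rule tendsto_sandwich[where f = "\<lambda>_. r" and h = "\<lambda>n. r + (1/2) ^ n"])
  show "(\<lambda>n. r + (1/2) ^ n) \<longlonglongrightarrow> r"
    using LIMSEQ_realpow_zero[of "1/2::real"] by (auto intro!: tendsto_eq_intros)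
qed (auto intro!: always_eventually less_imp_le[OF dyadic_above_gt] dyadic_above_le)

lemma limitin_compose_filterlim:
  "limitin X f l F \<Longrightarrow> filterlim s F G \<Longrightarrow> limitin X (\<lambda>n. f (s n)) l G"
  unfolding limitin_def by (auto dest: eventually_compose_filterlim)

context hunt_process begin

lemma space_Fl: "space (Fl t) = space M"
  by (rule space_F)

lemma space_P: "space (P x) = space M"
  by (rule sets_eq_imp_space_eq[OF sets_P])

lemma X_measurable [measurable]: "X t \<in> M \<rightarrow>\<^sub>M cemetery_borel"
  using adapted[of t] sets_Fl[of t] by (auto simp: measurable_def space_Fl)

text \<open>By right-continuity the position at \<open>T\<close> is the limit of the positions at
  dyadic times above \<open>T\<close>. Each of these takes countably many values, so only fixed
  times have to be measurable.\<close>

lemma X_at_random_time [measurable]: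
  assumes T [measurable]: "T \<in> borel_measurable M"
  shows "(\<lambda>\<omega>. X (T \<omega>) \<omega>) \<in> M \<rightarrow>\<^sub>M cemetery_borel"
proof (rule measurable_limitin_cemetery)
  fix n :: nat
  \<comment> \<open>The index \<open>None\<close> stands for the time infinity, which the dyadic
    times leave out.\<close>
  let ?g = "\<lambda>\<omega>. if T \<omega> = \<infinity> then None else Some (nat \<lfloor>2 ^ n * enn2real (T \<omega>)\<rfloor>)"
  let ?X = "\<lambda>i::nat option. X (case i of None \<Rightarrow> \<infinity> | Some k \<Rightarrow> ennreal (real (k + 1) / 2 ^ n))"
  have "(\<lambda>\<omega>. ?X (?g \<omega>) \<omega>) \<in> M \<rightarrow>\<^sub>M cemetery_borel"
    by (rule measurable_compose_countable) (auto split: option.splits)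
  moreover have "(\<lambda>\<omega>. ?X (?g \<omega>) \<omega>) =
      (\<lambda>\<omega>. X (if T \<omega> = \<infinity> then \<infinity> else ennreal (dyadic_above n (enn2real (T \<omega>)))) \<omega>)"
    by (auto simp: dyadic_above_def fun_eq_iff)
  ultimately show "(\<lambda>\<omega>. X (if T \<omega> = \<infinity> then \<infinity> else ennreal (dyadic_above n (enn2real (T \<omega>)))) \<omega>) \<in> M \<rightarrow>\<^sub>M cemetery_borel"
    by (rule back_subst)
next
  fix \<omega> assume w: "\<omega> \<in> space M"
  show "limitin cemetery_top (\<lambda>n. X (if T \<omega> = \<infinity> then \<infinity> else ennreal (dyadic_above n (enn2real (T \<omega>)))) \<omega>) (X (T \<omega>) \<omega>) sequentially"
  proof (cases "T \<omega> = \<infinity>")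
    case True
    then show ?thesis using X_infinity[OF w] by (simp add: limitin_def)
  next
    case False
    then obtain r where r: "T \<omega> = ennreal r" "0 \<le> r" by (cases "T \<omega>") auto
    have "filterlim (\<lambda>n. ennreal (dyadic_above n r)) (at_right (T \<omega>)) sequentially"
      unfolding filterlim_at r(1)
      using tendsto_ennrealI[OF dyadic_above_tendsto[OF r(2)]] r(2)
      by (auto intro!: always_eventually simp: dyadic_above_gt dyadic_above_pos ennreal_less_iff
          less_imp_neq[THEN not_sym])
    moreover have "T \<omega> < \<infinity>" using False by (simp add: less_top)
    ultimately have "limitin cemetery_top (\<lambda>n. X (ennreal (dyadic_above n r)) \<omega>) (X (T \<omega>) \<omega>) sequentially"
      by (intro limitin_compose_filterlim[OF right_continuous[OF w]])
    then show ?thesis using False r by simp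
  qed
qed

end

section \<open>Exit times and the strong Markov property\<close>

context hunt_process begin

section \<open>Entry times of open sets and exit from an open set\<close>

lemma X_mem_sets_Fl: "openin cemetery_top U \<Longrightarrow> {\<omega> \<in> space M. X t \<omega> \<in> U} \<in> sets (Fl t)"
  using measurable_sets[OF adapted[of t] openin_imp_cemetery_borel[of U]]
  by (simp add: space_Fl vimage_def Int_def conj_commute)

lemma sets_Fl_less: "s < t \<Longrightarrow> A \<in> sets (Fl s) \<Longrightarrow> A \<in> sets (Fl t)"
  by (rule subsetD[OF sets_F_mono[OF less_imp_le]])

text \<open>A right-continuous path that is in an open set stays there for a short while, so an
  entry before \<open>t\<close> is already seen at one of countably many times before
  \<open>t\<close>.\<close>

lemma entry_time_less_sets:
  assumes U: "openin cemetery_top U"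
  shows "{\<omega> \<in> space M. (Inf {s. X s \<omega> \<in> U}) < t} \<in> sets (Fl t)"
proof -
  obtain Q :: "ennreal set" where Q: "countable Q" "\<And>V. open V \<Longrightarrow> V \<noteq> {} \<Longrightarrow> \<exists>q\<in>Q. q \<in> V"
    using countable_dense_setE by blast
  have "{\<omega> \<in> space M. (Inf {s. X s \<omega> \<in> U}) < t} = (\<Union>q\<in>Q \<inter> {..<t}. {\<omega> \<in> space M. X q \<omega> \<in> U})"
    (is "?L = ?R")
  proof (intro equalityI subsetI)
    fix \<omega> assume "\<omega> \<in> ?L"
    then obtain s where w: "\<omega> \<in> space M" and s: "s < t" "X s \<omega> \<in> U"
      by (auto simp: Inf_less_iff)
    then have "s < \<infinity>" using top.not_eq_extremum by fastforce
    have "\<forall>\<^sub>F r in at_right s. X r \<omega> \<in> U"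
      by (rule limitin_eventually_mem[OF right_continuous[OF w \<open>s < \<infinity>\<close>] U s(2)])
    then obtain b where b: "b > s" "\<And>y. y > s \<Longrightarrow> y < b \<Longrightarrow> X y \<omega> \<in> U"
      unfolding eventually_at_right[OF s(1)] by auto
    have "s < min b t" using b(1) s(1) by simp
    then have "{s<..<min b t} \<noteq> {}" by (simp del: min_less_iff_conj add: not_le)
    then obtain q where "q \<in> Q" "q \<in> {s<..<min b t}" using Q(2)[of "{s<..<min b t}"] by auto
    then show "\<omega> \<in> ?R" using b(2)[of q] w by auto
  next
    fix \<omega> assume "\<omega> \<in> ?R"
    then show "\<omega> \<in> ?L" by (auto simp: Inf_less_iff)
  qed
  also have "?R \<in> sets (Fl t)"
  proof (rule sets.countable_UN')
    show "(\<lambda>q. {\<omega> \<in> space M. X q \<omega> \<in> U}) ` (Q \<inter> {..<t}) \<subseteq> sets (Fl t)"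
      by (auto intro: sets_Fl_less X_mem_sets_Fl[OF U])
  qed (use Q(1) in auto)
  finally show ?thesis .
qed

text \<open>The strict inequality is known at every level, so the event for \<open>t\<close> is a
  countable intersection over levels in any interval right of \<open>t\<close>. It thus belongs to
  all later sigma-algebras, and right-continuity of the filtration brings it back to time
  \<open>t\<close>.\<close>

lemma entry_time_stopping:
  assumes U: "openin cemetery_top U"
  shows "stopping_time Fl (\<lambda>\<omega>. Inf {s. X s \<omega> \<in> U})"
proof
  let ?T = "\<lambda>\<omega>. Inf {s. X s \<omega> \<in> U}"
  fix t :: ennreal
  have "{\<omega> \<in> space M. ?T \<omega> \<le> t} \<in> sets (Fl t)"
  proof (cases "t = \<infinity>")
    case True
    then show ?thesis using sets.top[of "Fl t"] by (simp add: space_Fl)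
  next
    case False
    then have t: "t < \<infinity>" by (simp add: less_top)
    obtain Q :: "ennreal set" where Q: "countable Q" "\<And>V. open V \<Longrightarrow> V \<noteq> {} \<Longrightarrow> \<exists>q\<in>Q. q \<in> V"
      using countable_dense_setE by blast
    have dense_Q: "\<exists>q\<in>Q. a < q \<and> q < b" if "a < b" for a b :: ennreal
      using Q(2)[of "{a<..<b}"] dense[OF that] by auto
    have "{\<omega> \<in> space M. ?T \<omega> \<le> t} \<in> sets (Fl s)" if s: "t < s" for s
    proof -
      have "{\<omega> \<in> space M. ?T \<omega> \<le> t} = (\<Inter>q\<in>Q \<inter> {t<..<s}. {\<omega> \<in> space M. ?T \<omega> < q})" (is "?L = ?R")
      proof (intro equalityI subsetI)
        fix \<omega> assume "\<omega> \<in> ?L"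
        then show "\<omega> \<in> ?R" by auto
      next
        fix \<omega> assume R: "\<omega> \<in> ?R"
        have "\<omega> \<in> space M" using R dense_Q[OF s] by auto
        moreover have "?T \<omega> \<le> t"
        proof (rule ccontr)
          assume "\<not> ?T \<omega> \<le> t"
          then obtain q where "q \<in> Q" "t < q" "q < min (?T \<omega>) s"
            using dense_Q[of t "min (?T \<omega>) s"] s by (auto simp: not_le)
          moreover from this have "?T \<omega> < q" using R by auto
          ultimately show False by (auto dest: less_asym)
        qed
        ultimately show "\<omega> \<in> ?L" by simp
      qed
      also have "?R \<in> sets (Fl s)"
      proof (rule sets.countable_INT')
        show "(\<lambda>q. {\<omega> \<in> space M. ?T \<omega> < q}) ` (Q \<inter> {t<..<s}) \<subseteq> sets (Fl s)"
          by (auto intro: sets_Fl_less entry_time_less_sets[OF U])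
      qed (use Q(1) dense_Q[OF s] in auto)
      finally show ?thesis .
    qed
    then show ?thesis unfolding Fl_right_continuous[OF t] by auto
  qed
  then show "Measurable.pred (Fl t) (\<lambda>\<omega>. ?T \<omega> \<le> t)"
    by (simp add: pred_def space_Fl)
qed

lemma SUP_stopping:
  fixes \<sigma> :: "nat \<Rightarrow> 'w \<Rightarrow> ennreal"
  assumes "\<And>n. stopping_time Fl (\<sigma> n)"
  shows "stopping_time Fl (\<lambda>\<omega>. SUP n. \<sigma> n \<omega>)"
  using assms unfolding stopping_time_def SUP_le_iff by (auto intro!: pred_intros_countable)

text \<open>If the path were in the open set \<open>U\<close> at that time, right-continuity would
  keep it in \<open>U'\<close> at that time and shortly after it, and the infimum of the times spent
  outside \<open>U'\<close> would be larger.\<close>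

lemma X_entry_time_notin:
  assumes w: "\<omega> \<in> space M" and U: "openin cemetery_top U"
    and fin: "(Inf {s. X s \<omega> \<in> - U'}) < \<infinity>" and sub: "U \<subseteq> U'"
  shows "X (Inf {s. X s \<omega> \<in> - U'}) \<omega> \<notin> U"
proof
  let ?T = "Inf {s. X s \<omega> \<in> - U'}"
  assume XT: "X ?T \<omega> \<in> U"
  have "\<forall>\<^sub>F r in at_right ?T. X r \<omega> \<in> U"
    by (rule limitin_eventually_mem[OF right_continuous[OF w fin] U XT])
  then obtain b where b: "b > ?T" "\<And>y. y > ?T \<Longrightarrow> y < b \<Longrightarrow> X y \<omega> \<in> U"
    unfolding eventually_at_right[OF fin] by auto
  from b(1) obtain s where s: "X s \<omega> \<in> - U'" "s < b" by (auto simp: Inf_less_iff)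
  moreover have "?T \<le> s" using s by (auto intro: Inf_lower)
  ultimately show False using b(2)[of s] XT sub by (cases "s = ?T") (auto simp: less_le)
qed

text \<open>The second clause is what removes the event \<open>\<sigma> = t\<close> from the
  Dirichlet heat kernel: a position off \<open>D\<close> differs from every \<open>y\<close> in
  \<open>D\<close>.\<close>

abbreviation exits_at :: "'a set \<Rightarrow> ('w \<Rightarrow> ennreal) \<Rightarrow> 'a \<Rightarrow> bool" where
  "exits_at D \<sigma> x \<equiv> (AE \<omega> in P (Some x). exit_time X D \<omega> = \<sigma> \<omega> \<and> (\<sigma> \<omega> < \<infinity> \<longrightarrow> X (\<sigma> \<omega>) \<omega> \<notin> Some ` D))"

text \<open>
  The exit time is only the increasing limit of exit times from compact sets, up to a null set:
  this is where quasi-left-continuity enters.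
\<close>

lemma exit_time_stopping:
  assumes D: "open D"
  obtains \<sigma> where "stopping_time Fl \<sigma>"
    and "\<forall>x\<in>D. exits_at D \<sigma> x"
proof -
  obtain C where C: "\<And>n. compact (C n)" "\<And>n. C n \<subseteq> D" "\<And>n. C n \<subseteq> interior (C (Suc n))" "\<Union>(range C) = D"
    using open_Union_compact_subsets[OF D] by metis
  define \<sigma> where "\<sigma> n \<omega> = Inf {s. X s \<omega> \<in> - (Some ` C n)}" for n \<omega>
  have op: "openin cemetery_top (- (Some ` C n))" for n
  proof -
    have "closedin cemetery_top (Some ` C n)" using C(1)[of n] by (simp add: compact_imp_closed)
    then have "openin cemetery_top (topspace cemetery_top - Some ` C n)" by blast
    moreover have "topspace cemetery_top - Some ` C n = - (Some ` C n)"
      by (auto simp: UNIV_option_conv)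
    ultimately show ?thesis by simp
  qed
  have stop: "stopping_time Fl (\<sigma> n)" for n
    unfolding \<sigma>_def by (rule entry_time_stopping[OF op])
  have Cmono: "C n \<subseteq> C (Suc n)" for n using C(3)[of n] interior_subset by blast
  then have incC: "incseq C" by (rule incseq_SucI)
  have mono: "incseq (\<lambda>n. \<sigma> n \<omega>)" for \<omega>
    unfolding \<sigma>_def using Cmono by (intro incseq_SucI Inf_superset_mono) auto
  have exit_ge: "(SUP n. \<sigma> n \<omega>) \<le> exit_time X D \<omega>" for \<omega>
    unfolding \<sigma>_def exit_time_def using C(2)
    by (intro SUP_least Inf_greatest Inf_lower) auto
  show ?thesis
  proof
    show "stopping_time Fl (\<lambda>\<omega>. SUP n. \<sigma> n \<omega>)" by (rule SUP_stopping[OF stop])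
    show "\<forall>x\<in>D. exits_at D (\<lambda>\<omega>. SUP n. \<sigma> n \<omega>) x"
    proof
      fix x assume x: "x \<in> D"
      have "AE \<omega> in P (Some x). \<omega> \<in> space M" using AE_space[of "P (Some x)"] by (simp add: space_P)
      moreover have "AE \<omega> in P (Some x). (SUP n. \<sigma> n \<omega>) < \<infinity> \<longrightarrow>
          limitin cemetery_top (\<lambda>n. X (\<sigma> n \<omega>) \<omega>) (X (SUP n. \<sigma> n \<omega>) \<omega>) sequentially"
        by (rule quasi_left_continuous[OF stop]) (use mono in auto)
      ultimately show "exits_at D (\<lambda>\<omega>. SUP n. \<sigma> n \<omega>) x"
        using normal[of "Some x"]
      proof eventually_elim
        case (elim \<omega>)
        let ?S = "SUP n. \<sigma> n \<omega>"
        obtain m where m: "x \<in> C m" using x C(4) by auto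
        show ?case
        proof (cases "?S = \<infinity>")
          case True
          then have "exit_time X D \<omega> = \<infinity>" using exit_ge[of \<omega>] by (metis infinity_ennreal_def top_unique)
          then show ?thesis unfolding True by simp
        next
          case False
          then have fin: "?S < \<infinity>" using top.not_eq_extremum by (metis infinity_ennreal_def)
          have fin_n: "\<sigma> n \<omega> < \<infinity>" for n
            using fin by (meson SUP_upper UNIV_I le_less_trans)
          have notin: "X (\<sigma> n \<omega>) \<omega> \<notin> Some ` interior (C n)" for n
            unfolding \<sigma>_def
            by (rule X_entry_time_notin) (use elim fin_n[of n] interior_subset in \<open>auto simp: \<sigma>_def\<close>)
          \<comment> \<open>Quasi-left-continuity at the limit time: if the path were in
            \<open>D\<close> there, the positions at the times \<open>\<sigma> n \<omega>\<close>
            would eventually lie in the interior of one \<open>C (Suc k)\<close>, which for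
            \<open>n > k\<close> they have already left.\<close>
          have XS: "X ?S \<omega> \<notin> Some ` D"
          proof
            assume "X ?S \<omega> \<in> Some ` D"
            then obtain k where "X ?S \<omega> \<in> Some ` C k" using C(4) by auto
            then have "X ?S \<omega> \<in> Some ` interior (C (Suc k))" using C(3)[of k] by auto
            then have "\<forall>\<^sub>F n in sequentially. X (\<sigma> n \<omega>) \<omega> \<in> Some ` interior (C (Suc k))"
              using elim fin by (intro limitin_eventually_mem) auto
            then have "\<forall>\<^sub>F n in sequentially. False"
              using eventually_ge_at_top[of "Suc k"]
            proof eventually_elim
              case (elim n)
              then have "interior (C (Suc k)) \<subseteq> interior (C n)" using incC by (intro interior_mono) (auto simp: incseq_def)
              then show ?case using elim notin[of n] by auto
            qed
            then show False by simp
          qed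
          \<comment> \<open>\<open>exit_time\<close> is an infimum over positive times only, so
            \<open>?S\<close> is a competitor only if it is positive. It is, because the starting
            point is interior to \<open>C (Suc m)\<close>.\<close>
          have pos: "0 < ?S"
          proof (rule ccontr)
            assume "\<not> 0 < ?S"
            then have "\<sigma> (Suc m) \<omega> = 0"
              by (metis SUP_upper UNIV_I le_zero_eq zero_less_iff_neq_zero)
            then have "X 0 \<omega> \<notin> Some ` interior (C (Suc m))" using notin[of "Suc m"] by simp
            then show False using elim m C(3)[of m] by auto
          qed
          then have "exit_time X D \<omega> \<le> ?S" using XS unfolding exit_time_def by (intro Inf_lower) auto
          then show ?thesis using exit_ge[of \<omega>] XS by (simp add: antisym)
        qed
      qed
    qed
  qed
qed

section \<open>The strong Markov property for events and for functions\<close>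

lemma subalgebra_pre_sigma:
  assumes "stopping_time Fl \<sigma>"
  shows "subalgebra (P x) (pre_sigma \<sigma>)"
proof -
  have "A \<in> sets M" if "A \<in> sets (pre_sigma \<sigma>)" for A
    using sets_pre_sigmaD[OF assms that, of \<infinity>] sets_Fl[of \<infinity>] by auto
  then show ?thesis by (auto simp: subalgebra_def space_P space_pre_sigma sets_P)
qed

lemma stopping_time_measurable:
  "stopping_time Fl \<sigma> \<Longrightarrow> \<sigma> \<in> borel_measurable M"
  by (rule measurable_stopping_time[where F = Fl]) (use sets_Fl space_Fl in auto)

lemma measurable_P [simp]: "measurable (P x) N = measurable M N"
  by (rule measurable_cong_sets[OF sets_P refl])

definition law :: "ennreal \<Rightarrow> 'a option \<Rightarrow> 'a option measure" where
  "law s z = distr (P z) cemetery_borel (X s)"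

lemma sets_law [simp]: "sets (law s z) = sets cemetery_borel"
  by (simp add: law_def)

lemma emeasure_law: "E \<in> sets cemetery_borel \<Longrightarrow> emeasure (law s z) E = emeasure (P z) {\<omega> \<in> space M. X s \<omega> \<in> E}"
  unfolding law_def by (subst emeasure_distr) (auto simp: space_P vimage_def Int_def conj_commute)

lemma law_measurable [measurable]: "law s \<in> cemetery_borel \<rightarrow>\<^sub>M subprob_algebra cemetery_borel"
proof (rule measurable_subprob_algebra)
  fix z :: "'a option"
  interpret prob_space "P z" by (rule prob_space_P)
  show "subprob_space (law s z)"
    unfolding law_def by (intro prob_space_imp_subprob_space prob_space_distr) simp
next
  fix E :: "'a option set" assume E: "E \<in> sets cemetery_borel"
  have "emeasure (law s z) E = ennreal (measure (P z) {\<omega> \<in> space M. X s \<omega> \<in> E})" for z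
  proof -
    interpret prob_space "P z" by (rule prob_space_P)
    show ?thesis by (simp add: emeasure_law[OF E] emeasure_eq_measure)
  qed
  then show "(\<lambda>z. emeasure (law s z) E) \<in> borel_measurable cemetery_borel"
    using kernel[OF E, of s] by simp
qed simp

lemma nn_integral_law:
  "f \<in> borel_measurable cemetery_borel \<Longrightarrow> (\<integral>\<^sup>+ y. f y \<partial>law s z) = (\<integral>\<^sup>+ \<omega>. f (X s \<omega>) \<partial>P z)"
  unfolding law_def by (subst nn_integral_distr) auto

text \<open>Integrating the conditional probability over \<open>A\<close> replaces the almost sure
  identity of the locale by an identity of numbers, so that conditional expectations are not met
  again.\<close>

lemma strong_markov_emeasure:
  assumes \<sigma>: "stopping_time Fl \<sigma>" and E: "E \<in> sets cemetery_borel" and A: "A \<in> sets (pre_sigma \<sigma>)"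
  shows "emeasure (P x) (A \<inter> {\<omega> \<in> space M. X (\<sigma> \<omega> + s) \<omega> \<in> E})
    = (\<integral>\<^sup>+ \<omega>. indicator A \<omega> * emeasure (law s (X (\<sigma> \<omega>) \<omega>)) E \<partial>P x)"
proof -
  note [measurable] = stopping_time_measurable[OF \<sigma>]
  interpret prob_space "P x" by (rule prob_space_P)
  interpret finite_measure_subalgebra "P x" "pre_sigma \<sigma>"
    by unfold_locales (rule subalgebra_pre_sigma[OF \<sigma>])
  let ?B = "{\<omega> \<in> space M. X (\<sigma> \<omega> + s) \<omega> \<in> E}"
  let ?m = "\<lambda>\<omega>. measure (P (X (\<sigma> \<omega>) \<omega>)) {\<omega>' \<in> space M. X s \<omega>' \<in> E}"
  have AM: "A \<in> sets (P x)" using A subalg by (auto simp: subalgebra_def)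
  have "(\<lambda>\<omega>. X (\<sigma> \<omega> + s) \<omega>) \<in> M \<rightarrow>\<^sub>M cemetery_borel" by measurable
  from measurable_sets[OF this E] have B: "?B \<in> sets (P x)"
    by (simp add: sets_P vimage_def Int_def conj_commute)
  have [measurable]: "?m \<in> borel_measurable M"
    by (rule measurable_compose[OF _ kernel[OF E]]) measurable
  have m_le: "?m \<omega> \<le> 1" for \<omega>
    by (rule prob_space.prob_le_1[OF prob_space_P])
  have "(\<integral>\<omega>\<in>A. indicator ?B \<omega> \<partial>P x) = (\<integral>\<omega>\<in>A. real_cond_exp (P x) (pre_sigma \<sigma>) (indicator ?B) \<omega> \<partial>P x)"
    by (rule real_cond_exp_intA[OF _ A]) (use B in \<open>simp add: emeasure_eq_measure integrable_indicator_iff\<close>)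
  also have "\<dots> = (\<integral>\<omega>\<in>A. ?m \<omega> \<partial>P x)"
    unfolding set_lebesgue_integral_def
    using strong_markov[OF \<sigma> E, of x s]
    by (intro integral_cong_AE borel_measurable_scaleR borel_measurable_indicator[OF AM]
        borel_measurable_cond_exp2) auto
  also have "(\<integral>\<omega>\<in>A. indicator ?B \<omega> \<partial>P x) = measure (P x) (A \<inter> ?B)"
    unfolding set_lebesgue_integral_def using AM B
    by (simp add: indicator_inter_arith[symmetric] sets.sets_into_space Int_absorb2)
  finally have eq: "measure (P x) (A \<inter> ?B) = (\<integral>\<omega>. indicator A \<omega> * ?m \<omega> \<partial>P x)"
    by (simp add: set_lebesgue_integral_def)
  have "(\<integral>\<^sup>+ \<omega>. indicator A \<omega> * emeasure (law s (X (\<sigma> \<omega>) \<omega>)) E \<partial>P x)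
      = (\<integral>\<^sup>+ \<omega>. ennreal (indicator A \<omega> * ?m \<omega>) \<partial>P x)"
  proof (rule nn_integral_cong)
    fix \<omega>
    interpret Pz: prob_space "P (X (\<sigma> \<omega>) \<omega>)" by (rule prob_space_P)
    show "indicator A \<omega> * emeasure (law s (X (\<sigma> \<omega>) \<omega>)) E = ennreal (indicator A \<omega> * ?m \<omega>)"
      by (simp add: emeasure_law[OF E] Pz.emeasure_eq_measure indicator_def)
  qed
  also have "\<dots> = ennreal (\<integral>\<omega>. indicator A \<omega> * ?m \<omega> \<partial>P x)"
    using AM m_le by (intro nn_integral_eq_integral integrable_const_bound[where B = 1])
      (auto simp: indicator_def sets_P)
  finally show ?thesis by (simp add: emeasure_eq_measure eq)
qed

text \<open>As functions of the target event both sides of \<open>strong_markov_emeasure\<close> are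
  measures on the cemetery space, an image measure on the left and a composition with the kernel
  \<open>law s\<close> on the right. They agree on events, hence as measures, hence on
  functions.\<close>

lemma strong_markov_nn_integral:
  assumes \<sigma>: "stopping_time Fl \<sigma>" and A: "A \<in> sets (pre_sigma \<sigma>)"
    and f [measurable]: "f \<in> borel_measurable cemetery_borel"
  shows "(\<integral>\<^sup>+ \<omega>. indicator A \<omega> * f (X (\<sigma> \<omega> + s) \<omega>) \<partial>P x)
    = (\<integral>\<^sup>+ \<omega>. indicator A \<omega> * (\<integral>\<^sup>+ \<omega>'. f (X s \<omega>') \<partial>P (X (\<sigma> \<omega>) \<omega>)) \<partial>P x)"
proof -
  note [measurable] = stopping_time_measurable[OF \<sigma>]
  have [measurable]: "A \<in> sets M"
    using A subalgebra_pre_sigma[OF \<sigma>, of x] by (auto simp: subalgebra_def sets_P)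
  let ?A = "density (P x) (indicator A)"
  let ?N1 = "distr ?A cemetery_borel (\<lambda>\<omega>. X (\<sigma> \<omega> + s) \<omega>)" and ?N2 = "?A \<bind> (\<lambda>\<omega>. law s (X (\<sigma> \<omega>) \<omega>))"
  have mA [simp]: "measurable ?A N = measurable M N" for N :: "'c measure"
    by (rule measurable_cong_sets) (simp_all add: sets_P)
  have meas: "(\<lambda>\<omega>. X (\<sigma> \<omega> + s) \<omega>) \<in> M \<rightarrow>\<^sub>M cemetery_borel" by measurable
  have K: "(\<lambda>\<omega>. law s (X (\<sigma> \<omega>) \<omega>)) \<in> M \<rightarrow>\<^sub>M subprob_algebra cemetery_borel" by measurable
  have ne: "space M \<noteq> {}" using prob_space.not_empty[OF prob_space_P[of x]] by (simp add: space_P)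
  have "?N1 = ?N2"
  proof (rule measure_eqI)
    show "sets (?N1) = sets ?N2"
      by (subst sets_bind[where N = cemetery_borel]) (use K ne in \<open>auto simp: space_P\<close>)
    fix E assume "E \<in> sets (?N1)"
    then have E: "E \<in> sets cemetery_borel" by simp
    let ?XE = "{\<omega> \<in> space M. X (\<sigma> \<omega> + s) \<omega> \<in> E}"
    have B: "?XE \<in> sets M"
      using measurable_sets[OF meas E] by (simp add: vimage_def Int_def conj_commute)
    have "emeasure (?N1) E
        = emeasure ?A ?XE"
      using E meas by (subst emeasure_distr) (auto simp: space_P vimage_def Int_def conj_commute)
    also have "\<dots> = emeasure (P x) (A \<inter> ?XE)"
    proof -
      have "emeasure ?A ?XE
          = (\<integral>\<^sup>+ \<omega>. indicator (A \<inter> ?XE) \<omega> \<partial>P x)"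
        using B unfolding indicator_inter_arith by (subst emeasure_density) (auto simp: sets_P)
      moreover have "A \<inter> ?XE \<in> sets (P x)"
        using B by (auto simp: sets_P)
      ultimately show ?thesis by (metis nn_integral_indicator)
    qed
    also have "\<dots> = (\<integral>\<^sup>+ \<omega>. indicator A \<omega> * emeasure (law s (X (\<sigma> \<omega>) \<omega>)) E \<partial>P x)"
      by (rule strong_markov_emeasure[OF \<sigma> E A])
    also have "\<dots> = (\<integral>\<^sup>+ \<omega>. emeasure (law s (X (\<sigma> \<omega>) \<omega>)) E \<partial>?A)"
      using measurable_compose[OF K measurable_emeasure_subprob_algebra[OF E]]
      by (subst nn_integral_density) (auto simp: sets_P)
    also have "\<dots> = emeasure ?N2 E"
      by (rule emeasure_bind[symmetric, where N = cemetery_borel]) (use K ne E in \<open>auto simp: space_P\<close>)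
    finally show "emeasure (?N1) E = emeasure ?N2 E" .
  qed
  then have "(\<integral>\<^sup>+ y. f y \<partial>?N1) = (\<integral>\<^sup>+ y. f y \<partial>?N2)"
    by simp
  moreover have "(\<integral>\<^sup>+ y. f y \<partial>?N1) = (\<integral>\<^sup>+ \<omega>. indicator A \<omega> * f (X (\<sigma> \<omega> + s) \<omega>) \<partial>P x)"
    using meas by (subst nn_integral_distr) (auto simp: nn_integral_density sets_P)
  moreover have "(\<integral>\<^sup>+ y. f y \<partial>?N2) = (\<integral>\<^sup>+ \<omega>. (\<integral>\<^sup>+ y. f y \<partial>law s (X (\<sigma> \<omega>) \<omega>)) \<partial>?A)"
    by (rule nn_integral_bind[where B = cemetery_borel]) (use K in auto)
  moreover have "\<dots> = (\<integral>\<^sup>+ \<omega>. indicator A \<omega> * (\<integral>\<^sup>+ y. f y \<partial>law s (X (\<sigma> \<omega>) \<omega>)) \<partial>P x)"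
    using nn_integral_measurable_subprob_algebra2[of "\<lambda>_ y. f y" M cemetery_borel, OF _ K]
    by (subst nn_integral_density) (auto simp: sets_P)
  ultimately show ?thesis by (simp add: nn_integral_law)
qed

end

section \<open>Transition densities at random times\<close>

text \<open>\<open>f\<close> need not be measurable for \<open>N\<close>; agreement with
  \<open>g\<close> off a null set makes it measurable for the completion. It is applied with the
  exit time in \<open>f\<close> and the stopping time that equals it almost surely in
  \<open>g\<close>.\<close>

lemma integral_completion_AE:
  fixes f g :: "'w \<Rightarrow> real"
  assumes g: "g \<in> borel_measurable N" and eq: "AE \<omega> in N. f \<omega> = g \<omega>"
  shows "(\<integral>\<omega>. f \<omega> \<partial>completion N) = (\<integral>\<omega>. g \<omega> \<partial>N)"
proof -
  have gc: "g \<in> borel_measurable (completion N)" by (rule measurable_completion[OF g])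
  have fc: "f \<in> borel_measurable (completion N)"
  proof (rule measurableI)
    fix A :: "real set" assume A: "A \<in> sets borel"
    show "f -` A \<inter> space (completion N) \<in> sets (completion N)"
    proof (rule completion.in_sets_AE)
      show "AE \<omega> in completion N. \<omega> \<in> g -` A \<inter> space (completion N) \<longleftrightarrow> \<omega> \<in> f -` A \<inter> space (completion N)"
        using AE_completion[OF eq] by eventually_elim auto
    qed (use measurable_sets[OF gc A] in auto)
  qed simp
  show ?thesis
    using integral_cong_AE[OF fc gc AE_completion[OF eq]] integral_completion[OF g] by simp
qed

text \<open>A continuous function with bounded support, extended by \<open>0\<close>, is continuous
  on the compactification, since the complement of a compact set is a neighbourhood of the
  cemetery.\<close>

lemma case_option_tendsto_cemetery:
  fixes f :: "'a::euclidean_space \<Rightarrow> real"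
  assumes f: "continuous_on UNIV f" and supp: "bounded {x. f x \<noteq> 0}"
    and lim: "limitin cemetery_top Z l F"
  shows "((\<lambda>n. case_option 0 f (Z n)) \<longlongrightarrow> case_option 0 f l) F"
proof (rule topological_tendstoI)
  fix V :: "real set" assume V: "open V" "case_option 0 f l \<in> V"
  have op: "open (f -` V)" using f V(1) by (metis continuous_on_open_vimage Int_UNIV_right open_UNIV)
  have "openin cemetery_top {z. case_option 0 f z \<in> V}"
  proof (cases "0 \<in> V")
    case False
    then have "{z. case_option 0 f z \<in> V} = Some ` (f -` V)" by (auto split: option.splits)
    then show ?thesis using op by simp
  next
    case True
    then have "bounded (- (f -` V))" by (intro bounded_subset[OF supp]) auto
    then have "compact (- (f -` V))" using op by (simp add: compact_eq_bounded_closed closed_Compl)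
    moreover have "z \<in> {z. case_option 0 f z \<in> V} \<longleftrightarrow> z \<in> insert None (Some ` (UNIV - (- (f -` V))))" for z
      using True by (cases z) auto
    then have "{z. case_option 0 f z \<in> V} = insert None (Some ` (UNIV - (- (f -` V))))"
      by blast
    ultimately show ?thesis using op
      unfolding openin_Alexandroff_compactification by (auto simp: closed_Compl)
  qed
  from limitin_eventually_mem[OF lim this] V(2)
  show "\<forall>\<^sub>F n in F. case_option 0 f (Z n) \<in> V" by simp
qed

text \<open>Path continuity yields identities for continuous test functions only; this lemma carries
  them over to all Borel functions. Open boxes form a generating system stable under intersection,
  and the indicator of a box is the limit of the functions \<open>f m\<close>.\<close>

lemma finite_measure_eq_on_Cc:
  fixes N1 N2 :: "'a::euclidean_space measure"
  assumes sets: "sets N1 = sets borel" "sets N2 = sets borel"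
    and fin: "emeasure N1 UNIV < \<infinity>" "emeasure N2 UNIV < \<infinity>"
    and eq: "\<And>f :: 'a \<Rightarrow> real. continuous_on UNIV f \<Longrightarrow> (\<And>x. 0 \<le> f x \<and> f x \<le> 1) \<Longrightarrow> bounded {x. f x \<noteq> 0} \<Longrightarrow>
      (\<integral>\<^sup>+ x. ennreal (f x) \<partial>N1) = (\<integral>\<^sup>+ x. ennreal (f x) \<partial>N2)"
  shows "N1 = N2"
proof (rule measure_eqI_generator_eq)
  let ?E = "range (\<lambda>(a, b). box a b::'a set)"
  show "Int_stable ?E"
    by (auto simp: Int_stable_def box_Int_box)
  show "?E \<subseteq> Pow UNIV" "sets N1 = sigma_sets UNIV ?E" "sets N2 = sigma_sets UNIV ?E"
    by (simp_all add: borel_eq_box sets)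
  let ?A = "\<lambda>n::nat. box (- (real n *\<^sub>R One)) (real n *\<^sub>R One) :: 'a set"
  show "range ?A \<subseteq> ?E" "(\<Union>i. ?A i) = UNIV"
    unfolding UN_box_eq_UNIV by auto
  show "emeasure N1 (?A i) \<noteq> \<infinity>" for i
    using fin(1) emeasure_mono[of "?A i" UNIV N1] sets(1) sets_eq_imp_space_eq[OF sets(1)]
    by (metis less_irrefl order.strict_trans1 sets.top space_borel subset_UNIV)
  fix U assume "U \<in> ?E"
  then obtain a b where U: "U = box a b" by auto
  \<comment> \<open>\<open>infdist\<close> to the empty set is \<open>0\<close>, so the functions
    \<open>f m\<close> would vanish identically if \<open>U\<close> were the whole space.\<close>
  have ne: "- U \<noteq> {}"
  proof
    assume "- U = {}"
    then have "U = UNIV" by auto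
    moreover have "bounded U" by (simp add: U bounded_box)
    ultimately show False using not_bounded_UNIV by metis
  qed
  define f where "f m x = min 1 (real m * infdist x (- U))" for m x
  have f0: "f m x = 0" if "x \<notin> U" for m x using that by (simp add: f_def)
  have lim: "(\<lambda>m. ennreal (f m x)) \<longlonglongrightarrow> indicator U x" for x
  proof (cases "x \<in> U")
    case True
    have pos: "0 < infdist x (- U)"
      using True ne by (intro infdist_pos_not_in_closed) (auto simp: U open_box closed_Compl)
    then obtain k :: nat where k: "1 < real k * infdist x (- U)" using ex_less_of_nat_mult by blast
    have "\<forall>\<^sub>F m in sequentially. f m x = 1"
      using eventually_ge_at_top[of k]
    proof eventually_elim
      case (elim m)
      then have "real k * infdist x (- U) \<le> real m * infdist x (- U)" using pos by simp
      then show ?case using k by (simp add: f_def)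
    qed
    then have "\<forall>\<^sub>F m in sequentially. ennreal (f m x) = indicator U x"
      by eventually_elim (use True in simp)
    then show ?thesis by (rule tendsto_eventually)
  next
    case False
    then show ?thesis by (simp add: f0)
  qed
  have bnd: "0 \<le> f m x \<and> f m x \<le> 1" for m x by (simp add: f_def infdist_nonneg)
  have cont: "continuous_on UNIV (f m)" for m
    unfolding f_def by (intro continuous_intros)
  have meas: "(\<lambda>x. ennreal (f m x)) \<in> borel_measurable borel" for m
    using borel_measurable_continuous_onI[OF cont] by measurable
  have conv: "(\<lambda>m. \<integral>\<^sup>+ x. ennreal (f m x) \<partial>N) \<longlonglongrightarrow> emeasure N U"
    if N: "sets N = sets borel" "emeasure N UNIV < \<infinity>" for N
  proof -
    have mN: "measurable N L = measurable borel L" for L :: "ennreal measure"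
      by (rule measurable_cong_sets[OF N(1) refl])
    have "(\<lambda>m. \<integral>\<^sup>+ x. ennreal (f m x) \<partial>N) \<longlonglongrightarrow> (\<integral>\<^sup>+ x. indicator U x \<partial>N)"
    proof (rule nn_integral_dominated_convergence[where w = "\<lambda>_. 1"])
      show "(\<integral>\<^sup>+ x. 1 \<partial>N) < \<infinity>" using N(2) sets_eq_imp_space_eq[OF N(1)] by simp
      show "AE x in N. ennreal (f j x) \<le> 1" for j using bnd by simp
    qed (use lim meas in \<open>auto simp: mN U\<close>)
    then show ?thesis by (simp add: N(1) U)
  qed
  have "bounded {x. f m x \<noteq> 0}" for m
    by (rule bounded_subset[OF bounded_box[of a b]]) (use f0 U in auto)
  then have "(\<integral>\<^sup>+ x. ennreal (f m x) \<partial>N1) = (\<integral>\<^sup>+ x. ennreal (f m x) \<partial>N2)" for m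
    using bnd by (intro eq cont) auto
  then show "emeasure N1 U = emeasure N2 U"
    using conv[OF sets(1) fin(1)] conv[OF sets(2) fin(2)] LIMSEQ_unique by auto
qed

section \<open>The density at random times and the transition operator on nonnegative
  functions\<close>

locale hunt_density = hunt_process M Fl X \<theta> P
  for M :: "'w measure" and Fl and X :: "ennreal \<Rightarrow> 'w \<Rightarrow> 'a::euclidean_space option" and \<theta> and P +
  fixes p :: "real \<Rightarrow> 'a \<Rightarrow> 'a \<Rightarrow> real"
  assumes density: "transition_density P X p"
begin

lemma p_nonneg: "t > 0 \<Longrightarrow> 0 \<le> p t x y"
  using density by (simp add: transition_density_def)

lemma p_0: "x \<noteq> y \<Longrightarrow> p 0 x y = 0"
  using density by (simp add: transition_density_def)

lemma p_measurable:
  "(\<lambda>(t, x, y). if 0 < t then p t x y else 0) \<in> borel_measurable (borel \<Otimes>\<^sub>M borel \<Otimes>\<^sub>M borel)"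
proof -
  have "(\<lambda>(t, x, y). p t x y) \<in> borel_measurable (restrict_space borel ({0<..} \<times> UNIV))"
    using density by (simp add: transition_density_def)
  then have "(\<lambda>z. indicator ({0<..} \<times> UNIV) z *\<^sub>R (case z of (t, x, y) \<Rightarrow> p t x y)) \<in> borel_measurable borel"
    by (subst (asm) borel_measurable_restrict_space_iff)
       (auto intro!: borel_open open_Times)
  moreover have "(\<lambda>z. indicator ({0<..} \<times> UNIV) z *\<^sub>R (case z of (t, x, y) \<Rightarrow> p t x y))
      = (\<lambda>(t, x, y). if 0 < t then p t x y else 0)"
    by (auto simp: fun_eq_iff indicator_def)
  ultimately show ?thesis by (simp add: borel_prod)
qed

lemma p_compose_measurable:
  assumes [measurable]: "a \<in> borel_measurable N" "b \<in> borel_measurable N" "c \<in> borel_measurable N"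
  shows "(\<lambda>\<omega>. if 0 < a \<omega> then p (a \<omega>) (b \<omega>) (c \<omega>) else 0) \<in> borel_measurable N"
proof -
  have "(\<lambda>\<omega>. (a \<omega>, b \<omega>, c \<omega>)) \<in> N \<rightarrow>\<^sub>M borel \<Otimes>\<^sub>M borel \<Otimes>\<^sub>M borel" by measurable
  from measurable_compose[OF this p_measurable] show ?thesis by simp
qed

lemma p_compose_measurable_const [measurable (raw)]:
  assumes "0 < t" "b \<in> borel_measurable N" "c \<in> borel_measurable N"
  shows "(\<lambda>\<omega>. p t (b \<omega>) (c \<omega>)) \<in> borel_measurable N"
  using p_compose_measurable[of "\<lambda>_. t" N b c] assms by simp

lemma density_random_time_measurable:
  assumes [measurable]: "r \<in> borel_measurable N" and Y [measurable]: "Y \<in> N \<rightarrow>\<^sub>M cemetery_borel"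
  shows "(\<lambda>(\<omega>, y). if 0 < r \<omega> then case_option 0 (\<lambda>z. p (r \<omega>) z y) (Y \<omega>) else 0) \<in> borel_measurable (N \<Otimes>\<^sub>M borel)"
proof -
  \<comment> \<open>The density takes vectors, not optional vectors. The position is therefore split
    into a factor that vanishes at the cemetery and a vector with dummy value \<open>0\<close>
    there; the guard is needed because measurability of \<open>p\<close> is assumed for positive
    times only.\<close>
  let ?L = "\<lambda>w. case_option 0 (\<lambda>z. 1) (Y (fst w)) *
      (if 0 < r (fst w) then p (r (fst w)) (case_option 0 (\<lambda>z. z) (Y (fst w))) (snd w) else 0)"
  have [measurable]: "(\<lambda>\<omega>. case_option 0 (\<lambda>z. z) (Y \<omega>)) \<in> borel_measurable N"
    by (rule measurable_compose[OF Y]) measurable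
  have [measurable]: "(\<lambda>\<omega>. case_option 0 (\<lambda>z. 1 :: real) (Y \<omega>)) \<in> borel_measurable N"
    by (rule measurable_compose[OF Y]) measurable
  have "?L \<in> borel_measurable (N \<Otimes>\<^sub>M borel)"
    by (intro borel_measurable_times p_compose_measurable) measurable
  also have "?L =
      (\<lambda>(\<omega>, y). if 0 < r \<omega> then case_option 0 (\<lambda>z. p (r \<omega>) z y) (Y \<omega>) else 0)"
    by (auto simp: fun_eq_iff split: option.splits)
  finally show ?thesis .
qed

definition heat :: "real \<Rightarrow> ('a \<Rightarrow> ennreal) \<Rightarrow> 'a \<Rightarrow> ennreal" where
  "heat t f x = (\<integral>\<^sup>+ y. ennreal (p t x y) * f y \<partial>lborel)"

text \<open>The starting point may be \<open>None\<close>, because the strong Markov property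
  restarts the process wherever it happens to be. The cemetery absorbs, so both sides are then
  \<open>0\<close>.\<close>

lemma nn_integral_X:
  assumes t: "0 < t" and f: "f \<in> borel_measurable borel"
  shows "(\<integral>\<^sup>+ \<omega>. case_option 0 f (X (ennreal t) \<omega>) \<partial>P z) = case_option 0 (heat t f) z"
proof (cases z)
  case (Some x)
  then show ?thesis using density t f by (simp add: transition_density_def heat_def)
next
  case None
  have "AE \<omega> in P None. \<omega> \<in> space M" using AE_space[of "P None"] by (simp add: space_P)
  then have "AE \<omega> in P None. X (ennreal t) \<omega> = None"
    using normal[of None] by eventually_elim (use absorbing zero_le in blast)
  then have "(\<integral>\<^sup>+ \<omega>. case_option 0 f (X (ennreal t) \<omega>) \<partial>P None) = (\<integral>\<^sup>+ \<omega>. 0 \<partial>P None)"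
    by (intro nn_integral_cong_AE) auto
  then show ?thesis using None by simp
qed

lemma heat_measurable [measurable]:
  assumes "0 < t" and [measurable]: "f \<in> borel_measurable borel"
  shows "heat t f \<in> borel_measurable borel"
proof -
  have "(\<lambda>x. \<integral>\<^sup>+ y. ennreal (p t x y) * f y \<partial>lborel) \<in> borel_measurable borel"
    using assms(1) by measurable
  then show ?thesis by (simp add: heat_def[abs_def])
qed

lemma heat_mono: "(\<And>y. f y \<le> g y) \<Longrightarrow> heat t f x \<le> heat t g x"
  unfolding heat_def by (intro nn_integral_mono mult_left_mono) auto

lemma heat_1_le: "0 < t \<Longrightarrow> heat t (\<lambda>_. 1) x \<le> 1"
proof -
  assume t: "0 < t"
  interpret prob_space "P (Some x)" by (rule prob_space_P)
  have "heat t (\<lambda>_. 1) x = (\<integral>\<^sup>+ \<omega>. case_option 0 (\<lambda>_. 1) (X (ennreal t) \<omega>) \<partial>P (Some x))"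
    using nn_integral_X[OF t, of "\<lambda>_. 1" "Some x"] by simp
  also have "\<dots> \<le> (\<integral>\<^sup>+ \<omega>. 1 \<partial>P (Some x))"
    by (intro nn_integral_mono) (simp split: option.split)
  also have "\<dots> = 1" by (simp add: emeasure_space_1)
  finally show ?thesis .
qed

lemma heat_le:
  assumes "0 < t" "\<And>y. f y \<le> c"
  shows "heat t f x \<le> c"
proof -
  have "heat t f x \<le> heat t (\<lambda>_. c) x" by (intro heat_mono assms)
  also have "\<dots> = heat t (\<lambda>_. 1) x * c"
    unfolding heat_def using assms(1) by (subst nn_integral_multc) auto
  also have "\<dots> \<le> 1 * c" by (intro mult_right_mono heat_1_le assms) auto
  finally show ?thesis by simp
qed

lemma heat_random_time_measurable:
  assumes r: "r \<in> borel_measurable N" and Y: "Y \<in> N \<rightarrow>\<^sub>M cemetery_borel" and [measurable]: "f \<in> borel_measurable borel"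
  shows "(\<lambda>\<omega>. if 0 < r \<omega> then case_option 0 (heat (r \<omega>) f) (Y \<omega>) else 0) \<in> borel_measurable N"
proof -
  let ?I = "\<lambda>\<omega>. \<integral>\<^sup>+ y. ennreal (if 0 < r \<omega> then case_option 0 (\<lambda>z. p (r \<omega>) z y) (Y \<omega>) else 0) * f y \<partial>lborel"
  note [measurable] = density_random_time_measurable[OF r Y]
  have "?I \<in> borel_measurable N"
    by measurable
  also have "?I =
      (\<lambda>\<omega>. if 0 < r \<omega> then case_option 0 (heat (r \<omega>) f) (Y \<omega>) else 0)"
    by (auto simp: fun_eq_iff heat_def split: option.splits)
  finally show ?thesis .
qed

text \<open>
  The density enters the Dirichlet heat kernel at the random time \<open>t - \<sigma>\<close>, whereas the strong Markov
  property is stated for deterministic increments. The remaining time \<open>t - \<sigma>\<close> is approximated from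
  above by dyadic times, which is compatible with right-continuity of the paths.
\<close>

lemma strong_markov_remaining_dyadic:
  assumes \<sigma>: "stopping_time Fl \<sigma>" and f [measurable]: "f \<in> borel_measurable borel"
  shows "(\<integral>\<^sup>+ \<omega>. case_option 0 f (X (\<sigma> \<omega> + ennreal (dyadic_above n (t - enn2real (\<sigma> \<omega>)))) \<omega>)
        * indicator {\<omega> \<in> space M. \<sigma> \<omega> < ennreal t} \<omega> \<partial>P x)
    = (\<integral>\<^sup>+ \<omega>. case_option 0 (heat (dyadic_above n (t - enn2real (\<sigma> \<omega>))) f) (X (\<sigma> \<omega>) \<omega>)
        * indicator {\<omega> \<in> space M. \<sigma> \<omega> < ennreal t} \<omega> \<partial>P x)"
proof -
  note [measurable] = stopping_time_measurable[OF \<sigma>]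
  let ?R = "\<lambda>\<omega>. dyadic_above n (t - enn2real (\<sigma> \<omega>))"
  let ?k = "\<lambda>\<omega>. nat \<lfloor>2 ^ n * (t - enn2real (\<sigma> \<omega>))\<rfloor>"
  let ?r = "\<lambda>k. real (k + 1) / 2 ^ n"
  \<comment> \<open>On \<open>A k\<close> the rounded remaining time is the constant
    \<open>?r k\<close>, so the strong Markov property with a deterministic increment applies. The
    event belongs to the past of \<open>\<sigma>\<close> since \<open>\<sigma>\<close> is measurable
    for it.\<close>
  define A where "A k = {\<omega> \<in> space M. \<sigma> \<omega> < ennreal t \<and> ?k \<omega> = k}" for k
  have A: "A k \<in> sets (pre_sigma \<sigma>)" for k
  proof -
    have [measurable]: "\<sigma> \<in> borel_measurable (pre_sigma \<sigma>)"
      by (rule measurable_stopping_time_pre_sigma[OF \<sigma>])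
    have "{\<omega> \<in> space (pre_sigma \<sigma>). \<sigma> \<omega> < ennreal t \<and> ?k \<omega> = k} \<in> sets (pre_sigma \<sigma>)" by measurable
    then show ?thesis by (simp add: A_def space_pre_sigma)
  qed
  have AM [measurable]: "A k \<in> sets M" for k
    using A[of k] subalgebra_pre_sigma[OF \<sigma>, of x] by (auto simp: subalgebra_def sets_P)
  have disj: "disjoint_family A" by (auto simp: disjoint_family_on_def A_def)
  have UN: "(\<Union>k. A k) = {\<omega> \<in> space M. \<sigma> \<omega> < ennreal t}" by (auto simp: A_def)
  have r_pos: "0 < ?r k" for k by simp
  have R: "?R \<omega> = ?r k" if "\<omega> \<in> A k" for \<omega> k using that by (simp add: A_def dyadic_above_def)
  have R': "?R \<omega> = ?r (?k \<omega>)" for \<omega> by (simp add: dyadic_above_def)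
  have mR [measurable]: "?R \<in> borel_measurable M" unfolding dyadic_above_def by measurable
  have step: "(\<integral>\<^sup>+ \<omega>. case_option 0 f (X (\<sigma> \<omega> + ennreal (?R \<omega>)) \<omega>) * indicator (A k) \<omega> \<partial>P x)
      = (\<integral>\<^sup>+ \<omega>. case_option 0 (heat (?R \<omega>) f) (X (\<sigma> \<omega>) \<omega>) * indicator (A k) \<omega> \<partial>P x)" for k
  proof -
    have "(\<integral>\<^sup>+ \<omega>. case_option 0 f (X (\<sigma> \<omega> + ennreal (?R \<omega>)) \<omega>) * indicator (A k) \<omega> \<partial>P x)
        = (\<integral>\<^sup>+ \<omega>. indicator (A k) \<omega> * case_option 0 f (X (\<sigma> \<omega> + ennreal (?r k)) \<omega>) \<partial>P x)"
      by (intro nn_integral_cong) (auto simp: indicator_def R[of _ k] split: option.split)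
    also have "\<dots> = (\<integral>\<^sup>+ \<omega>. indicator (A k) \<omega> * (\<integral>\<^sup>+ \<omega>'. case_option 0 f (X (ennreal (?r k)) \<omega>') \<partial>P (X (\<sigma> \<omega>) \<omega>)) \<partial>P x)"
      by (rule strong_markov_nn_integral[OF \<sigma> A]) measurable
    also have "\<dots> = (\<integral>\<^sup>+ \<omega>. case_option 0 (heat (?R \<omega>) f) (X (\<sigma> \<omega>) \<omega>) * indicator (A k) \<omega> \<partial>P x)"
      unfolding nn_integral_X[OF r_pos f] by (intro nn_integral_cong) (auto simp: indicator_def R[of _ k] split: option.split)
    finally show ?thesis .
  qed
  have m1: "(\<lambda>\<omega>. case_option 0 f (X (\<sigma> \<omega> + ennreal (?R \<omega>)) \<omega>)) \<in> borel_measurable (P x)"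
    by simp
  have "(\<lambda>\<omega>. case_option 0 (heat (?r (?k \<omega>)) f) (X (\<sigma> \<omega>) \<omega>)) \<in> borel_measurable M"
  proof (rule measurable_compose_countable[where f = "\<lambda>k \<omega>. case_option 0 (heat (?r k) f) (X (\<sigma> \<omega>) \<omega>)" and g = ?k])
    fix k :: nat
    have [measurable]: "heat (?r k) f \<in> borel_measurable borel" using r_pos by measurable
    show "(\<lambda>\<omega>. case_option 0 (heat (?r k) f) (X (\<sigma> \<omega>) \<omega>)) \<in> borel_measurable M" by measurable
  qed measurable
  then have m2: "(\<lambda>\<omega>. case_option 0 (heat (?R \<omega>) f) (X (\<sigma> \<omega>) \<omega>)) \<in> borel_measurable (P x)"
    unfolding measurable_P R' .
  have "A k \<in> sets (P x)" for k by (simp add: sets_P)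
  from nn_integral_disjoint_family[OF m1 this disj] nn_integral_disjoint_family[OF m2 this disj]
  show ?thesis by (simp add: step UN)
qed

text \<open>Limit of the dyadic version. On the left the total time tends to \<open>t\<close> from
  above, so right-continuity of the paths and continuity of \<open>f\<close> apply; on the right the
  remaining time does the same inside \<open>heat\<close>. Both integrands are bounded by
  \<open>1\<close>.\<close>

lemma strong_markov_remaining_Cc:
  fixes f :: "'a \<Rightarrow> real"
  assumes \<sigma>: "stopping_time Fl \<sigma>"
    and f: "continuous_on UNIV f" "\<And>x. 0 \<le> f x \<and> f x \<le> 1" "bounded {x. f x \<noteq> 0}"
  shows "(\<integral>\<^sup>+ \<omega>. ennreal (case_option 0 f (X (ennreal t) \<omega>)) * indicator {\<omega> \<in> space M. \<sigma> \<omega> < ennreal t} \<omega> \<partial>P x)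
    = (\<integral>\<^sup>+ \<omega>. case_option 0 (heat (t - enn2real (\<sigma> \<omega>)) (\<lambda>y. ennreal (f y))) (X (\<sigma> \<omega>) \<omega>)
        * indicator {\<omega> \<in> space M. \<sigma> \<omega> < ennreal t} \<omega> \<partial>P x)" (is "?L = ?R")
proof -
  note [measurable] = stopping_time_measurable[OF \<sigma>] borel_measurable_continuous_onI[OF f(1)]
  let ?f = "\<lambda>y. ennreal (f y)"
  let ?B = "{\<omega> \<in> space M. \<sigma> \<omega> < ennreal t}"
  let ?d = "\<lambda>n \<omega>. dyadic_above n (t - enn2real (\<sigma> \<omega>))"
  have [measurable]: "(\<lambda>\<omega>. ?d n \<omega>) \<in> borel_measurable M" for n
    unfolding dyadic_above_def by measurable
  have path: "(\<lambda>n. ennreal (case_option 0 f (X (s n) \<omega>))) \<longlonglongrightarrow> ennreal (case_option 0 f (X r \<omega>))"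
    if "\<omega> \<in> space M" "filterlim s (at_right r) sequentially" "r < \<infinity>" for s r \<omega>
    by (intro tendsto_ennrealI case_option_tendsto_cemetery[OF f(1,3)]
        limitin_compose_filterlim[OF right_continuous] that)
  have f_eq: "case_option 0 ?f z = ennreal (case_option 0 f z)" for z :: "'a option"
    by (simp split: option.split)
  have le1: "case_option 0 ?f z \<le> 1" for z :: "'a option"
    using f(2) by (auto split: option.split simp: ennreal_le_1)
  have real_\<sigma>: "0 \<le> enn2real (\<sigma> \<omega>)" "\<sigma> \<omega> = ennreal (enn2real (\<sigma> \<omega>))" "0 < t - enn2real (\<sigma> \<omega>)" if "\<omega> \<in> ?B" for \<omega>
  proof -
    have "\<sigma> \<omega> < top" using that less_trans[OF _ ennreal_less_top, of "\<sigma> \<omega>" t] by simp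
    then obtain r where "\<sigma> \<omega> = ennreal r" "0 \<le> r" by (cases "\<sigma> \<omega>") auto
    then show "0 \<le> enn2real (\<sigma> \<omega>)" "\<sigma> \<omega> = ennreal (enn2real (\<sigma> \<omega>))" "0 < t - enn2real (\<sigma> \<omega>)"
      using that by (auto simp: ennreal_less_iff)
  qed
  \<comment> \<open>\<open>transition_density\<close> provides no continuity of \<open>p\<close> in
    time; continuity of \<open>heat\<close> from the right is read off from the paths started at
    \<open>z\<close>.\<close>
  have heat_lim: "(\<lambda>n. case_option 0 (heat (dyadic_above n r) ?f) z) \<longlonglongrightarrow> case_option 0 (heat r ?f) z"
    if r: "0 < r" for r z
  proof -
    interpret prob_space "P z" by (rule prob_space_P)
    have flt: "filterlim (\<lambda>n. ennreal (dyadic_above n r)) (at_right (ennreal r)) sequentially"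
      unfolding filterlim_at
      using tendsto_ennrealI[OF dyadic_above_tendsto[of r]] r
      by (auto intro!: always_eventually simp: dyadic_above_gt dyadic_above_pos ennreal_less_iff
          less_imp_neq[THEN not_sym])
    have "(\<lambda>n. \<integral>\<^sup>+ \<omega>. case_option 0 ?f (X (ennreal (dyadic_above n r)) \<omega>) \<partial>P z)
        \<longlonglongrightarrow> (\<integral>\<^sup>+ \<omega>. case_option 0 ?f (X (ennreal r) \<omega>) \<partial>P z)"
    proof (rule nn_integral_dominated_convergence[where w = "\<lambda>_. 1"])
      show "AE \<omega> in P z. (\<lambda>n. case_option 0 ?f (X (ennreal (dyadic_above n r)) \<omega>)) \<longlonglongrightarrow> case_option 0 ?f (X (ennreal r) \<omega>)"
        unfolding f_eq by (rule AE_I2) (rule path[OF _ flt], simp_all add: space_P)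
    qed (auto simp: emeasure_space_1 le1)
    then show ?thesis using r by (simp add: nn_integral_X dyadic_above_pos)
  qed
  let ?G = "\<lambda>n \<omega>. case_option 0 ?f (X (\<sigma> \<omega> + ennreal (?d n \<omega>)) \<omega>) * indicator ?B \<omega>"
  let ?Glim = "\<lambda>\<omega>. ennreal (case_option 0 f (X (ennreal t) \<omega>)) * indicator ?B \<omega>"
  let ?H = "\<lambda>n \<omega>. case_option 0 (heat (?d n \<omega>) ?f) (X (\<sigma> \<omega>) \<omega>) * indicator ?B \<omega>"
  let ?Hlim = "\<lambda>\<omega>. case_option 0 (heat (t - enn2real (\<sigma> \<omega>)) ?f) (X (\<sigma> \<omega>) \<omega>) * indicator ?B \<omega>"
  have L: "(\<lambda>n. \<integral>\<^sup>+ \<omega>. ?G n \<omega> \<partial>P x) \<longlonglongrightarrow> ?L"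
  proof (rule nn_integral_dominated_convergence[where w = "\<lambda>_. 1"])
    interpret prob_space "P x" by (rule prob_space_P)
    show "(\<integral>\<^sup>+ \<omega>. 1 \<partial>P x) < \<infinity>" by (simp add: emeasure_space_1)
    show "AE \<omega> in P x. ?G n \<omega> \<le> 1" for n
      using le1 by (auto simp: indicator_def)
    show "AE \<omega> in P x. (\<lambda>n. ?G n \<omega>)
        \<longlonglongrightarrow> ?Glim \<omega>"
    proof (rule AE_I2)
      fix \<omega> assume "\<omega> \<in> space (P x)"
      then have w: "\<omega> \<in> space M" by (simp add: space_P)
      show "(\<lambda>n. ?G n \<omega>)
        \<longlonglongrightarrow> ?Glim \<omega>"
      proof (cases "\<omega> \<in> ?B")
        case True
        have "\<sigma> \<omega> + ennreal (?d n \<omega>) = ennreal (enn2real (\<sigma> \<omega>) + ?d n \<omega>)" for n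
          using real_\<sigma>[OF True] dyadic_above_pos[of n] by (metis ennreal_plus less_imp_le)
        moreover have "(\<lambda>n. enn2real (\<sigma> \<omega>) + ?d n \<omega>) \<longlonglongrightarrow> enn2real (\<sigma> \<omega>) + (t - enn2real (\<sigma> \<omega>))"
          by (intro tendsto_intros dyadic_above_tendsto) (use real_\<sigma>[OF True] in simp)
        moreover have "ennreal t < ennreal (enn2real (\<sigma> \<omega>) + ?d n \<omega>)" for n
          using dyadic_above_gt[of "t - enn2real (\<sigma> \<omega>)" n] real_\<sigma>(1,3)[OF True] by (intro ennreal_lessI) linarith+
        ultimately have "filterlim (\<lambda>n. \<sigma> \<omega> + ennreal (?d n \<omega>)) (at_right (ennreal t)) sequentially"
          unfolding filterlim_at using real_\<sigma>[OF True] dyadic_above_pos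
          by (auto intro!: always_eventually tendsto_ennrealI simp: less_imp_neq[THEN not_sym])
        from path[OF w this] show ?thesis using True by (simp add: f_eq)
      qed simp
    qed
  qed simp_all
  have meas: "(\<lambda>\<omega>. case_option 0 (heat (r \<omega>) ?f) (X (\<sigma> \<omega>) \<omega>) * indicator ?B \<omega>) \<in> borel_measurable M"
    if [measurable]: "r \<in> borel_measurable M" and pos: "\<And>\<omega>. \<omega> \<in> ?B \<Longrightarrow> 0 < r \<omega>" for r
  proof -
    let ?h = "\<lambda>\<omega>. if 0 < r \<omega> then case_option 0 (heat (r \<omega>) ?f) (X (\<sigma> \<omega>) \<omega>) else 0"
    have [measurable]: "?h \<in> borel_measurable M"
      by (rule heat_random_time_measurable) measurable
    have "(\<lambda>\<omega>. ?h \<omega> * indicator ?B \<omega>) \<in> borel_measurable M"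
      by measurable
    also have "(\<lambda>\<omega>. ?h \<omega> * indicator ?B \<omega>)
        = (\<lambda>\<omega>. case_option 0 (heat (r \<omega>) ?f) (X (\<sigma> \<omega>) \<omega>) * indicator ?B \<omega>)"
      using pos by (auto simp: fun_eq_iff indicator_def)
    finally show ?thesis .
  qed
  have R: "(\<lambda>n. \<integral>\<^sup>+ \<omega>. ?H n \<omega> \<partial>P x) \<longlonglongrightarrow> ?R"
  proof (rule nn_integral_dominated_convergence[where w = "\<lambda>_. 1"])
    interpret prob_space "P x" by (rule prob_space_P)
    show "(\<integral>\<^sup>+ \<omega>. 1 \<partial>P x) < \<infinity>" by (simp add: emeasure_space_1)
    show "AE \<omega> in P x. ?H n \<omega> \<le> 1" for n
    proof (rule AE_I2)
      fix \<omega>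
      have "heat (?d n \<omega>) ?f z \<le> 1" for z
        by (rule heat_le[OF dyadic_above_pos]) (use f(2) in \<open>simp add: ennreal_le_1\<close>)
      then show "?H n \<omega> \<le> 1"
        by (auto simp: indicator_def split: option.split)
    qed
    show "AE \<omega> in P x. (\<lambda>n. ?H n \<omega>)
        \<longlonglongrightarrow> ?Hlim \<omega>"
    proof (rule AE_I2)
      fix \<omega>
      show "(\<lambda>n. ?H n \<omega>)
        \<longlonglongrightarrow> ?Hlim \<omega>"
        by (cases "\<omega> \<in> ?B") (use heat_lim[OF real_\<sigma>(3)[of \<omega>]] in auto)
    qed
    show "?H n \<in> borel_measurable (P x)" for n
      unfolding measurable_P by (rule meas) (auto simp: dyadic_above_pos)
    show "?Hlim \<in> borel_measurable (P x)"
      unfolding measurable_P by (rule meas) (use real_\<sigma>(3) in auto)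
  qed simp
  show ?thesis
    using LIMSEQ_unique[OF L] R strong_markov_remaining_dyadic[OF \<sigma>, of ?f] by simp
qed


text \<open>The term subtracted in the Dirichlet heat kernel, with a stopping time in place of the
  exit time and a strict inequality between \<open>\<sigma>\<close> and \<open>t\<close>. The values
  are extended because finiteness is obtained for almost every \<open>y\<close> only.\<close>

definition exit_density :: "('w \<Rightarrow> ennreal) \<Rightarrow> real \<Rightarrow> 'a option \<Rightarrow> 'a \<Rightarrow> ennreal" where
  "exit_density \<sigma> t x y = (\<integral>\<^sup>+ \<omega>. ennreal (if \<sigma> \<omega> < ennreal t then case_option 0 (\<lambda>z. p (t - enn2real (\<sigma> \<omega>)) z y) (X (\<sigma> \<omega>) \<omega>) else 0) \<partial>P x)"

lemma less_ennreal_imp_enn2real_less: "s < ennreal t \<Longrightarrow> enn2real s < t"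
proof -
  assume "s < ennreal t"
  moreover from this have "s < top" using less_trans ennreal_less_top by blast
  then obtain r where "s = ennreal r" "0 \<le> r" by (cases s) auto
  ultimately show ?thesis by (simp add: ennreal_less_iff)
qed

lemma exit_integrand_measurable:
  assumes [measurable]: "\<sigma> \<in> borel_measurable M"
  shows "(\<lambda>(\<omega>, y). if \<sigma> \<omega> < ennreal t then case_option 0 (\<lambda>z. p (t - enn2real (\<sigma> \<omega>)) z y) (X (\<sigma> \<omega>) \<omega>) else 0)
    \<in> borel_measurable (M \<Otimes>\<^sub>M borel)"
proof -
  let ?L = "\<lambda>w. if \<sigma> (fst w) < ennreal t then (case w of (\<omega>, y) \<Rightarrow> if 0 < t - enn2real (\<sigma> \<omega>) then case_option 0 (\<lambda>z. p (t - enn2real (\<sigma> \<omega>)) z y) (X (\<sigma> \<omega>) \<omega>) else 0) else 0"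
  have [measurable]: "(\<lambda>(\<omega>, y). if 0 < t - enn2real (\<sigma> \<omega>) then case_option 0 (\<lambda>z. p (t - enn2real (\<sigma> \<omega>)) z y) (X (\<sigma> \<omega>) \<omega>) else 0)
    \<in> borel_measurable (M \<Otimes>\<^sub>M borel)"
    by (rule density_random_time_measurable) measurable
  have "?L
    \<in> borel_measurable (M \<Otimes>\<^sub>M borel)"
    by measurable
  also have "?L
    = (\<lambda>(\<omega>, y). if \<sigma> \<omega> < ennreal t then case_option 0 (\<lambda>z. p (t - enn2real (\<sigma> \<omega>)) z y) (X (\<sigma> \<omega>) \<omega>) else 0)"
    by (auto simp: fun_eq_iff dest: less_ennreal_imp_enn2real_less)
  finally show ?thesis .
qed

lemma measurable_P_pair: "measurable (P x \<Otimes>\<^sub>M N) L = measurable (M \<Otimes>\<^sub>M N) L"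
  by (rule measurable_cong_sets[OF sets_pair_measure_cong[OF sets_P refl] refl])

lemma exit_density_measurable [measurable]:
  assumes "\<sigma> \<in> borel_measurable M"
  shows "exit_density \<sigma> t x \<in> borel_measurable borel"
proof -
  let ?g = "\<lambda>\<omega> y. if \<sigma> \<omega> < ennreal t then case_option 0 (\<lambda>z. p (t - enn2real (\<sigma> \<omega>)) z y) (X (\<sigma> \<omega>) \<omega>) else 0"
  interpret prob_space "P x" by (rule prob_space_P)
  have "(\<lambda>(\<omega>, y). ennreal (?g \<omega> y))
    \<in> borel_measurable (P x \<Otimes>\<^sub>M borel)"
    unfolding measurable_P_pair using measurable_compose[OF exit_integrand_measurable[OF assms, of t] measurable_ennreal]
    by (simp add: case_prod_beta')
  then have "(\<lambda>(y, \<omega>). ennreal (?g \<omega> y))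
    \<in> borel_measurable (borel \<Otimes>\<^sub>M P x)"
    by (subst measurable_pair_swap_iff) simp
  from borel_measurable_nn_integral[OF this] show ?thesis
    by (simp add: exit_density_def[abs_def])
qed

lemma nn_integral_exit_density:
  assumes \<sigma>: "\<sigma> \<in> borel_measurable M" and f [measurable]: "f \<in> borel_measurable borel"
  shows "(\<integral>\<^sup>+ y. exit_density \<sigma> t x y * f y \<partial>lborel)
    = (\<integral>\<^sup>+ \<omega>. case_option 0 (heat (t - enn2real (\<sigma> \<omega>)) f) (X (\<sigma> \<omega>) \<omega>) * indicator {\<omega> \<in> space M. \<sigma> \<omega> < ennreal t} \<omega> \<partial>P x)"
proof -
  interpret prob_space "P x" by (rule prob_space_P)
  interpret pair_sigma_finite lborel "P x" ..
  let ?g = "\<lambda>\<omega> y. if \<sigma> \<omega> < ennreal t then case_option 0 (\<lambda>z. p (t - enn2real (\<sigma> \<omega>)) z y) (X (\<sigma> \<omega>) \<omega>) else 0"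
  have g: "(\<lambda>w. ?g (fst w) (snd w)) \<in> borel_measurable (P x \<Otimes>\<^sub>M borel)"
    unfolding measurable_P_pair using exit_integrand_measurable[OF \<sigma>, of t] by (simp add: case_prod_beta')
  have gs [measurable]: "(\<lambda>w. ?g (snd w) (fst w)) \<in> borel_measurable (borel \<Otimes>\<^sub>M P x)"
    using measurable_compose[OF measurable_pair_swap' g] unfolding case_prod_beta fst_conv snd_conv .
  have gy: "(\<lambda>\<omega>. ennreal (?g \<omega> y)) \<in> borel_measurable (P x)" for y
  proof -
    have "(\<lambda>\<omega>. ?g \<omega> y) \<in> borel_measurable (P x)"
      using measurable_compose[OF measurable_Pair1' gs, of y] unfolding fst_conv snd_conv by simp
    then show ?thesis by (rule measurable_compose[OF _ measurable_ennreal])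
  qed
  have "(\<integral>\<^sup>+ y. exit_density \<sigma> t x y * f y \<partial>lborel) = (\<integral>\<^sup>+ y. \<integral>\<^sup>+ \<omega>. ennreal (?g \<omega> y) * f y \<partial>P x \<partial>lborel)"
    unfolding exit_density_def by (intro nn_integral_cong nn_integral_multc[symmetric] gy)
  also have "\<dots> = (\<integral>\<^sup>+ \<omega>. \<integral>\<^sup>+ y. ennreal (?g \<omega> y) * f y \<partial>lborel \<partial>P x)"
  proof (rule Fubini'[symmetric])
    have "(\<lambda>w. ennreal (?g (snd w) (fst w)) * f (fst w)) \<in> borel_measurable (borel \<Otimes>\<^sub>M P x)" by measurable
    then show "(\<lambda>(y, \<omega>). ennreal (?g \<omega> y) * f y) \<in> borel_measurable (lborel \<Otimes>\<^sub>M P x)"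
      by (simp add: case_prod_beta')
  qed
  also have "\<dots> = (\<integral>\<^sup>+ \<omega>. case_option 0 (heat (t - enn2real (\<sigma> \<omega>)) f) (X (\<sigma> \<omega>) \<omega>) * indicator {\<omega> \<in> space M. \<sigma> \<omega> < ennreal t} \<omega> \<partial>P x)"
    by (intro nn_integral_cong) (auto simp: heat_def indicator_def space_P split: option.split)
  finally show ?thesis .
qed

text \<open>It identifies \<open>exit_density\<close> as the density of the position at time
  \<open>t\<close> on the event that \<open>\<sigma>\<close> comes before \<open>t\<close>. Both
  sides are integrals against finite measures that agree on continuous functions with bounded
  support.\<close>

lemma strong_markov_remaining:
  assumes \<sigma>: "stopping_time Fl \<sigma>" and f: "f \<in> borel_measurable borel"
  shows "(\<integral>\<^sup>+ \<omega>. case_option 0 f (X (ennreal t) \<omega>) * indicator {\<omega> \<in> space M. \<sigma> \<omega> < ennreal t} \<omega> \<partial>P x)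
    = (\<integral>\<^sup>+ y. exit_density \<sigma> t x y * f y \<partial>lborel)"
proof -
  interpret prob_space "P x" by (rule prob_space_P)
  note \<sigma>m [measurable] = stopping_time_measurable[OF \<sigma>]
  let ?B = "{\<omega> \<in> space M. \<sigma> \<omega> < ennreal t}"
  let ?v = "case_option 0 (\<lambda>z. z)"
  have [measurable]: "(\<lambda>\<omega>. ?v (X (ennreal t) \<omega>)) \<in> borel_measurable M"
    by (rule measurable_compose[OF X_measurable]) measurable
  have [measurable]: "(\<lambda>\<omega>. case_option 0 (\<lambda>z. 1 :: ennreal) (X (ennreal t) \<omega>)) \<in> borel_measurable M"
    by (rule measurable_compose[OF X_measurable]) measurable
  \<comment> \<open>Paths at the cemetery get weight \<open>0\<close>, so sending them to the dummy
    point \<open>0\<close> of the state space adds no mass there.\<close>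
  let ?w = "\<lambda>\<omega>. case_option 0 (\<lambda>z. 1 :: ennreal) (X (ennreal t) \<omega>) * indicator ?B \<omega>"
  define N1 where "N1 = distr (density (P x) ?w) borel (\<lambda>\<omega>. ?v (X (ennreal t) \<omega>))"
  define N2 where "N2 = density lborel (exit_density \<sigma> t x)"
  have N1: "(\<integral>\<^sup>+ y. g y \<partial>N1) = (\<integral>\<^sup>+ \<omega>. case_option 0 g (X (ennreal t) \<omega>) * indicator ?B \<omega> \<partial>P x)"
    if [measurable]: "g \<in> borel_measurable borel" for g
  proof -
    have m: "measurable (density (P x) ?w) L = measurable M L" for L :: "'a measure"
      by (rule measurable_cong_sets) (auto simp: sets_P)
    have "(\<integral>\<^sup>+ y. g y \<partial>N1) = (\<integral>\<^sup>+ \<omega>. g (?v (X (ennreal t) \<omega>)) \<partial>density (P x) ?w)"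
      unfolding N1_def by (rule nn_integral_distr) (auto simp: m)
    also have "\<dots> = (\<integral>\<^sup>+ \<omega>. ?w \<omega> * g (?v (X (ennreal t) \<omega>)) \<partial>P x)"
      by (rule nn_integral_density) auto
    also have "\<dots> = (\<integral>\<^sup>+ \<omega>. case_option 0 g (X (ennreal t) \<omega>) * indicator ?B \<omega> \<partial>P x)"
      by (intro nn_integral_cong) (auto simp: mult.commute split: option.split)
    finally show ?thesis .
  qed
  have N2: "(\<integral>\<^sup>+ y. g y \<partial>N2) = (\<integral>\<^sup>+ y. exit_density \<sigma> t x y * g y \<partial>lborel)"
    if [measurable]: "g \<in> borel_measurable borel" for g
    unfolding N2_def by (rule nn_integral_density) auto
  have "N1 = N2"
  proof (rule finite_measure_eq_on_Cc)
    show sets12: "sets N1 = sets borel" "sets N2 = sets borel" by (simp_all add: N1_def N2_def)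
    show eq: "(\<integral>\<^sup>+ x. ennreal (f x) \<partial>N1) = (\<integral>\<^sup>+ x. ennreal (f x) \<partial>N2)"
      if "continuous_on UNIV f" "\<And>x. 0 \<le> f x \<and> f x \<le> 1" "bounded {x. f x \<noteq> 0}" for f :: "'a \<Rightarrow> real"
    proof -
      have [measurable]: "f \<in> borel_measurable borel" by (rule borel_measurable_continuous_onI[OF that(1)])
      have e: "case_option 0 (\<lambda>y. ennreal (f y)) z = ennreal (case_option 0 f z)" for z by (simp split: option.split)
      show ?thesis
        using strong_markov_remaining_Cc[OF \<sigma> that, where t = t and x = x] nn_integral_exit_density[OF \<sigma>m, where f = "\<lambda>y. ennreal (f y)" and t = t and x = x]
        by (simp add: N1 N2 e)
    qed
    have "emeasure N1 UNIV = (\<integral>\<^sup>+ y. 1 \<partial>N1)"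
      using sets_eq_imp_space_eq[OF sets12(1)] by simp
    also have "\<dots> \<le> (\<integral>\<^sup>+ \<omega>. 1 \<partial>P x)"
      unfolding N1[OF borel_measurable_const]
      by (intro nn_integral_mono) (auto simp: indicator_def split: option.split)
    finally show "emeasure N1 UNIV < \<infinity>"
      by (metis emeasure_space_1 ennreal_one_less_top infinity_ennreal_def le_less_trans mult_1 nn_integral_const)
    have "emeasure N2 UNIV = (\<integral>\<^sup>+ y. 1 \<partial>N2)"
      using sets_eq_imp_space_eq[OF sets12(2)] by simp
    also have "\<dots> = (\<integral>\<^sup>+ \<omega>. case_option 0 (heat (t - enn2real (\<sigma> \<omega>)) (\<lambda>_. 1)) (X (\<sigma> \<omega>) \<omega>) * indicator ?B \<omega> \<partial>P x)"
      unfolding N2[OF borel_measurable_const] by (rule nn_integral_exit_density) auto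
    also have "\<dots> \<le> (\<integral>\<^sup>+ \<omega>. 1 \<partial>P x)"
      by (intro nn_integral_mono)
         (auto simp: indicator_def heat_1_le dest: less_ennreal_imp_enn2real_less split: option.split)
    finally show "emeasure N2 UNIV < \<infinity>"
      by (metis emeasure_space_1 ennreal_one_less_top infinity_ennreal_def le_less_trans mult_1 nn_integral_const)
  qed
  then show ?thesis using N1[OF f] N2[OF f] by simp
qed

end

section \<open>The killed semigroup\<close>

context hunt_density begin

text \<open>Only the event \<open>\<sigma> = t\<close> has to be discussed: there the position is
  off \<open>D\<close>, hence different from \<open>y\<close>, and \<open>p 0\<close> vanishes off
  the diagonal.\<close>

lemma dirichlet_heat_kernel_eq:
  assumes \<sigma>: "\<sigma> \<in> borel_measurable M" and t: "0 < t" and x: "x \<in> D" and y: "y \<in> D"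
    and exit: "exits_at D \<sigma> x"
  shows "dirichlet_heat_kernel P X p D t x y = p t x y - enn2real (exit_density \<sigma> t (Some x) y)"
proof -
  let ?g = "\<lambda>\<omega>. if \<sigma> \<omega> < ennreal t then case_option 0 (\<lambda>z. p (t - enn2real (\<sigma> \<omega>)) z y) (X (\<sigma> \<omega>) \<omega>) else 0"
  have g: "?g \<in> borel_measurable (P (Some x))"
    using measurable_compose[OF measurable_Pair2' exit_integrand_measurable[OF \<sigma>, of t], of y]
    unfolding measurable_P case_prod_conv by simp
  have g0: "0 \<le> ?g \<omega>" for \<omega>
    by (auto intro!: p_nonneg dest: less_ennreal_imp_enn2real_less split: option.split)
  have "(\<integral>\<omega>. (let \<tau> = exit_time X D \<omega> in
            if \<tau> \<le> ennreal t then case_option 0 (\<lambda>z. p (t - enn2real \<tau>) z y) (X \<tau> \<omega>) else 0)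
        \<partial>completion (P (Some x))) = (\<integral>\<omega>. ?g \<omega> \<partial>P (Some x))"
  proof (rule integral_completion_AE[OF g])
    show "AE \<omega> in P (Some x). (let \<tau> = exit_time X D \<omega> in
            if \<tau> \<le> ennreal t then case_option 0 (\<lambda>z. p (t - enn2real \<tau>) z y) (X \<tau> \<omega>) else 0) = ?g \<omega>"
      using exit
    proof eventually_elim
      case (elim \<omega>)
      have "case_option 0 (\<lambda>z. p (t - enn2real (\<sigma> \<omega>)) z y) (X (\<sigma> \<omega>) \<omega>) = 0" if "\<sigma> \<omega> = ennreal t"
      proof (cases "X (\<sigma> \<omega>) \<omega>")
        case (Some z)
        then have "z \<noteq> y" using elim that y by auto
        then show ?thesis using Some that t by (simp add: p_0)
      qed simp
      then show ?case using elim by (auto simp: Let_def less_le)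
    qed
  qed
  \<comment> \<open>No integrability is required: if the nonnegative integral is infinite, the
    Bochner integral has the default value \<open>0\<close>, which is also \<open>enn2real\<close>
    of infinity.\<close>
  also have "\<dots> = enn2real (exit_density \<sigma> t (Some x) y)"
    unfolding exit_density_def using g g0 by (intro integral_eq_nn_integral) auto
  finally show ?thesis by (simp add: dirichlet_heat_kernel_def)
qed

text \<open>\<open>heat t f x\<close> is split in two ways: by densities into the exit part and the
  kernel part, and by paths according to whether \<open>\<sigma>\<close> comes before
  \<open>t\<close>. The exit parts agree and are cancelled, for which they must be finite; this is
  where the bound on \<open>f\<close> enters. The splitting of the density holds almost everywhere,
  where \<open>exit_density\<close> is finite, and uses that the kernel is nonnegative.\<close>

lemma nn_integral_dirichlet_heat_kernel_le:
  assumes \<sigma>: "stopping_time Fl \<sigma>" and t: "0 < t" and x: "x \<in> D"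
    and exit: "exits_at D \<sigma> x"
    and nonneg: "\<And>y. y \<in> D \<Longrightarrow> 0 \<le> dirichlet_heat_kernel P X p D t x y"
    and f [measurable]: "f \<in> borel_measurable borel" and f_le: "\<And>y. f y \<le> ennreal c" and f_0: "\<And>y. y \<notin> D \<Longrightarrow> f y = 0"
  shows "(\<integral>\<^sup>+ y. ennreal (dirichlet_heat_kernel P X p D t x y) * f y \<partial>lborel)
    \<le> (\<integral>\<^sup>+ \<omega>. case_option 0 f (X (ennreal t) \<omega>) * indicator {\<omega> \<in> space M. \<not> \<sigma> \<omega> < ennreal t} \<omega> \<partial>P (Some x))"
proof -
  interpret prob_space "P (Some x)" by (rule prob_space_P)
  note \<sigma>m [measurable] = stopping_time_measurable[OF \<sigma>]
  let ?B = "{\<omega> \<in> space M. \<sigma> \<omega> < ennreal t}" and ?C = "{\<omega> \<in> space M. \<not> \<sigma> \<omega> < ennreal t}"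
  let ?e = "exit_density \<sigma> t (Some x)"
  let ?F = "\<lambda>\<omega>. case_option 0 f (X (ennreal t) \<omega>)"
  define k where "k y = p t x y - enn2real (?e y)" for y
  have [measurable]: "?e \<in> borel_measurable borel" by measurable
  have [measurable]: "k \<in> borel_measurable borel" unfolding k_def using t by measurable
  have kD: "dirichlet_heat_kernel P X p D t x y = k y" if "y \<in> D" for y
    unfolding k_def by (rule dirichlet_heat_kernel_eq[OF \<sigma>m t x that exit])
  have mass: "(\<integral>\<^sup>+ y. ?e y * g y \<partial>lborel) \<le> ennreal d"
    if [measurable]: "g \<in> borel_measurable borel" and "\<And>y. g y \<le> ennreal d" for g d
  proof -
    have "(\<integral>\<^sup>+ y. ?e y * g y \<partial>lborel) = (\<integral>\<^sup>+ \<omega>. case_option 0 g (X (ennreal t) \<omega>) * indicator ?B \<omega> \<partial>P (Some x))"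
      by (rule strong_markov_remaining[OF \<sigma> that(1), symmetric])
    also have "\<dots> \<le> (\<integral>\<^sup>+ \<omega>. ennreal d \<partial>P (Some x))"
      using that(2) by (intro nn_integral_mono) (auto simp: indicator_def split: option.split)
    finally show ?thesis by (simp add: emeasure_space_1)
  qed
  have "AE y in lborel. ?e y \<noteq> \<infinity>"
  proof (rule nn_integral_PInf_AE)
    have "(\<integral>\<^sup>+ y. ?e y * 1 \<partial>lborel) \<le> ennreal 1" by (rule mass) auto
    then have "(\<integral>\<^sup>+ y. ?e y \<partial>lborel) \<le> 1" by simp
    also have "\<dots> < \<infinity>" by simp
    finally show "(\<integral>\<^sup>+ y. ?e y \<partial>lborel) \<noteq> \<infinity>" by simp
  qed measurable
  then have AE_sum: "AE y in lborel. ?e y * f y + ennreal (k y) * f y = ennreal (p t x y) * f y"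
  proof eventually_elim
    case (elim y)
    show ?case
    proof (cases "y \<in> D")
      case True
      then have "0 \<le> k y" using nonneg kD by force
      then have "ennreal (p t x y) = ennreal (enn2real (?e y)) + ennreal (k y)"
        by (subst ennreal_plus[symmetric]) (auto simp: k_def)
      also have "ennreal (enn2real (?e y)) = ?e y" using elim by (simp add: less_top)
      finally show ?thesis by (simp add: distrib_right)
    qed (simp add: f_0)
  qed
  have "(\<integral>\<^sup>+ y. ?e y * f y \<partial>lborel) + (\<integral>\<^sup>+ y. ennreal (k y) * f y \<partial>lborel)
      = (\<integral>\<^sup>+ y. ?e y * f y + ennreal (k y) * f y \<partial>lborel)"
    by (rule nn_integral_add[symmetric]) measurable
  also have "\<dots> = heat t f x" unfolding heat_def by (rule nn_integral_cong_AE[OF AE_sum])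
  also have "\<dots> = (\<integral>\<^sup>+ \<omega>. ?F \<omega> \<partial>P (Some x))" using nn_integral_X[OF t f, of "Some x"] by simp
  also have "\<dots> = (\<integral>\<^sup>+ \<omega>. ?F \<omega> * indicator ?B \<omega> + ?F \<omega> * indicator ?C \<omega> \<partial>P (Some x))"
    by (intro nn_integral_cong) (auto simp: indicator_def space_P)
  also have "\<dots> = (\<integral>\<^sup>+ \<omega>. ?F \<omega> * indicator ?B \<omega> \<partial>P (Some x)) + (\<integral>\<^sup>+ \<omega>. ?F \<omega> * indicator ?C \<omega> \<partial>P (Some x))"
    by (rule nn_integral_add) simp_all
  also have "(\<integral>\<^sup>+ \<omega>. ?F \<omega> * indicator ?B \<omega> \<partial>P (Some x)) = (\<integral>\<^sup>+ y. ?e y * f y \<partial>lborel)"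
    by (rule strong_markov_remaining[OF \<sigma> f])
  finally have "(\<integral>\<^sup>+ y. ennreal (k y) * f y \<partial>lborel) = (\<integral>\<^sup>+ \<omega>. ?F \<omega> * indicator ?C \<omega> \<partial>P (Some x))"
    using mass[OF f f_le] by (subst (asm) ennreal_add_left_cancel) (auto simp: top_unique)
  moreover have "(\<integral>\<^sup>+ y. ennreal (dirichlet_heat_kernel P X p D t x y) * f y \<partial>lborel) = (\<integral>\<^sup>+ y. ennreal (k y) * f y \<partial>lborel)"
  proof (intro nn_integral_cong)
    fix y show "ennreal (dirichlet_heat_kernel P X p D t x y) * f y = ennreal (k y) * f y"
      by (cases "y \<in> D") (auto simp: kD f_0)
  qed
  ultimately show ?thesis by simp
qed

section \<open>Killing at the points of a time grid\<close>

definition killed :: "real \<Rightarrow> 'a set \<Rightarrow> ('a \<Rightarrow> ennreal) \<Rightarrow> 'a \<Rightarrow> ennreal" where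
  "killed h D f x = indicator D x * heat h (\<lambda>y. indicator D y * f y) x"

lemma killed_measurable [measurable]:
  assumes "0 < h" "D \<in> sets borel" "f \<in> borel_measurable borel"
  shows "killed h D f \<in> borel_measurable borel"
  unfolding killed_def[abs_def] using assms by measurable

lemma killed_power_measurable:
  assumes "0 < h" "D \<in> sets borel" "f \<in> borel_measurable borel"
  shows "(killed h D ^^ n) f \<in> borel_measurable borel"
  by (induction n) (use assms in auto)

definition survival_set :: "real \<Rightarrow> 'a set \<Rightarrow> nat \<Rightarrow> 'w set" where
  "survival_set h D n = {\<omega> \<in> space M. \<forall>k\<le>n. X (ennreal (real k * h)) \<omega> \<in> Some ` D}"

lemma survival_set_pre_sigma:
  assumes h: "0 < h" and D: "D \<in> sets borel"
  shows "survival_set h D n \<in> sets (pre_sigma (\<lambda>_. ennreal (real n * h)))"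
proof (rule sets_pre_sigmaI[OF stopping_time_const])
  fix t
  have "{\<omega> \<in> space M. \<forall>k\<le>n. X (ennreal (real k * h)) \<omega> \<in> Some ` D} \<in> sets (Fl t)" if le: "ennreal (real n * h) \<le> t"
  proof -
    have "{\<omega> \<in> space M. X (ennreal (real k * h)) \<omega> \<in> Some ` D} \<in> sets (Fl t)" if "k \<le> n" for k
    proof -
      have "ennreal (real k * h) \<le> t"
        using h that by (intro order_trans[OF ennreal_leI le] mult_right_mono) auto
      then have "sets (Fl (ennreal (real k * h))) \<subseteq> sets (Fl t)" by (rule sets_F_mono)
      moreover have "{\<omega> \<in> space M. X (ennreal (real k * h)) \<omega> \<in> Some ` D} \<in> sets (Fl (ennreal (real k * h)))"
        using measurable_sets[OF adapted Some_image_in_cemetery_borel[OF D]]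
        by (simp add: space_Fl vimage_def Int_def conj_commute)
      ultimately show ?thesis by blast
    qed
    then have "(\<Inter>k\<in>{..n}. {\<omega> \<in> space M. X (ennreal (real k * h)) \<omega> \<in> Some ` D}) \<in> sets (Fl t)"
      by (intro sets.finite_INT) auto
    also have "(\<Inter>k\<in>{..n}. {\<omega> \<in> space M. X (ennreal (real k * h)) \<omega> \<in> Some ` D})
        = {\<omega> \<in> space M. \<forall>k\<le>n. X (ennreal (real k * h)) \<omega> \<in> Some ` D}" by auto
    finally show ?thesis .
  qed
  note S = this[folded survival_set_def]
  show "{\<omega> \<in> survival_set h D n. ennreal (real n * h) \<le> t} \<in> sets (Fl t)"
  proof (cases "ennreal (real n * h) \<le> t")
    case True
    then have "{\<omega> \<in> survival_set h D n. ennreal (real n * h) \<le> t} = survival_set h D n" by blast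
    then show ?thesis using S[OF True] by (simp only:)
  next
    case False
    then have "{\<omega> \<in> survival_set h D n. ennreal (real n * h) \<le> t} = {}" by blast
    then show ?thesis by (simp only: sets.empty_sets)
  qed
qed

lemma survival_set_sets [measurable]:
  assumes "0 < h" "D \<in> sets borel"
  shows "survival_set h D n \<in> sets M"
  using survival_set_pre_sigma[OF assms, of n] subalgebra_pre_sigma[OF stopping_time_const]
  by (auto simp: subalgebra_def sets_P)

text \<open>The last step is peeled off by the Markov property at time \<open>n h\<close>, so the
  induction hypothesis is applied to \<open>killed h D f\<close> and \<open>f\<close> has to stay
  general. Time \<open>0\<close> belongs to the survival event, which is harmless for a start in
  \<open>D\<close>.\<close>

lemma killed_power_eq:
  assumes h: "0 < h" and D: "D \<in> sets borel" and x: "x \<in> D" and f: "f \<in> borel_measurable borel"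
  shows "(killed h D ^^ n) f x
    = (\<integral>\<^sup>+ \<omega>. indicator (survival_set h D n) \<omega> * case_option 0 f (X (ennreal (real n * h)) \<omega>) \<partial>P (Some x))"
  using f
proof (induction n arbitrary: f)
  case 0
  interpret prob_space "P (Some x)" by (rule prob_space_P)
  have "AE \<omega> in P (Some x). \<omega> \<in> space M" using AE_space[of "P (Some x)"] by (simp add: space_P)
  then have "AE \<omega> in P (Some x). indicator (survival_set h D 0) \<omega> * case_option 0 f (X (ennreal (real 0 * h)) \<omega>) = f x"
    using normal[of "Some x"] by eventually_elim (use x in \<open>simp add: survival_set_def\<close>)
  then have "(\<integral>\<^sup>+ \<omega>. indicator (survival_set h D 0) \<omega> * case_option 0 f (X (ennreal (real 0 * h)) \<omega>) \<partial>P (Some x))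
      = (\<integral>\<^sup>+ \<omega>. f x \<partial>P (Some x))"
    by (rule nn_integral_cong_AE)
  then show ?case by (simp add: emeasure_space_1)
next
  case (Suc n)
  note [measurable] = Suc.prems D
  let ?f = "\<lambda>y. indicator D y * f y"
  let ?A = "survival_set h D n"
  have time: "ennreal (real n * h) + ennreal h = ennreal (real (Suc n) * h)"
    using h by (subst ennreal_plus[symmetric]) (auto simp: algebra_simps)
  have "(\<integral>\<^sup>+ \<omega>. indicator (survival_set h D (Suc n)) \<omega> * case_option 0 f (X (ennreal (real (Suc n) * h)) \<omega>) \<partial>P (Some x))
      = (\<integral>\<^sup>+ \<omega>. indicator ?A \<omega> * case_option 0 ?f (X (ennreal (real n * h) + ennreal h) \<omega>) \<partial>P (Some x))"
    unfolding time
    by (intro nn_integral_cong)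
       (auto simp: survival_set_def indicator_def le_Suc_eq split: option.split)
  also have "\<dots> = (\<integral>\<^sup>+ \<omega>. indicator ?A \<omega> * (\<integral>\<^sup>+ \<omega>'. case_option 0 ?f (X (ennreal h) \<omega>') \<partial>P (X (ennreal (real n * h)) \<omega>)) \<partial>P (Some x))"
    by (rule strong_markov_nn_integral[OF stopping_time_const survival_set_pre_sigma[OF h D], where f = "case_option 0 ?f"]) measurable
  also have "\<dots> = (\<integral>\<^sup>+ \<omega>. indicator ?A \<omega> * case_option 0 (killed h D f) (X (ennreal (real n * h)) \<omega>) \<partial>P (Some x))"
    using h by (intro nn_integral_cong)
      (auto simp: nn_integral_X survival_set_def indicator_def killed_def split: option.split)
  also have "\<dots> = (killed h D ^^ n) (killed h D f) x"
    using h by (intro Suc.IH[symmetric]) measurable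
  finally show ?case by (simp add: funpow_swap1)
qed

lemma killed_power_outside: "0 < n \<Longrightarrow> x \<notin> D \<Longrightarrow> (killed h D ^^ n) f x = 0"
  by (cases n) (auto simp: killed_def)

lemma killed_power_le_heat:
  assumes "0 < h" "D \<in> sets borel" "f \<in> borel_measurable borel" "0 < n"
  shows "(killed h D ^^ n) f x \<le> heat (real n * h) f x"
proof (cases "x \<in> D")
  case True
  have "(killed h D ^^ n) f x \<le> (\<integral>\<^sup>+ \<omega>. case_option 0 f (X (ennreal (real n * h)) \<omega>) \<partial>P (Some x))"
    unfolding killed_power_eq[OF assms(1,2) True assms(3)]
    by (intro nn_integral_mono) (auto simp: indicator_def)
  also have "\<dots> = heat (real n * h) f x" using assms nn_integral_X[of "real n * h" f "Some x"] by simp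
  finally show ?thesis .
qed (simp add: killed_power_outside assms)

text \<open>Halving the step adds times at which the path is required to be in \<open>D\<close>; the
  terminal time is the same.\<close>

lemma killed_power_refine:
  assumes h: "0 < h" and D: "D \<in> sets borel" and f: "f \<in> borel_measurable borel" and n: "0 < n"
  shows "(killed (h / 2) D ^^ (2 * n)) f x \<le> (killed h D ^^ n) f x"
proof (cases "x \<in> D")
  case True
  have sub: "survival_set (h / 2) D (2 * n) \<subseteq> survival_set h D n"
  proof
    fix \<omega> assume w: "\<omega> \<in> survival_set (h / 2) D (2 * n)"
    have "X (ennreal (real k * h)) \<omega> \<in> Some ` D" if "k \<le> n" for k
    proof -
      have "X (ennreal (real (2 * k) * (h / 2))) \<omega> \<in> Some ` D"
        using w that unfolding survival_set_def by (auto simp del: of_nat_mult)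
      then show ?thesis by simp
    qed
    then show "\<omega> \<in> survival_set h D n" using w by (simp add: survival_set_def)
  qed
  have h2: "0 < h / 2" using h by simp
  show ?thesis
    unfolding killed_power_eq[OF h D True f] killed_power_eq[OF h2 D True f]
    by (intro nn_integral_mono mult_mono) (use sub in \<open>auto simp: indicator_def\<close>)
qed (simp add: killed_power_outside n)

text \<open>A path that has not exited before \<open>t\<close> is in \<open>D\<close> at every
  positive grid time before \<open>t\<close>, and at time \<open>0\<close> by the choice of
  \<open>x\<close>. At the last grid time, \<open>t\<close> itself, it may be outside, but there
  \<open>f\<close> vanishes.\<close>

lemma dirichlet_heat_kernel_le_killed:
  assumes D: "open D" and t: "0 < t" and x: "x \<in> D" and n: "0 < n"
    and nonneg: "\<And>y. y \<in> D \<Longrightarrow> 0 \<le> dirichlet_heat_kernel P X p D t x y"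
    and f: "f \<in> borel_measurable borel" and f_le: "\<And>y. f y \<le> ennreal c" and f_0: "\<And>y. y \<notin> D \<Longrightarrow> f y = 0"
  shows "(\<integral>\<^sup>+ y. ennreal (dirichlet_heat_kernel P X p D t x y) * f y \<partial>lborel) \<le> (killed (t / real n) D ^^ n) f x"
proof -
  let ?h = "t / real n"
  obtain \<sigma> where \<sigma>1: "stopping_time Fl \<sigma>" and
    \<sigma>x: "\<forall>x\<in>D. exits_at D \<sigma> x"
    by (rule exit_time_stopping[OF D])
  note \<sigma> = \<sigma>1 bspec[OF \<sigma>x x]
  have nh: "real n * ?h = t" using n by simp
  have "AE \<omega> in P (Some x). case_option 0 f (X (ennreal t) \<omega>) * indicator {\<omega> \<in> space M. \<not> \<sigma> \<omega> < ennreal t} \<omega>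
      \<le> indicator (survival_set ?h D n) \<omega> * case_option 0 f (X (ennreal t) \<omega>)"
    using \<sigma>(2) normal[of "Some x"]
  proof eventually_elim
    case (elim \<omega>)
    have "case_option 0 f (X (ennreal t) \<omega>) = 0"
      if w: "\<omega> \<in> space M" "\<not> \<sigma> \<omega> < ennreal t" "\<omega> \<notin> survival_set ?h D n"
    proof -
      obtain k where k: "k \<le> n" "X (ennreal (real k * ?h)) \<omega> \<notin> Some ` D"
        using w by (auto simp: survival_set_def)
      have "k \<noteq> 0" using k(2) elim x by auto
      then have "0 < ennreal (real k * ?h)" using t n by simp
      then have le: "\<sigma> \<omega> \<le> ennreal (real k * ?h)"
        using elim k(2) unfolding exit_time_def by (metis (mono_tags, lifting) Inf_lower mem_Collect_eq)
      \<comment> \<open>A visit outside \<open>D\<close> at an earlier positive grid time would push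
        \<open>\<sigma>\<close> below \<open>t\<close>.\<close>
      have "k = n"
      proof (rule ccontr)
        assume "k \<noteq> n"
        then have "real k * ?h < t" using k(1) t n by (simp add: field_simps)
        then have "ennreal (real k * ?h) < ennreal t" using t n by (intro ennreal_lessI) auto
        then show False using le w(2) by (simp add: not_less)
      qed
      then show ?thesis using k(2) nh f_0 by (auto split: option.split)
    qed
    then show ?case by (auto simp: indicator_def)
  qed
  then have "(\<integral>\<^sup>+ \<omega>. case_option 0 f (X (ennreal t) \<omega>) * indicator {\<omega> \<in> space M. \<not> \<sigma> \<omega> < ennreal t} \<omega> \<partial>P (Some x))
      \<le> (\<integral>\<^sup>+ \<omega>. indicator (survival_set ?h D n) \<omega> * case_option 0 f (X (ennreal t) \<omega>) \<partial>P (Some x))"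
    by (rule nn_integral_mono_AE)
  also have "\<dots> = (killed ?h D ^^ n) f x"
    using killed_power_eq[of ?h D x f n] t n D x f nh by auto
  finally show ?thesis
    using nn_integral_dirichlet_heat_kernel_le[OF \<sigma>(1) t x \<sigma>(2) nonneg f f_le f_0] by (meson order_trans)
qed

end

section \<open>The energy of the killed semigroup\<close>

lemma ennreal_sum_squares_bound: "2 * a * b \<le> a\<^sup>2 + b\<^sup>2" for a b :: ennreal
proof (cases "a = top \<or> b = top")
  case True
  then have eq: "a\<^sup>2 + b\<^sup>2 = top" by (auto simp: power2_eq_square)
  show ?thesis unfolding eq by simp
next
  case False
  then obtain x y where "a = ennreal x" "0 \<le> x" "b = ennreal y" "0 \<le> y"
    by (metis ennreal_cases)
  moreover have "ennreal (2 * x * y) \<le> ennreal (x\<^sup>2 + y\<^sup>2)" by (rule ennreal_leI[OF sum_squares_bound])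
  ultimately show ?thesis by (simp add: ennreal_mult'' ennreal_power ennreal_plus ennreal_mult)
qed

lemma ennreal_mult_le_sum_squares: "a * b \<le> a\<^sup>2 + b\<^sup>2" for a b :: ennreal
proof -
  have "a * b + 0 \<le> a * b + a * b" by (rule add_left_mono) simp
  also have "\<dots> = 2 * a * b" by (simp add: mult_2 distrib_right)
  also have "\<dots> \<le> a\<^sup>2 + b\<^sup>2" by (rule ennreal_sum_squares_bound)
  finally show ?thesis by simp
qed

text \<open>
  Applied to \<open>b k = (Q\<^sup>k f, Q\<^sup>k f)\<close> with a symmetric contraction \<open>Q\<close>, where it takes the place of the
  spectral bound on \<open>\<lambda> exp (- 2 \<lambda> t)\<close>.
\<close>

lemma convex_decreasing_diff_le:
  fixes b :: "nat \<Rightarrow> real"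
  assumes nonneg: "\<And>k. 0 \<le> b k" and dec: "\<And>k. b (Suc k) \<le> b k"
    and conv: "\<And>k. 2 * b (Suc k) \<le> b k + b (Suc (Suc k))"
  shows "b n - b (n + m) \<le> real m / real (n + 1) * b 0"
proof -
  define d where "d k = b k - b (Suc k)" for k
  have d0: "0 \<le> d k" for k using dec by (simp add: d_def)
  have "d (Suc k) \<le> d k" for k using conv[of k] by (simp add: d_def)
  then have dd: "d j \<le> d i" if "i \<le> j" for i j using that by (rule lift_Suc_antimono_le)
  have "real (n + 1) * d n = (\<Sum>k<Suc n. d n)" by simp
  also have "\<dots> \<le> (\<Sum>k<Suc n. d k)" by (intro sum_mono dd) simp
  also have "\<dots> = b 0 - b (Suc n)" unfolding d_def by (rule sum_lessThan_telescope')
  finally have "real (n + 1) * d n \<le> b 0" using nonneg[of "Suc n"] by simp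
  then have dn: "d n \<le> b 0 / real (n + 1)" by (simp add: field_simps)
  have "b n - b (n + m) = (\<Sum>i<m. d (n + i))"
    using sum_lessThan_telescope'[of "\<lambda>i. b (n + i)" m] by (simp add: d_def)
  also have "\<dots> \<le> (\<Sum>i<m. d n)" by (intro sum_mono dd) simp
  also have "\<dots> = real m * d n" by simp
  also have "\<dots> \<le> real m * (b 0 / real (n + 1))" by (intro mult_left_mono dn) simp
  finally show ?thesis by simp
qed

context hunt_density begin

section \<open>Symmetry and contractivity on nonnegative functions\<close>

lemma semigroup_eq_heat:
  assumes t: "0 < t" and [measurable]: "u \<in> borel_measurable borel" and u: "\<And>y. 0 \<le> u y"
  shows "semigroup P X t u x = enn2real (heat t (\<lambda>y. ennreal (u y)) x)"
proof -
  have e: "ennreal (case_option 0 u z) = case_option 0 (\<lambda>y. ennreal (u y)) z" for z by (simp split: option.split)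
  have "semigroup P X t u x = enn2real (\<integral>\<^sup>+ \<omega>. ennreal (case_option 0 u (X (ennreal t) \<omega>)) \<partial>P (Some x))"
    unfolding semigroup_def
  proof (rule integral_eq_nn_integral)
    show "(\<lambda>\<omega>. case_option 0 u (X (ennreal t) \<omega>)) \<in> borel_measurable (P (Some x))"
      unfolding measurable_P by (rule measurable_compose[OF X_measurable]) measurable
  qed (auto simp: u split: option.split)
  also have "\<dots> = enn2real (heat t (\<lambda>y. ennreal (u y)) x)"
    unfolding e using nn_integral_X[OF t, of "\<lambda>y. ennreal (u y)" "Some x"] by simp
  finally show ?thesis .
qed

lemma heat_incseq_limit:
  assumes t: "0 < t" and meas [measurable]: "\<And>i. f i \<in> borel_measurable borel"
    and inc: "\<And>y. incseq (\<lambda>i. f i y)" and lim: "\<And>y. (\<lambda>i. f i y) \<longlonglongrightarrow> g y" and [measurable]: "g \<in> borel_measurable borel"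
  shows "(\<lambda>i. heat t (f i) x) \<longlonglongrightarrow> heat t g x"
  unfolding heat_def
proof (rule nn_integral_LIMSEQ)
  show "incseq (\<lambda>i y. ennreal (p t x y) * f i y)"
    using inc by (auto simp: incseq_def le_fun_def intro!: mult_left_mono)
  show "(\<lambda>i. ennreal (p t x y) * f i y) \<longlonglongrightarrow> ennreal (p t x y) * g y" for y
    by (intro ennreal_tendsto_cmult lim) simp
qed (use t in measurable)

text \<open>Symmetry is assumed for square integrable real functions and Bochner integrals, while
  \<open>heat\<close> is applied to bounded nonnegative functions whose integrals may be infinite,
  such as the constant \<open>1\<close>. Cut off to balls, bounded functions are square integrable;
  the balls are removed by monotone convergence on both sides.\<close>

lemma heat_symmetric:
  assumes sym: "\<And>f g. f \<in> L2 lborel \<Longrightarrow> g \<in> L2 lborel \<Longrightarrow>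
      (\<integral>x. semigroup P X t f x * g x \<partial>lborel) = (\<integral>x. f x * semigroup P X t g x \<partial>lborel)"
    and t: "0 < t" and fm: "f \<in> borel_measurable borel" and gm: "g \<in> borel_measurable borel"
    and fc: "\<And>y. f y \<le> ennreal c" and gc: "\<And>y. g y \<le> ennreal c"
  shows "(\<integral>\<^sup>+ x. heat t f x * g x \<partial>lborel) = (\<integral>\<^sup>+ x. f x * heat t g x \<partial>lborel)"
proof -
  define r where "r f i y = enn2real (f y) * indicator (cball (0 :: 'a) (real i)) y" for f :: "'a \<Rightarrow> ennreal" and i :: nat and y
  have [measurable]: "cball (0 :: 'a) q \<in> sets borel" for q by simp
  have r_meas [measurable]: "r f i \<in> borel_measurable borel" if [measurable]: "f \<in> borel_measurable borel" for f i
    unfolding r_def by measurable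
  have r0: "0 \<le> r f i y" for f i y by (simp add: r_def)
  have er: "ennreal (r f i y) = f y * indicator (cball 0 (real i)) y" if "\<And>y. f y \<le> ennreal c" for f i y
  proof -
    have "f y < top" using that[of y] by (rule le_less_trans) simp
    then show ?thesis by (simp add: r_def indicator_def)
  qed
  have r_le: "r f i y \<le> max c 0 * indicator (cball 0 (real i)) y" if "\<And>y. f y \<le> ennreal c" for f i y
  proof -
    have "f y \<le> ennreal (max c 0)" using that[of y] by (rule order_trans) (simp add: ennreal_leI)
    then have "enn2real (f y) \<le> max c 0" by (intro enn2real_leI) auto
    then show ?thesis by (simp add: r_def indicator_def)
  qed
  have r_le': "r f i y \<le> max c 0" if "\<And>y. f y \<le> ennreal c" for f i y
    using r_le[of f i y, OF that] by (cases "norm y \<le> real i") (simp_all add: indicator_def max.coboundedI2)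
  have int_ball: "integrable lborel (\<lambda>y. K * indicator (cball (0::'a) (real i)) y)" for i and K :: real
    by (intro integrable_mult_right integrable_real_indicator) (use emeasure_bounded_finite[OF bounded_cball] in auto)
  have bounded_int: "integrable lborel h" if "h \<in> borel_measurable borel" "\<And>y. 0 \<le> h y \<and> h y \<le> K * indicator (cball 0 (real i)) y" for h :: "'a \<Rightarrow> real" and K i
    by (rule Bochner_Integration.integrable_bound[OF int_ball[of K i]]) (use that in \<open>auto intro!: AE_I2 order_trans[OF _ abs_ge_self]\<close>)
  have L2: "r f i \<in> L2 lborel" if [measurable]: "f \<in> borel_measurable borel" and le: "\<And>y. f y \<le> ennreal c" for f i
  proof -
    have "integrable lborel (\<lambda>y. (r f i y)\<^sup>2)"
    proof (rule bounded_int[where K = "(max c 0)\<^sup>2" and i = i])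
      show "0 \<le> (r f i y)\<^sup>2 \<and> (r f i y)\<^sup>2 \<le> (max c 0)\<^sup>2 * indicator (cball 0 (real i)) y" for y
        using power_mono[OF r_le[of f i y, OF le] r0, where n = 2]
        by (cases "norm y \<le> real i") (simp_all add: power_mult_distrib indicator_def)
    qed measurable
    then show ?thesis by (simp add: L2_def)
  qed
  let ?h = "\<lambda>f i. heat t (\<lambda>y. ennreal (r f i y))"
  have h_bd: "?h f i x \<le> ennreal (max c 0)" if le: "\<And>y. f y \<le> ennreal c" for f i x
    by (rule heat_le[OF t]) (intro ennreal_leI r_le' le)
  have h_le: "enn2real (?h f i x) \<le> max c 0" if "\<And>y. f y \<le> ennreal c" for f i x
    using h_bd[OF that] by (intro enn2real_leI) auto
  have nn: "(\<integral>\<^sup>+ x. ?h f i x * ennreal (r g i x) \<partial>lborel)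
      = ennreal (\<integral>x. semigroup P X t (r f i) x * r g i x \<partial>lborel)"
    if [measurable]: "f \<in> borel_measurable borel" "g \<in> borel_measurable borel"
      and f_le: "\<And>y. f y \<le> ennreal c" and g_le: "\<And>y. g y \<le> ennreal c" for f g i
  proof -
    have fin: "?h f i x < top" for x
      by (rule le_less_trans[OF h_bd[OF f_le]]) simp
    have sg: "semigroup P X t (r f i) x = enn2real (?h f i x)" for x
      by (rule semigroup_eq_heat[OF t]) (auto simp: r0)
    have "(\<integral>\<^sup>+ x. ?h f i x * ennreal (r g i x) \<partial>lborel)
        = (\<integral>\<^sup>+ x. ennreal (semigroup P X t (r f i) x * r g i x) \<partial>lborel)"
      by (intro nn_integral_cong) (use fin in \<open>simp add: sg ennreal_mult' r0 less_top\<close>)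
    also have "\<dots> = ennreal (\<integral>x. semigroup P X t (r f i) x * r g i x \<partial>lborel)"
    proof (rule nn_integral_eq_integral)
      have [measurable]: "?h f i \<in> borel_measurable borel" using t by measurable
      show "integrable lborel (\<lambda>x. semigroup P X t (r f i) x * r g i x)"
      proof (rule bounded_int[where K = "max c 0 * max c 0" and i = i])
        show "(\<lambda>x. semigroup P X t (r f i) x * r g i x) \<in> borel_measurable borel" unfolding sg by measurable
        fix x
        have "enn2real (?h f i x) * r g i x \<le> max c 0 * (max c 0 * indicator (cball 0 (real i)) x)"
          by (intro mult_mono h_le f_le r_le g_le r0) auto
        then show "0 \<le> semigroup P X t (r f i) x * r g i x \<and> semigroup P X t (r f i) x * r g i x \<le> max c 0 * max c 0 * indicator (cball 0 (real i)) x"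
          by (simp add: sg r0 mult.assoc)
      qed
    qed (simp add: sg r0)
    finally show ?thesis .
  qed
  let ?T = "\<lambda>f i y. f y * indicator (cball (0 :: 'a) (real i)) y :: ennreal"
  let ?I = "\<lambda>f g i. \<integral>\<^sup>+ x. heat t (?T f i) x * ?T g i x \<partial>lborel"
  have Tinc: "incseq (\<lambda>i. ?T f i y)" for f y
    by (auto simp: incseq_def indicator_def)
  have Tlim: "(\<lambda>i. ?T f i y) \<longlonglongrightarrow> f y" for f y
  proof (rule tendsto_eventually)
    obtain k :: nat where k: "norm y \<le> real k" using real_arch_simple by blast
    show "\<forall>\<^sub>F i in sequentially. ?T f i y = f y"
      using eventually_ge_at_top[of k]
    proof eventually_elim
      case (elim i)
      then have "norm y \<le> real i" using k by simp
      then show ?case by simp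
    qed
  qed
  have "?I f g i = (\<integral>\<^sup>+ x. ?T f i x * heat t (?T g i) x \<partial>lborel)" for i
    using nn[of f g i, OF fm gm fc gc] nn[of g f i, OF gm fm gc fc] sym[OF L2[of f i, OF fm fc] L2[of g i, OF gm gc]]
    by (simp add: er[OF fc] er[OF gc] mult.commute)
  moreover have conv: "?I f g \<longlonglongrightarrow> (\<integral>\<^sup>+ x. heat t f x * g x \<partial>lborel)"
    if [measurable]: "f \<in> borel_measurable borel" "g \<in> borel_measurable borel"
      and f_le: "\<And>y. f y \<le> ennreal c" and g_le: "\<And>y. g y \<le> ennreal c" for f g
  proof (rule nn_integral_LIMSEQ)
    show "(\<lambda>i. heat t (?T f i) x * ?T g i x) \<longlonglongrightarrow> heat t f x * g x" for x
    proof -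
      have "heat t f x \<le> ennreal c" by (rule heat_le[OF t f_le])
      then have "heat t f x < top" by (rule le_less_trans) simp
      moreover have "g x < top" using g_le[of x] by (rule le_less_trans) simp
      ultimately have fin: "\<not> (heat t f x = 0 \<and> g x = top \<or> heat t f x = top \<and> g x = 0)" by auto
      have "(\<lambda>i. heat t (?T f i) x) \<longlonglongrightarrow> heat t f x"
        by (rule heat_incseq_limit[OF t _ Tinc Tlim]) measurable
      from tendsto_mult_ennreal[OF this Tlim] fin show ?thesis by simp
    qed
    show "incseq (\<lambda>i x. heat t (?T f i) x * ?T g i x)"
      using Tinc by (auto simp: incseq_def le_fun_def intro!: mult_mono heat_mono)
    show "(\<lambda>x. heat t (?T f i) x * ?T g i x) \<in> borel_measurable lborel" for i
      using t by measurable
  qed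
  moreover have "(\<lambda>i. \<integral>\<^sup>+ x. ?T f i x * heat t (?T g i) x \<partial>lborel) \<longlonglongrightarrow> (\<integral>\<^sup>+ x. f x * heat t g x \<partial>lborel)"
    using conv[OF gm fm gc fc] by (simp add: mult.commute)
  ultimately show ?thesis
    using conv[OF fm gm fc gc] LIMSEQ_unique by simp
qed

lemma heat_finite: "0 < t \<Longrightarrow> (\<And>y. f y \<le> ennreal c) \<Longrightarrow> heat t f x < top"
  by (rule le_less_trans[OF heat_le[of t f "ennreal c"]]) auto

text \<open>Jensen's inequality for a kernel of mass at most \<open>1\<close>, without division:
  integrate \<open>2 a f <= a^2 + f^2\<close> with \<open>a = heat t f x\<close> and cancel one
  \<open>a^2\<close>. The bound on \<open>f\<close> makes \<open>a\<close> finite, so the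
  cancellation is legitimate.\<close>

lemma heat_square_le:
  assumes t: "0 < t" and [measurable]: "f \<in> borel_measurable borel" and fc: "\<And>y. f y \<le> ennreal c"
  shows "(heat t f x)\<^sup>2 \<le> heat t (\<lambda>y. (f y)\<^sup>2) x"
proof -
  let ?a = "heat t f x"
  have fin: "?a < top" by (rule heat_finite[OF t fc])
  have [measurable]: "(\<lambda>y. p t x y) \<in> borel_measurable borel" using t by measurable
  have "?a\<^sup>2 + ?a\<^sup>2 = 2 * ?a * ?a" by (simp add: power2_eq_square mult_2 distrib_right)
  also have "\<dots> = (\<integral>\<^sup>+ y. ennreal (p t x y) * (2 * ?a * f y) \<partial>lborel)"
    unfolding heat_def by (subst nn_integral_cmult[symmetric]) (auto intro!: nn_integral_cong simp: ac_simps)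
  also have "\<dots> \<le> (\<integral>\<^sup>+ y. ennreal (p t x y) * (?a\<^sup>2 + (f y)\<^sup>2) \<partial>lborel)"
    by (intro nn_integral_mono mult_left_mono ennreal_sum_squares_bound) simp
  also have "\<dots> = (\<integral>\<^sup>+ y. ?a\<^sup>2 * (ennreal (p t x y) * 1) + ennreal (p t x y) * (f y)\<^sup>2 \<partial>lborel)"
    by (intro nn_integral_cong) (simp add: distrib_left mult.commute)
  also have "\<dots> = ?a\<^sup>2 * heat t (\<lambda>_. 1) x + heat t (\<lambda>y. (f y)\<^sup>2) x"
    unfolding heat_def[of t "\<lambda>_. 1"] heat_def[of t "\<lambda>y. (f y)\<^sup>2"]
    by (subst nn_integral_add) (auto simp: nn_integral_cmult)
  also have "\<dots> \<le> ?a\<^sup>2 * 1 + heat t (\<lambda>y. (f y)\<^sup>2) x"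
    by (intro add_mono mult_left_mono heat_1_le t) auto
  finally have "?a\<^sup>2 + ?a\<^sup>2 \<le> ?a\<^sup>2 + heat t (\<lambda>y. (f y)\<^sup>2) x" by simp
  moreover have "?a\<^sup>2 \<noteq> top" using fin by (simp add: power2_eq_square ennreal_mult_eq_top_iff)
  ultimately show ?thesis by (simp add: ennreal_add_left_cancel_le)
qed

lemma killed_le: "0 < h \<Longrightarrow> (\<And>y. f y \<le> c) \<Longrightarrow> killed h D f x \<le> c"
  unfolding killed_def
  using heat_le[of h "\<lambda>y. indicator D y * f y" c x] by (force simp: indicator_def)

lemma killed_power_le: "0 < h \<Longrightarrow> (\<And>y. f y \<le> c) \<Longrightarrow> (killed h D ^^ n) f x \<le> c"
  by (induction n arbitrary: x) (auto intro: killed_le)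

end

section \<open>Powers of the discretely killed operator as symmetric contractions\<close>

locale symmetric_hunt_density = hunt_density M Fl X \<theta> P p
  for M :: "'w measure" and Fl and X :: "ennreal \<Rightarrow> 'w \<Rightarrow> 'a::euclidean_space option" and \<theta> and P
    and p :: "real \<Rightarrow> 'a \<Rightarrow> 'a \<Rightarrow> real" +
  assumes semigroup_symmetric: "\<And>t f g. 0 < t \<Longrightarrow> f \<in> L2 lborel \<Longrightarrow> g \<in> L2 lborel \<Longrightarrow>
      (\<integral>x. semigroup P X t f x * g x \<partial>lborel) = (\<integral>x. f x * semigroup P X t g x \<partial>lborel)"
begin

lemma killed_symmetric:
  assumes h: "0 < h" and [measurable]: "D \<in> sets borel" "f \<in> borel_measurable borel" "g \<in> borel_measurable borel"
    and fc: "\<And>y. f y \<le> ennreal c" and gc: "\<And>y. g y \<le> ennreal c"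
  shows "(\<integral>\<^sup>+ x. killed h D f x * g x \<partial>lborel) = (\<integral>\<^sup>+ x. f x * killed h D g x \<partial>lborel)"
proof -
  have "(\<integral>\<^sup>+ x. heat h (\<lambda>y. indicator D y * f y) x * (indicator D x * g x) \<partial>lborel)
      = (\<integral>\<^sup>+ x. indicator D x * f x * heat h (\<lambda>y. indicator D y * g y) x \<partial>lborel)"
  proof (rule heat_symmetric[OF semigroup_symmetric[OF h] h])
    show "indicator D y * f y \<le> ennreal c" for y using fc[of y] by (simp add: indicator_def)
    show "indicator D y * g y \<le> ennreal c" for y using gc[of y] by (simp add: indicator_def)
  qed auto
  then show ?thesis by (simp add: killed_def ac_simps)
qed

text \<open>After \<open>heat_square_le\<close>, symmetry moves the operator from the square onto
  the constant \<open>1\<close>, where it is at most \<open>1\<close>.\<close>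

lemma killed_contraction:
  assumes h: "0 < h" and [measurable]: "D \<in> sets borel" "f \<in> borel_measurable borel"
    and fc: "\<And>y. f y \<le> ennreal c"
  shows "(\<integral>\<^sup>+ x. (killed h D f x)\<^sup>2 \<partial>lborel) \<le> (\<integral>\<^sup>+ x. (f x)\<^sup>2 \<partial>lborel)"
proof -
  let ?F = "\<lambda>y. (indicator D y * f y)\<^sup>2"
  have F: "indicator D y * f y \<le> ennreal c" for y using fc[of y] by (simp add: indicator_def)
  have "(\<integral>\<^sup>+ x. (killed h D f x)\<^sup>2 \<partial>lborel) \<le> (\<integral>\<^sup>+ x. heat h ?F x * 1 \<partial>lborel)"
  proof (rule nn_integral_mono)
    fix x
    have "(killed h D f x)\<^sup>2 \<le> (heat h (\<lambda>y. indicator D y * f y) x)\<^sup>2"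
      by (intro power_mono) (auto simp: killed_def indicator_def)
    also have "\<dots> \<le> heat h ?F x" by (rule heat_square_le[OF h _ F]) measurable
    finally show "(killed h D f x)\<^sup>2 \<le> heat h ?F x * 1" by simp
  qed
  also have "\<dots> = (\<integral>\<^sup>+ x. ?F x * heat h (\<lambda>_. 1) x \<partial>lborel)"
  \<comment> \<open>\<open>heat_symmetric\<close> asks for one bound on both functions, here the
    square and the constant \<open>1\<close>. The inner maximum handles a negative \<open>c\<close>,
    for which \<open>ennreal c\<close> is \<open>0\<close>.\<close>
  proof (rule heat_symmetric[OF semigroup_symmetric[OF h] h, where c = "max 1 ((max c 0)\<^sup>2)"])
    show "?F y \<le> ennreal (max 1 ((max c 0)\<^sup>2))" for y
    proof -
      have "indicator D y * f y \<le> ennreal (max c 0)" using F[of y] by (rule order_trans) (simp add: ennreal_leI)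
      then have "?F y \<le> (ennreal (max c 0))\<^sup>2" by (rule power_mono) simp
      then have "?F y \<le> ennreal ((max c 0)\<^sup>2)" unfolding ennreal_power[OF max.cobounded2] .
      then show ?thesis by (rule order_trans) (simp add: ennreal_leI)
    qed
    show "1 \<le> ennreal (max 1 ((max c 0)\<^sup>2))" by simp
  qed auto
  also have "\<dots> \<le> (\<integral>\<^sup>+ x. (f x)\<^sup>2 * 1 \<partial>lborel)"
    by (intro nn_integral_mono mult_mono heat_1_le h) (auto simp: indicator_def)
  finally show ?thesis by simp
qed

lemma heat_contraction:
  assumes "0 < h" "f \<in> borel_measurable borel" "\<And>y. f y \<le> ennreal c"
  shows "(\<integral>\<^sup>+ x. (heat h f x)\<^sup>2 \<partial>lborel) \<le> (\<integral>\<^sup>+ x. (f x)\<^sup>2 \<partial>lborel)"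
  using killed_contraction[of h UNIV f c] assms by (simp add: killed_def)

lemma killed_power_contraction:
  assumes h: "0 < h" and D: "D \<in> sets borel" and f: "f \<in> borel_measurable borel"
    and fc: "\<And>y. f y \<le> ennreal c"
  shows "(\<integral>\<^sup>+ x. ((killed h D ^^ n) f x)\<^sup>2 \<partial>lborel) \<le> (\<integral>\<^sup>+ x. (f x)\<^sup>2 \<partial>lborel)"
proof (induction n)
  case (Suc n)
  have "(\<integral>\<^sup>+ x. ((killed h D ^^ Suc n) f x)\<^sup>2 \<partial>lborel) \<le> (\<integral>\<^sup>+ x. ((killed h D ^^ n) f x)\<^sup>2 \<partial>lborel)"
    using killed_contraction[OF h D killed_power_measurable[OF h D f] killed_power_le[OF h fc]] by simp
  then show ?case using Suc by (rule order_trans)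
qed simp

lemma killed_power_symmetric:
  assumes h: "0 < h" and D: "D \<in> sets borel" and f: "f \<in> borel_measurable borel" and g: "g \<in> borel_measurable borel"
    and fc: "\<And>y. f y \<le> ennreal c" and gc: "\<And>y. g y \<le> ennreal c"
  shows "(\<integral>\<^sup>+ x. (killed h D ^^ n) f x * g x \<partial>lborel) = (\<integral>\<^sup>+ x. f x * (killed h D ^^ n) g x \<partial>lborel)"
  using g gc
proof (induction n arbitrary: g)
  case (Suc n)
  have "(\<integral>\<^sup>+ x. (killed h D ^^ Suc n) f x * g x \<partial>lborel) = (\<integral>\<^sup>+ x. (killed h D ^^ n) f x * killed h D g x \<partial>lborel)"
    using killed_symmetric[OF h D killed_power_measurable[OF h D f] Suc.prems(1) killed_power_le[OF h fc] Suc.prems(2)] by simp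
  also have "\<dots> = (\<integral>\<^sup>+ x. f x * (killed h D ^^ n) (killed h D g) x \<partial>lborel)"
    by (rule Suc.IH) (use h D Suc.prems killed_le in auto)
  finally show ?case by (simp add: funpow_swap1)
qed simp

text \<open>With \<open>b k\<close> the squared norm of the \<open>k\<close>-th power applied to
  \<open>f\<close>, the quantity to control is \<open>b n - b (n + m)\<close>. The killed powers in
  the inner product are replaced by the transition operator only at the end, where the domination
  enlarges the right-hand side.\<close>

lemma killed_power_energy_bound:
  fixes n :: nat
  assumes h: "0 < h" and D: "D \<in> sets borel" and f: "f \<in> borel_measurable borel"
    and fc: "\<And>y. f y \<le> ennreal c" and fin: "(\<integral>\<^sup>+ x. (f x)\<^sup>2 \<partial>lborel) < \<infinity>" and m: "0 < m"
  defines "u \<equiv> (killed h D ^^ n) f"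
  shows "(\<integral>\<^sup>+ x. (u x)\<^sup>2 \<partial>lborel)
    \<le> (\<integral>\<^sup>+ x. u x * heat (real (2 * m) * h) u x \<partial>lborel) + ennreal (real m / real (n + 1)) * (\<integral>\<^sup>+ x. (f x)\<^sup>2 \<partial>lborel)"
proof -
  let ?Q = "\<lambda>k. (killed h D ^^ k) f"
  note Qm = killed_power_measurable[OF h D f] and Qc = killed_power_le[OF h fc]
  note [measurable] = Qm
  define B where "B k = (\<integral>\<^sup>+ x. (?Q k x)\<^sup>2 \<partial>lborel)" for k
  define b where "b k = enn2real (B k)" for k
  have Bfin: "B k < top" for k
    using killed_power_contraction[OF h D f fc, where n = k] fin unfolding B_def by (simp add: le_less_trans)
  then have Bb: "B k = ennreal (b k)" for k by (simp add: b_def)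
  have b0: "0 \<le> b k" for k by (simp add: b_def)
  have "B (Suc k) \<le> B k" for k
    unfolding B_def using killed_contraction[OF h D Qm[of k] Qc[where n = k]] by simp
  then have dec: "b (Suc k) \<le> b k" for k using b0 by (simp add: Bb)
  \<comment> \<open>By symmetry such an inner product depends only on the total number of factors.
    The case \<open>j = 1\<close> gives the convexity of \<open>b\<close>, and \<open>j = m\<close>,
    \<open>k = n\<close> gives the inner product in the conclusion.\<close>
  have shift: "(\<integral>\<^sup>+ x. ?Q k x * ?Q (2 * j + k) x \<partial>lborel) = B (k + j)" for j k
  proof -
    have "(\<integral>\<^sup>+ x. ?Q k x * (killed h D ^^ j) (?Q (j + k)) x \<partial>lborel) = (\<integral>\<^sup>+ x. (killed h D ^^ j) (?Q k) x * ?Q (j + k) x \<partial>lborel)"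
      by (rule killed_power_symmetric[OF h D Qm Qm Qc Qc, symmetric])
    moreover have "(killed h D ^^ j) (?Q k) = ?Q (j + k)" "(killed h D ^^ j) (?Q (j + k)) = ?Q (2 * j + k)"
      by (simp_all add: funpow_add mult_2)
    ultimately show ?thesis by (simp add: B_def power2_eq_square add.commute)
  qed
  have "2 * B (Suc k) \<le> B k + B (Suc (Suc k))" for k
  proof -
    have "2 * B (Suc k) = (\<integral>\<^sup>+ x. 2 * ?Q k x * ?Q (Suc (Suc k)) x \<partial>lborel)"
    proof -
      have "2 * B (Suc k) = 2 * (\<integral>\<^sup>+ x. ?Q k x * ?Q (2 * 1 + k) x \<partial>lborel)" unfolding shift by simp
      also have "\<dots> = (\<integral>\<^sup>+ x. 2 * (?Q k x * ?Q (2 * 1 + k) x) \<partial>lborel)"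
        by (rule nn_integral_cmult[symmetric]) measurable
      finally show ?thesis by (simp add: mult.assoc)
    qed
    also have "\<dots> \<le> (\<integral>\<^sup>+ x. (?Q k x)\<^sup>2 + (?Q (Suc (Suc k)) x)\<^sup>2 \<partial>lborel)"
      by (intro nn_integral_mono ennreal_sum_squares_bound)
    also have "\<dots> = B k + B (Suc (Suc k))"
      unfolding B_def by (rule nn_integral_add) (use Qm in measurable)
    finally show ?thesis .
  qed
  then have conv: "2 * b (Suc k) \<le> b k + b (Suc (Suc k))" for k
    using b0 by (simp add: Bb ennreal_plus[symmetric] ennreal_mult'[symmetric] flip: ennreal_numeral del: ennreal_plus)
  have "b n \<le> b (n + m) + real m / real (n + 1) * b 0"
    using convex_decreasing_diff_le[of b n m, OF b0 dec conv] by simp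
  then have "ennreal (b n) \<le> ennreal (b (n + m) + real m / real (n + 1) * b 0)" by (rule ennreal_leI)
  also have "\<dots> = B (n + m) + ennreal (real m / real (n + 1)) * B 0"
    using b0 by (simp only: Bb) (subst ennreal_mult'[symmetric], simp_all)
  also have "B (n + m) = (\<integral>\<^sup>+ x. u x * (killed h D ^^ (2 * m)) u x \<partial>lborel)"
    unfolding shift[symmetric] u_def by (simp add: funpow_add)
  also have "\<dots> \<le> (\<integral>\<^sup>+ x. u x * heat (real (2 * m) * h) u x \<partial>lborel)"
    unfolding u_def by (intro nn_integral_mono mult_left_mono killed_power_le_heat h D Qm) (use m in auto)
  finally show ?thesis
    by (simp add: B_def u_def Bb[symmetric] add_right_mono)
qed

end

section \<open>The killing rate and the jump energy\<close>

lemma jump_kernel_exit_measurable: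
  fixes J :: "'a::euclidean_space \<Rightarrow> 'a \<Rightarrow> real"
  assumes J: "jump_kernel J" and [measurable]: "D \<in> sets borel"
  shows "(\<lambda>(x, y). indicator D x * indicator (- D) y * J x y) \<in> borel_measurable (borel \<Otimes>\<^sub>M borel)"
proof -
  let ?L = "\<lambda>z :: 'a \<times> 'a. indicator D (fst z) * indicator (- D) (snd z) * (indicator {(x, y). x \<noteq> y} z *\<^sub>R (case z of (x, y) \<Rightarrow> J x y))"
  \<comment> \<open>\<open>jump_kernel\<close> makes \<open>J\<close> measurable off the diagonal
    only. Extending it by \<open>0\<close> changes nothing here, since the two indicators in
    \<open>?L\<close> exclude the diagonal.\<close>
  have [measurable]: "(\<lambda>z :: 'a \<times> 'a. indicator {(x, y). x \<noteq> y} z *\<^sub>R (case z of (x, y) \<Rightarrow> J x y)) \<in> borel_measurable (borel \<Otimes>\<^sub>M borel)"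
  proof -
    have "{(x :: 'a, y). x \<noteq> y} = {(x, y) | x y. x \<noteq> y}" by auto
    then have "open {(x :: 'a, y). x \<noteq> y}" using open_diagonal_complement by simp
    then have "{(x :: 'a, y). x \<noteq> y} \<in> sets borel" by simp
    then show ?thesis
      using J unfolding jump_kernel_def
      by (subst (asm) borel_measurable_restrict_space_iff) (auto simp: borel_prod)
  qed
  have "?L \<in> borel_measurable (borel \<Otimes>\<^sub>M borel)"
    by measurable
  also have "?L
      = (\<lambda>(x, y). indicator D x * indicator (- D) y * J x y)"
    by (auto simp: fun_eq_iff indicator_def)
  finally show ?thesis .
qed

lemma killing_rate_eq:
  "x \<in> D \<Longrightarrow> killing_rate J D x = (\<integral>\<^sup>+ y. ennreal (indicator D x * indicator (- D) y * J x y) \<partial>lborel)"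
  unfolding killing_rate_def by (intro nn_integral_cong) (simp add: indicator_def)

lemma killing_rate_measurable:
  assumes J: "jump_kernel J" and D [measurable]: "D \<in> sets borel"
  shows "(\<lambda>x. indicator D x * killing_rate J D x) \<in> borel_measurable borel"
proof -
  let ?L = "\<lambda>x. indicator D x * (\<integral>\<^sup>+ y. ennreal (indicator D x * indicator (- D) y * J x y) \<partial>lborel)"
  note [measurable] = jump_kernel_exit_measurable[OF J D]
  have "?L \<in> borel_measurable borel"
    by measurable
  also have "?L = (\<lambda>x. indicator D x * killing_rate J D x)"
    by (auto simp: fun_eq_iff indicator_def killing_rate_def intro!: nn_integral_cong)
  finally show ?thesis .
qed

text \<open>The energy is restricted to pairs with \<open>x\<close> in \<open>D\<close> and
  \<open>y\<close> outside, where \<open>w y = 0\<close> and the squared difference is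
  \<open>(w x)^2\<close>; the inner integral over \<open>y\<close> is then the killing rate. The
  reversed pairs and those inside \<open>D\<close> are dropped.\<close>

lemma killing_rate_le_energy:
  assumes J: "jump_kernel J" and D [measurable]: "D \<in> sets borel"
    and w [measurable]: "w \<in> borel_measurable borel" and w0: "\<And>x. x \<notin> D \<Longrightarrow> w x = 0"
  shows "(\<integral>\<^sup>+ x. indicator D x * ennreal ((w x)\<^sup>2) * killing_rate J D x \<partial>lborel) \<le> energy J w"
proof -
  let ?J = "\<lambda>x y. indicator D x * indicator (- D) y * J x y"
  note J_meas [measurable] = jump_kernel_exit_measurable[OF J D]
  have J0: "0 \<le> J x y" if "x \<noteq> y" for x y using J that by (simp add: jump_kernel_def)
  have Jm: "(\<lambda>y. ennreal (?J x y)) \<in> borel_measurable borel" for x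
    using measurable_compose[OF measurable_Pair1' J_meas, of x] unfolding case_prod_conv by simp
  interpret lborel: pair_sigma_finite lborel lborel ..
  have "(\<integral>\<^sup>+ x. indicator D x * ennreal ((w x)\<^sup>2) * killing_rate J D x \<partial>lborel)
      = (\<integral>\<^sup>+ x. \<integral>\<^sup>+ y. ennreal ((w x)\<^sup>2) * ennreal (?J x y) \<partial>lborel \<partial>lborel)"
  proof (rule nn_integral_cong)
    fix x
    show "indicator D x * ennreal ((w x)\<^sup>2) * killing_rate J D x = (\<integral>\<^sup>+ y. ennreal ((w x)\<^sup>2) * ennreal (?J x y) \<partial>lborel)"
    proof (cases "x \<in> D")
      case True
      have "indicator D x * ennreal ((w x)\<^sup>2) * killing_rate J D x = ennreal ((w x)\<^sup>2) * (\<integral>\<^sup>+ y. ennreal (?J x y) \<partial>lborel)"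
        using True by (simp add: killing_rate_eq)
      also have "\<dots> = (\<integral>\<^sup>+ y. ennreal ((w x)\<^sup>2) * ennreal (?J x y) \<partial>lborel)"
        by (rule nn_integral_cmult[symmetric]) (use Jm in simp)
      finally show ?thesis .
    qed simp
  qed
  also have "\<dots> = (\<integral>\<^sup>+ z. ennreal ((w (fst z))\<^sup>2) * ennreal (?J (fst z) (snd z)) \<partial>(lborel \<Otimes>\<^sub>M lborel))"
  proof -
    have "(\<lambda>z. ennreal ((w (fst z))\<^sup>2) * ennreal (case z of (x, y) \<Rightarrow> ?J x y)) \<in> borel_measurable (lborel \<Otimes>\<^sub>M lborel)"
      by measurable
    from lborel.nn_integral_fst[OF this] show ?thesis by (simp add: case_prod_beta)
  qed
  also have "\<dots> \<le> energy J w"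
    unfolding energy_def
  proof (rule nn_integral_mono)
    fix z :: "'a \<times> 'a"
    show "ennreal ((w (fst z))\<^sup>2) * ennreal (?J (fst z) (snd z))
        \<le> ennreal ((w (fst z) - w (snd z))\<^sup>2 * J (fst z) (snd z)) * indicator {(x, y). x \<noteq> y} z"
    proof (cases "fst z \<in> D \<and> snd z \<notin> D")
      case True
      then have "fst z \<noteq> snd z" by auto
      then show ?thesis using True by (simp add: w0 indicator_def case_prod_beta ennreal_mult' J0)
    qed (auto simp: indicator_def)
  qed
  finally show ?thesis .
qed

context symmetric_hunt_density begin

section \<open>Dyadic refinement of the grid and passage to the limit\<close>

definition dyadic_killed :: "real \<Rightarrow> 'a set \<Rightarrow> ('a \<Rightarrow> ennreal) \<Rightarrow> nat \<Rightarrow> 'a \<Rightarrow> ennreal" where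
  "dyadic_killed t D f j = (killed (t / 2 ^ j) D ^^ (2 ^ j)) f"

text \<open>
  The limit of the discretely killed semigroups ignores exits that are seen at no dyadic time, so it
  may be larger than the Dirichlet semigroup. An upper bound is all that is needed, and it inherits
  symmetry from the transition semigroup, which would have to be proved for the Dirichlet heat kernel.
\<close>

definition killed_limit :: "real \<Rightarrow> 'a set \<Rightarrow> ('a \<Rightarrow> ennreal) \<Rightarrow> 'a \<Rightarrow> ennreal" where
  "killed_limit t D f x = (INF j. dyadic_killed t D f j x)"

lemma dyadic_killed_measurable:
  assumes "0 < t" "D \<in> sets borel" "f \<in> borel_measurable borel"
  shows "dyadic_killed t D f j \<in> borel_measurable borel"
  unfolding dyadic_killed_def by (rule killed_power_measurable) (use assms in auto)

lemma dyadic_killed_le: "0 < t \<Longrightarrow> (\<And>y. f y \<le> c) \<Longrightarrow> dyadic_killed t D f j x \<le> c"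
  unfolding dyadic_killed_def by (rule killed_power_le) auto

lemma dyadic_killed_decseq:
  assumes "0 < t" "D \<in> sets borel" "f \<in> borel_measurable borel"
  shows "decseq (\<lambda>j. dyadic_killed t D f j x)"
proof (rule decseq_SucI)
  fix j
  show "dyadic_killed t D f (Suc j) x \<le> dyadic_killed t D f j x"
    using killed_power_refine[of "t / 2 ^ j" D f "2 ^ j" x] assms
    by (simp add: dyadic_killed_def divide_divide_eq_left mult.commute)
qed

text \<open>In \<open>killed_power_energy_bound\<close> take \<open>2 ^ j\<close> steps and
  \<open>m = 2 ^ (j - i)\<close>. The time lag is then \<open>2 t / 2 ^ i\<close> for every
  \<open>j\<close>, and the coefficient is at most \<open>(1/2) ^ i\<close>, so \<open>j\<close> can
  tend to infinity with the lag fixed.\<close>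

lemma killed_limit_energy_bound:
  assumes t: "0 < t" and D: "D \<in> sets borel" and f: "f \<in> borel_measurable borel"
    and fc: "\<And>y. f y \<le> ennreal c" and fin: "(\<integral>\<^sup>+ x. (f x)\<^sup>2 \<partial>lborel) < \<infinity>"
  defines "v \<equiv> killed_limit t D f"
  shows "(\<integral>\<^sup>+ x. (v x)\<^sup>2 \<partial>lborel)
    \<le> (\<integral>\<^sup>+ x. v x * heat (2 * t / 2 ^ i) v x \<partial>lborel) + ennreal ((1/2) ^ i) * (\<integral>\<^sup>+ x. (f x)\<^sup>2 \<partial>lborel)"
proof -
  let ?s = "2 * t / 2 ^ i"
  let ?u = "dyadic_killed t D f"
  have s: "0 < ?s" using t by simp
  note um [measurable] = dyadic_killed_measurable[OF t D f]
  note uc = dyadic_killed_le[where f = f, OF t fc]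
  have [measurable]: "v \<in> borel_measurable borel"
    unfolding v_def killed_limit_def[abs_def] by measurable
  have heat_m [measurable]: "heat ?s g \<in> borel_measurable borel" if [measurable]: "g \<in> borel_measurable borel" for g
    using s by measurable
  have dec: "?u j x \<le> ?u 0 x" for j x
    using dyadic_killed_decseq[OF t D f, of x] by (auto simp: decseq_def)
  have v_le: "v x \<le> ?u j x" for j x
    unfolding v_def killed_limit_def by (rule INF_lower) simp
  have vc: "v x \<le> ennreal c" for x using v_le[of x 0] uc by (rule order_trans)
  have u_lim: "(\<lambda>j. ?u j x) \<longlonglongrightarrow> v x" for x
    unfolding v_def killed_limit_def by (rule LIMSEQ_INF[OF dyadic_killed_decseq[OF t D f]])
  have heat_lim: "(\<lambda>j. heat ?s (?u j) x) \<longlonglongrightarrow> heat ?s v x" for x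
  proof -
    have [measurable]: "(\<lambda>y. p ?s x y) \<in> borel_measurable borel" using s by measurable
    show ?thesis
      unfolding heat_def
    proof (rule nn_integral_dominated_convergence[where w = "\<lambda>y. ennreal (p ?s x y) * ennreal c"])
      show "(\<integral>\<^sup>+ y. ennreal (p ?s x y) * ennreal c \<partial>lborel) < \<infinity>"
        using heat_finite[OF s, of "\<lambda>_. ennreal c" c x] by (simp add: heat_def)
      show "AE y in lborel. (\<lambda>j. ennreal (p ?s x y) * ?u j y) \<longlonglongrightarrow> ennreal (p ?s x y) * v y"
        by (intro AE_I2 ennreal_tendsto_cmult u_lim) simp
    qed (auto intro!: mult_left_mono uc)
  qed
  let ?I = "\<lambda>j. \<integral>\<^sup>+ x. ?u j x * heat ?s (?u j) x \<partial>lborel"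
  \<comment> \<open>The functions \<open>?u j\<close> decrease in \<open>j\<close>, so the product
    is dominated by its value at \<open>j = 0\<close>, and this by a sum of squares, both integrable
    by contractivity.\<close>
  have lim: "?I \<longlonglongrightarrow> (\<integral>\<^sup>+ x. v x * heat ?s v x \<partial>lborel)"
  proof (rule nn_integral_dominated_convergence[where w = "\<lambda>x. (?u 0 x)\<^sup>2 + (heat ?s (?u 0) x)\<^sup>2"])
    have u0: "(\<integral>\<^sup>+ x. (?u 0 x)\<^sup>2 \<partial>lborel) \<le> (\<integral>\<^sup>+ x. (f x)\<^sup>2 \<partial>lborel)"
      unfolding dyadic_killed_def by (rule killed_power_contraction[OF _ D f fc]) (use t in simp)
    moreover have "(\<integral>\<^sup>+ x. (heat ?s (?u 0) x)\<^sup>2 \<partial>lborel) \<le> (\<integral>\<^sup>+ x. (?u 0 x)\<^sup>2 \<partial>lborel)"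
      by (rule heat_contraction[OF s um uc])
    ultimately show "(\<integral>\<^sup>+ x. (?u 0 x)\<^sup>2 + (heat ?s (?u 0) x)\<^sup>2 \<partial>lborel) < \<infinity>"
      using fin by (subst nn_integral_add) (auto simp: less_top[symmetric] top_unique)
    show "AE x in lborel. (\<lambda>j. ?u j x * heat ?s (?u j) x) \<longlonglongrightarrow> v x * heat ?s v x"
    proof (rule AE_I2)
      fix x
      have "v x < top" using vc[of x] by (rule le_less_trans) simp
      moreover have "heat ?s v x < top" by (rule heat_finite[OF s vc])
      ultimately show "(\<lambda>j. ?u j x * heat ?s (?u j) x) \<longlonglongrightarrow> v x * heat ?s v x"
        by (intro tendsto_mult_ennreal u_lim heat_lim) auto
    qed
    show "AE x in lborel. ?u j x * heat ?s (?u j) x \<le> (?u 0 x)\<^sup>2 + (heat ?s (?u 0) x)\<^sup>2" for j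
    proof (rule AE_I2)
      fix x
      have "?u j x * heat ?s (?u j) x \<le> ?u 0 x * heat ?s (?u 0) x"
        by (intro mult_mono heat_mono dec) auto
      also have "\<dots> \<le> (?u 0 x)\<^sup>2 + (heat ?s (?u 0) x)\<^sup>2"
        by (rule ennreal_mult_le_sum_squares)
      finally show "?u j x * heat ?s (?u j) x \<le> (?u 0 x)\<^sup>2 + (heat ?s (?u 0) x)\<^sup>2" .
    qed
  qed measurable
  let ?F = "\<integral>\<^sup>+ x. (f x)\<^sup>2 \<partial>lborel"
  have step: "(\<integral>\<^sup>+ x. (v x)\<^sup>2 \<partial>lborel) \<le> ?I j + ennreal ((1/2) ^ i) * ?F"
    if "i \<le> j" for j
  proof -
    have h: "0 < t / 2 ^ j" using t by simp
    have pw: "(2::real) ^ j = 2 ^ (j - i) * 2 ^ i" using that by (simp flip: power_add)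
    have time: "real (2 * 2 ^ (j - i)) * (t / 2 ^ j) = ?s" unfolding pw by simp
    have coef: "real (2 ^ (j - i)) / real (2 ^ j + 1) \<le> (1/2) ^ i"
    proof -
      have "real (2 ^ (j - i)) / real (2 ^ j + 1) \<le> real (2 ^ (j - i)) / real (2 ^ j)"
        by (rule frac_le) auto
      also have "\<dots> = (1/2) ^ i" using pw by (simp add: power_one_over field_simps)
      finally show ?thesis .
    qed
    have "(\<integral>\<^sup>+ x. (v x)\<^sup>2 \<partial>lborel) \<le> (\<integral>\<^sup>+ x. (?u j x)\<^sup>2 \<partial>lborel)"
      by (intro nn_integral_mono power_mono v_le) simp
    also have "\<dots> \<le> ?I j + ennreal (real (2 ^ (j - i)) / real (2 ^ j + 1)) * ?F"
      using killed_power_energy_bound[OF h D f fc fin, where m = "2 ^ (j - i)" and n = "2 ^ j"]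
      unfolding time dyadic_killed_def[symmetric] by simp
    also have "\<dots> \<le> ?I j + ennreal ((1/2) ^ i) * ?F"
      by (intro add_left_mono mult_right_mono ennreal_leI coef) simp
    finally show ?thesis .
  qed
  have "(\<lambda>j. ?I j + ennreal ((1/2) ^ i) * ?F)
      \<longlonglongrightarrow> (\<integral>\<^sup>+ x. v x * heat ?s v x \<partial>lborel) + ennreal ((1/2) ^ i) * ?F"
    by (intro tendsto_add lim tendsto_const)
  then show ?thesis
    by (rule tendsto_lowerbound) (auto intro!: step eventually_mono[OF eventually_ge_at_top[of i]])
qed

text \<open>The limit that defines the form exists by association, so it may be computed along the
  times \<open>2 t / 2 ^ i\<close>. There the quotient is at most \<open>(1/2) ^ i F\<close> divided
  by \<open>2 t / 2 ^ i\<close>, which is \<open>F / (2 t)\<close> for every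
  \<open>i\<close>.\<close>

lemma killed_limit_energy:
  assumes assoc: "associated_with_form P X (energy J) (form_domain J)"
    and t: "0 < t" and D: "D \<in> sets borel" and f: "f \<in> borel_measurable borel"
    and fc: "\<And>y. f y \<le> ennreal c" and fin: "(\<integral>\<^sup>+ x. (f x)\<^sup>2 \<partial>lborel) < \<infinity>"
  shows "energy J (\<lambda>x. enn2real (killed_limit t D f x)) \<le> ennreal (1 / (2 * t)) * (\<integral>\<^sup>+ x. (f x)\<^sup>2 \<partial>lborel)"
proof -
  define v where "v = killed_limit t D f"
  define w where "w x = enn2real (v x)" for x
  define F where "F = enn2real (\<integral>\<^sup>+ x. (f x)\<^sup>2 \<partial>lborel)"
  have F: "(\<integral>\<^sup>+ x. (f x)\<^sup>2 \<partial>lborel) = ennreal F" "0 \<le> F" using fin by (simp_all add: F_def)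
  note [measurable] = dyadic_killed_measurable[OF t D f]
  have [measurable]: "v \<in> borel_measurable borel"
    unfolding v_def killed_limit_def[abs_def] by measurable
  have [measurable]: "w \<in> borel_measurable borel" unfolding w_def[abs_def] by measurable
  have v_le: "v x \<le> dyadic_killed t D f 0 x" for x
    unfolding v_def killed_limit_def by (rule INF_lower) simp
  have vc: "v x \<le> ennreal c" for x
    using v_le[of x] dyadic_killed_le[where f = f, OF t fc] by (rule order_trans)
  then have "v x < top" for x by (rule le_less_trans) simp
  then have vw: "ennreal (w x) = v x" for x by (simp add: w_def)
  have w0: "0 \<le> w x" for x by (simp add: w_def)
  have v2: "(\<integral>\<^sup>+ x. (v x)\<^sup>2 \<partial>lborel) \<le> ennreal F"
  proof -
    have "(\<integral>\<^sup>+ x. (v x)\<^sup>2 \<partial>lborel) \<le> (\<integral>\<^sup>+ x. (dyadic_killed t D f 0 x)\<^sup>2 \<partial>lborel)"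
      by (intro nn_integral_mono power_mono v_le) simp
    also have "\<dots> \<le> (\<integral>\<^sup>+ x. (f x)\<^sup>2 \<partial>lborel)"
      unfolding dyadic_killed_def by (rule killed_power_contraction[OF _ D f fc]) (use t in simp)
    finally show ?thesis by (simp add: F)
  qed
  have int_w2: "integrable lborel (\<lambda>x. (w x)\<^sup>2)"
    using v2 by (intro integrableI_nonneg) (auto simp: ennreal_power[symmetric] w0 vw le_less_trans)
  then have L2: "w \<in> L2 lborel" by (simp add: L2_def)
  have w2: "ennreal (\<integral>x. (w x)\<^sup>2 \<partial>lborel) = (\<integral>\<^sup>+ x. (v x)\<^sup>2 \<partial>lborel)"
    using int_w2 by (subst nn_integral_eq_integral[symmetric]) (auto simp: ennreal_power[symmetric] w0 vw)
  have quotient: "(\<integral>x. (w x - semigroup P X s w x) * w x \<partial>lborel) / s \<le> F / (2 * t)" if si: "s = 2 * t / 2 ^ i" for s i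
  proof -
    let ?c = "\<integral>x. semigroup P X s w x * w x \<partial>lborel" and ?q = "\<integral>x. (w x - semigroup P X s w x) * w x \<partial>lborel"
    have s: "0 < s" using t si by simp
    have hv: "heat s v x < top" for x by (rule heat_finite[OF s vc])
    have sg: "semigroup P X s w x = enn2real (heat s v x)" for x
      using semigroup_eq_heat[OF s, of w x] by (simp add: w0 vw)
    have [measurable]: "heat s v \<in> borel_measurable borel" using s by measurable
    have [measurable]: "semigroup P X s w \<in> borel_measurable borel" unfolding sg[abs_def] by measurable
    have prod: "ennreal (semigroup P X s w x * w x) = v x * heat s v x" for x
      using hv[of x] by (simp add: sg ennreal_mult' vw w0 mult.commute)
    have "(\<integral>\<^sup>+ x. v x * heat s v x \<partial>lborel) \<le> (\<integral>\<^sup>+ x. (v x)\<^sup>2 + (heat s v x)\<^sup>2 \<partial>lborel)"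
      by (intro nn_integral_mono ennreal_mult_le_sum_squares)
    also have "\<dots> = (\<integral>\<^sup>+ x. (v x)\<^sup>2 \<partial>lborel) + (\<integral>\<^sup>+ x. (heat s v x)\<^sup>2 \<partial>lborel)"
      by (rule nn_integral_add) measurable
    also have "\<dots> \<le> ennreal F + ennreal F"
      using heat_contraction[OF s, of v c] vc v2 by (intro add_mono) (auto intro: order_trans)
    also have "\<dots> < \<infinity>" by simp
    finally have "(\<integral>\<^sup>+ x. ennreal (semigroup P X s w x * w x) \<partial>lborel) < \<infinity>" by (simp only: prod)
    then have int_p: "integrable lborel (\<lambda>x. semigroup P X s w x * w x)"
      by (rule integrableI_nonneg[rotated 2]) (measurable, simp add: sg w0)
    have pr: "ennreal ?c = (\<integral>\<^sup>+ x. v x * heat s v x \<partial>lborel)"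
      unfolding prod[symmetric] using int_p by (subst nn_integral_eq_integral[symmetric]) (auto simp: sg w0)
    have nonneg: "0 \<le> ?c" by (intro integral_nonneg_AE) (auto simp: sg w0)
    have "ennreal (\<integral>x. (w x)\<^sup>2 \<partial>lborel) \<le> ennreal ?c + ennreal ((1/2) ^ i) * ennreal F"
      using killed_limit_energy_bound[OF t D f fc fin, of i] unfolding w2 pr F(1) v_def[symmetric] unfolding si .
    also have "\<dots> = ennreal (?c + (1/2) ^ i * F)"
      using nonneg F(2) by (simp add: ennreal_mult')
    finally have le: "(\<integral>x. (w x)\<^sup>2 \<partial>lborel) \<le> ?c + (1/2) ^ i * F"
      using nonneg F(2) by (subst (asm) ennreal_le_iff) auto
    have "?q = (\<integral>x. (w x)\<^sup>2 - semigroup P X s w x * w x \<partial>lborel)"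
      by (simp add: power2_eq_square left_diff_distrib)
    also have "\<dots> = (\<integral>x. (w x)\<^sup>2 \<partial>lborel) - ?c"
      by (rule Bochner_Integration.integral_diff[OF int_w2 int_p])
    also have "\<dots> \<le> (1/2) ^ i * F" using le by simp
    finally have "?q / s \<le> (1/2) ^ i * F / s"
      using s by (intro divide_right_mono) auto
    also have "\<dots> = F / (2 * t)" using t by (simp add: si power_one_over field_simps)
    finally show ?thesis .
  qed
  \<comment> \<open>No separate proof that \<open>w\<close> lies in the form domain is required:
    outside of it the limit is infinite, which the finite bound excludes.\<close>
  let ?L = "if w \<in> form_domain J then energy J w else \<infinity>"
  have "((\<lambda>s. ennreal ((\<integral>x. (w x - semigroup P X s w x) * w x \<partial>lborel) / s)) \<longlongrightarrow> ?L) (at_right 0)"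
    using assoc L2 unfolding associated_with_form_def by blast
  moreover have "filterlim (\<lambda>i. 2 * t / 2 ^ i) (at_right 0) sequentially"
    unfolding filterlim_at
  proof
    have "(\<lambda>i. 2 * t * (1/2) ^ i) \<longlonglongrightarrow> 2 * t * 0"
      by (intro tendsto_mult tendsto_const LIMSEQ_realpow_zero) auto
    then show "(\<lambda>i. 2 * t / 2 ^ i) \<longlonglongrightarrow> 0" by (simp add: power_one_over field_simps)
  qed (use t in auto)
  ultimately have "(\<lambda>i. ennreal ((\<integral>x. (w x - semigroup P X (2 * t / 2 ^ i) w x) * w x \<partial>lborel) / (2 * t / 2 ^ i))) \<longlonglongrightarrow> ?L"
    by (rule filterlim_compose)
  then have "?L \<le> ennreal (F / (2 * t))"
    by (rule tendsto_upperbound) (auto intro!: always_eventually ennreal_leI quotient simp del: divide_divide_eq_right)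
  then have "energy J w \<le> ennreal (F / (2 * t))" by (auto split: if_splits simp: top_unique)
  also have "\<dots> = ennreal (1 / (2 * t)) * ennreal F" using t F(2) by (subst ennreal_mult[symmetric]) auto
  finally show ?thesis unfolding F(1) w_def[abs_def] v_def .
qed

text \<open>Only the majorant \<open>killed_limit\<close> is shown to have finite energy. The
  estimate passes to the Dirichlet semigroup because the weighted integral of squares is
  monotone.\<close>

lemma killing_estimate_bounded:
  assumes J: "jump_kernel J" and assoc: "associated_with_form P X (energy J) (form_domain J)"
    and D: "open D" and t: "0 < t"
    and nonneg: "\<And>x y. x \<in> D \<Longrightarrow> y \<in> D \<Longrightarrow> 0 \<le> dirichlet_heat_kernel P X p D t x y"
    and f: "f \<in> borel_measurable borel" and fc: "\<And>y. f y \<le> ennreal c" and f_0: "\<And>y. y \<notin> D \<Longrightarrow> f y = 0"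
    and fin: "(\<integral>\<^sup>+ x. (f x)\<^sup>2 \<partial>lborel) < \<infinity>"
  shows "(\<integral>\<^sup>+ x. indicator D x * (\<integral>\<^sup>+ y. ennreal (dirichlet_heat_kernel P X p D t x y) * f y \<partial>lborel)\<^sup>2 * killing_rate J D x \<partial>lborel)
    \<le> ennreal (1 / (2 * t)) * (\<integral>\<^sup>+ x. (f x)\<^sup>2 \<partial>lborel)"
proof -
  let ?k = "\<lambda>x. \<integral>\<^sup>+ y. ennreal (dirichlet_heat_kernel P X p D t x y) * f y \<partial>lborel"
  have Db: "D \<in> sets borel" using D by simp
  let ?v = "killed_limit t D f"
  let ?w = "\<lambda>x. enn2real (?v x)"
  note [measurable] = dyadic_killed_measurable[OF t Db f]
  have [measurable]: "?v \<in> borel_measurable borel"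
    unfolding killed_limit_def[abs_def] by measurable
  have "?v x \<le> dyadic_killed t D f 0 x" for x
    unfolding killed_limit_def by (rule INF_lower) simp
  moreover have "dyadic_killed t D f 0 x \<le> ennreal c" for x by (rule dyadic_killed_le[OF t fc])
  ultimately have "?v x \<le> ennreal c" for x by (rule order_trans)
  then have "?v x < top" for x by (rule le_less_trans) simp
  then have vw: "ennreal (?w x) = ?v x" for x by simp
  have v_out: "?v x = 0" if "x \<notin> D" for x
  proof -
    have "?v x \<le> dyadic_killed t D f 0 x" unfolding killed_limit_def by (rule INF_lower) simp
    then show ?thesis using killed_power_outside[OF _ that, of 1] by (simp add: dyadic_killed_def)
  qed
  have pw: "?k x \<le> ?v x" if x: "x \<in> D" for x
    unfolding killed_limit_def
  proof (rule INF_greatest)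
    fix j :: nat
    show "?k x \<le> dyadic_killed t D f j x"
      using dirichlet_heat_kernel_le_killed[OF D t x, of "2 ^ j" f c] nonneg x f fc f_0
      by (simp add: dyadic_killed_def)
  qed
  have "(\<integral>\<^sup>+ x. indicator D x * (?k x)\<^sup>2 * killing_rate J D x \<partial>lborel)
      \<le> (\<integral>\<^sup>+ x. indicator D x * ennreal ((?w x)\<^sup>2) * killing_rate J D x \<partial>lborel)"
  proof (intro nn_integral_mono mult_right_mono)
    fix x
    show "indicator D x * (?k x)\<^sup>2 \<le> indicator D x * ennreal ((?w x)\<^sup>2)"
      using power_mono[OF pw[of x], of 2] by (cases "x \<in> D") (auto simp: ennreal_power[symmetric] vw)
  qed simp
  also have "\<dots> \<le> energy J ?w"
    by (rule killing_rate_le_energy[OF J Db]) (auto simp: v_out)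
  also have "\<dots> \<le> ennreal (1 / (2 * t)) * (\<integral>\<^sup>+ x. (f x)\<^sup>2 \<partial>lborel)"
    by (rule killed_limit_energy[OF assoc t Db f fc fin])
  finally show ?thesis .
qed

end

section \<open>Compactness\<close>

lemma abs_mult_le_sum_squares: "\<bar>a * b\<bar> \<le> a\<^sup>2 + b\<^sup>2" for a b :: real
proof -
  have "2 * (\<bar>a\<bar> * \<bar>b\<bar>) \<le> \<bar>a\<bar>\<^sup>2 + \<bar>b\<bar>\<^sup>2"
    using sum_squares_bound[of "\<bar>a\<bar>" "\<bar>b\<bar>"] by (simp add: mult.assoc)
  moreover have "0 \<le> \<bar>a\<bar> * \<bar>b\<bar>" by simp
  ultimately have "\<bar>a\<bar> * \<bar>b\<bar> \<le> \<bar>a\<bar>\<^sup>2 + \<bar>b\<bar>\<^sup>2" by linarith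
  then show ?thesis by (simp add: abs_mult)
qed

lemma L2_prod_integrable:
  assumes f: "f \<in> L2 N" and g: "g \<in> L2 N"
  shows "integrable N (\<lambda>x. f x * g x)"
proof (rule Bochner_Integration.integrable_bound)
  show "integrable N (\<lambda>x. (f x)\<^sup>2 + (g x)\<^sup>2)" using f g by (simp add: L2_def)
  show "(\<lambda>x. f x * g x) \<in> borel_measurable N" using f g by (auto simp: L2_def intro!: borel_measurable_times)
  show "AE x in N. norm (f x * g x) \<le> norm ((f x)\<^sup>2 + (g x)\<^sup>2)"
    using abs_mult_le_sum_squares[of "f x" "g x" for x] by simp
qed

lemma L2_diff:
  assumes f: "f \<in> L2 N" and g: "g \<in> L2 N"
  shows "(\<lambda>x. f x - g x) \<in> L2 N"
proof -
  have "integrable N (\<lambda>x. (f x)\<^sup>2 + (g x)\<^sup>2 - 2 * (f x * g x))"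
    using f g L2_prod_integrable[OF f g]
    by (intro Bochner_Integration.integrable_diff Bochner_Integration.integrable_add integrable_mult_right) (auto simp: L2_def)
  then have "integrable N (\<lambda>x. (f x - g x)\<^sup>2)" by (simp add: power2_diff algebra_simps)
  then show ?thesis using f g by (auto simp: L2_def intro!: borel_measurable_diff)
qed

text \<open>A weighted Young inequality in the role of Cauchy-Schwarz. The weight is tuned in
  \<open>convergent_inner_approx\<close>; elsewhere \<open>l = 1\<close> suffices.\<close>

lemma L2_inner_le:
  assumes f: "f \<in> L2 N" and g: "g \<in> L2 N" and l: "0 < l"
  shows "\<bar>\<integral>x. f x * g x \<partial>N\<bar> \<le> l * (\<integral>x. (f x)\<^sup>2 \<partial>N) + (\<integral>x. (g x)\<^sup>2 \<partial>N) / l"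
proof -
  have "\<bar>\<integral>x. f x * g x \<partial>N\<bar> \<le> (\<integral>x. l * (f x)\<^sup>2 + (g x)\<^sup>2 / l \<partial>N)"
  proof (rule order_trans[OF integral_abs_bound integral_mono])
    show "integrable N (\<lambda>x. \<bar>f x * g x\<bar>)" using L2_prod_integrable[OF f g] by simp
    show "integrable N (\<lambda>x. l * (f x)\<^sup>2 + (g x)\<^sup>2 / l)" using f g by (simp add: L2_def)
    fix x
    have "\<bar>f x * g x\<bar> = \<bar>(sqrt l * f x) * (g x / sqrt l)\<bar>" using l by simp
    also have "\<dots> \<le> (sqrt l * f x)\<^sup>2 + (g x / sqrt l)\<^sup>2" by (rule abs_mult_le_sum_squares)
    also have "\<dots> = l * (f x)\<^sup>2 + (g x)\<^sup>2 / l" using l by (simp add: power_mult_distrib power_divide)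
    finally show "\<bar>f x * g x\<bar> \<le> l * (f x)\<^sup>2 + (g x)\<^sup>2 / l" .
  qed
  also have "\<dots> = l * (\<integral>x. (f x)\<^sup>2 \<partial>N) + (\<integral>x. (g x)\<^sup>2 \<partial>N) / l"
    using f g by (simp add: L2_def)
  finally show ?thesis .
qed

text \<open>For a bounded sequence, the functions against which the inner products converge form a
  closed subset of L^2. It is used to pass from countably many test functions to all sections of the
  kernel.\<close>

lemma convergent_inner_approx:
  assumes f: "\<And>n. f n \<in> L2 N" "\<And>n. (\<integral>x. (f n x)\<^sup>2 \<partial>N) \<le> C" and g: "g \<in> L2 N"
    and approx: "\<And>e. 0 < e \<Longrightarrow> \<exists>g'\<in>L2 N. (\<integral>x. (g x - g' x)\<^sup>2 \<partial>N) \<le> e \<and> convergent (\<lambda>n. \<integral>x. g' x * f n x \<partial>N)"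
  shows "convergent (\<lambda>n::nat. \<integral>x. g x * f n x \<partial>N)"
proof -
  let ?I = "\<lambda>g n. \<integral>x. g x * f n x \<partial>N"
  have C0: "0 \<le> C" by (rule order_trans[OF _ f(2)[of 0]]) simp
  have "Cauchy (?I g)"
  proof (rule metric_CauchyI)
    fix e :: real assume e: "0 < e"
    \<comment> \<open>With this weight both terms of \<open>L2_inner_le\<close> are at most
      \<open>e / 8\<close>, so replacing \<open>g\<close> by \<open>g'\<close> costs at most
      \<open>e / 4\<close> at each of two indices. Adding \<open>1\<close> keeps \<open>l\<close>
      positive when \<open>C = 0\<close>.\<close>
    define l where "l = 8 * (C + 1) / e"
    have l: "0 < l" using C0 e by (simp add: l_def)
    have "0 < e / (8 * l)" using e l by simp
    from approx[OF this] obtain g' where g': "g' \<in> L2 N" "(\<integral>x. (g x - g' x)\<^sup>2 \<partial>N) \<le> e / (8 * l)"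
      "convergent (?I g')" by blast
    have close: "\<bar>?I g n - ?I g' n\<bar> \<le> e / 4" for n
    proof -
      have "?I g n - ?I g' n = (\<integral>x. g x * f n x - g' x * f n x \<partial>N)"
        by (rule Bochner_Integration.integral_diff[symmetric]) (intro L2_prod_integrable g f g')+
      also have "\<dots> = (\<integral>x. (g x - g' x) * f n x \<partial>N)" by (simp add: left_diff_distrib)
      also have "\<bar>\<dots>\<bar> \<le> l * (\<integral>x. (g x - g' x)\<^sup>2 \<partial>N) + (\<integral>x. (f n x)\<^sup>2 \<partial>N) / l"
        by (rule L2_inner_le[OF L2_diff[OF g g'(1)] f(1) l])
      also have "\<dots> \<le> l * (e / (8 * l)) + C / l"
        using l f(2) g'(2) by (intro add_mono mult_left_mono divide_right_mono) auto
      also have "C / l \<le> e / 8"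
        using C0 e by (simp add: l_def divide_simps) 
      also have "l * (e / (8 * l)) + e / 8 = e / 4" using l by simp
      finally show ?thesis by simp
    qed
    from g'(3) have "Cauchy (?I g')" by (rule convergent_Cauchy)
    moreover have "0 < e / 4" using e by simp
    ultimately obtain M where M: "\<forall>m\<ge>M. \<forall>n\<ge>M. dist (?I g' m) (?I g' n) < e / 4"
      unfolding Cauchy_def by blast
    show "\<exists>M. \<forall>m\<ge>M. \<forall>n\<ge>M. dist (?I g m) (?I g n) < e"
    proof (intro exI allI impI)
      fix m n assume "M \<le> m" "M \<le> n"
      then have "\<bar>?I g' m - ?I g' n\<bar> < e / 4"
        using M by (simp add: dist_real_def)
      then show "dist (?I g m) (?I g n) < e"
        using close[of m] close[of n] e unfolding dist_real_def by linarith
    qed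
  qed
  then show ?thesis by (simp add: Cauchy_convergent_iff)
qed

text \<open>Everything the compactness argument takes over from probability. The tail estimate is
  stated for bounded nonnegative functions supported in \<open>D\<close>, the form in which the
  killed operators deliver it; \<open>op_tail\<close> extends it to L^2.\<close>

locale tail_kernel =
  fixes k :: "'a::euclidean_space \<Rightarrow> 'a \<Rightarrow> real" and D :: "'a set" and V :: "'a \<Rightarrow> ennreal" and B a :: real
  assumes D: "open D"
    and k_measurable [measurable]: "(\<lambda>(x, y). k x y) \<in> borel_measurable (borel \<Otimes>\<^sub>M borel)"
    and k_nonneg: "\<And>x y. 0 \<le> k x y" and k_le: "\<And>x y. k x y \<le> B"
    and k_outside: "\<And>x y. x \<notin> D \<or> y \<notin> D \<Longrightarrow> k x y = 0"
    and k_cont: "\<And>y. y \<in> D \<Longrightarrow> continuous_on D (\<lambda>x. k x y)"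
    and k_mass: "\<And>x. (\<integral>\<^sup>+ y. ennreal (k x y) \<partial>lborel) \<le> 1"
    and V_measurable: "(\<lambda>x. indicator D x * V x) \<in> borel_measurable borel"
    and V_level: "\<And>r. 0 < r \<Longrightarrow> emeasure lborel {x \<in> D. V x < ennreal r} < \<infinity>"
    and a_nonneg: "0 \<le> a"
    and tail_bounded: "\<And>f c. f \<in> borel_measurable borel \<Longrightarrow> (\<And>y. f y \<le> ennreal c) \<Longrightarrow> (\<And>y. y \<notin> D \<Longrightarrow> f y = 0) \<Longrightarrow>
      (\<integral>\<^sup>+ x. (f x)\<^sup>2 \<partial>lborel) < \<infinity> \<Longrightarrow>
      (\<integral>\<^sup>+ x. indicator D x * (\<integral>\<^sup>+ y. ennreal (k x y) * f y \<partial>lborel)\<^sup>2 * V x \<partial>lborel) \<le> ennreal a * (\<integral>\<^sup>+ x. (f x)\<^sup>2 \<partial>lborel)"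
begin

lemma D_borel [measurable]: "D \<in> sets borel"
  using D by simp

lemma B_nonneg: "0 \<le> B"
  using k_nonneg k_le order_trans by blast

lemma k_section [measurable]: "k x \<in> borel_measurable borel"
  using measurable_compose[OF measurable_Pair1' k_measurable, of x] by simp

text \<open>The square of the kernel is at most \<open>B\<close> times the kernel, whose mass is at
  most \<open>1\<close>. Hence the sections are bounded in L^2 uniformly in
  \<open>x\<close>.\<close>

lemma k_square: "k x \<in> L2 lborel" "(\<integral>y. (k x y)\<^sup>2 \<partial>lborel) \<le> B"
proof -
  have "(\<integral>\<^sup>+ y. ennreal ((k x y)\<^sup>2) \<partial>lborel) \<le> (\<integral>\<^sup>+ y. ennreal B * ennreal (k x y) \<partial>lborel)"
  proof (rule nn_integral_mono)
    fix y
    have "(k x y)\<^sup>2 \<le> B * k x y"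
      unfolding power2_eq_square by (rule mult_right_mono[OF k_le k_nonneg])
    then show "ennreal ((k x y)\<^sup>2) \<le> ennreal B * ennreal (k x y)"
      by (simp add: B_nonneg k_nonneg ennreal_mult[symmetric] ennreal_leI)
  qed
  also have "\<dots> = ennreal B * (\<integral>\<^sup>+ y. ennreal (k x y) \<partial>lborel)" by (rule nn_integral_cmult) measurable
  also have "\<dots> \<le> ennreal B * 1" by (intro mult_left_mono k_mass) simp
  finally have le: "(\<integral>\<^sup>+ y. ennreal ((k x y)\<^sup>2) \<partial>lborel) \<le> ennreal B" by simp
  then have int: "integrable lborel (\<lambda>y. (k x y)\<^sup>2)"
    by (intro integrableI_nonneg) (auto simp: le_less_trans)
  then show "k x \<in> L2 lborel" by (simp add: L2_def)
  have "ennreal (\<integral>y. (k x y)\<^sup>2 \<partial>lborel) = (\<integral>\<^sup>+ y. ennreal ((k x y)\<^sup>2) \<partial>lborel)"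
    using int by (rule nn_integral_eq_integral[symmetric]) simp
  also note le
  finally show "(\<integral>y. (k x y)\<^sup>2 \<partial>lborel) \<le> B" unfolding ennreal_le_iff[OF B_nonneg] .
qed

definition op :: "('a \<Rightarrow> real) \<Rightarrow> 'a \<Rightarrow> real" where
  "op f x = (\<integral>y. k x y * f y \<partial>lborel)"

lemma op_measurable [measurable]:
  assumes [measurable]: "f \<in> borel_measurable borel"
  shows "op f \<in> borel_measurable borel"
proof -
  have "(\<lambda>x. \<integral>y. k x y * f y \<partial>lborel) \<in> borel_measurable borel" by measurable
  then show ?thesis by (simp add: op_def[abs_def])
qed

lemma op_outside: "x \<notin> D \<Longrightarrow> op f x = 0"
  by (simp add: op_def k_outside)

lemma op_bound:
  assumes "f \<in> L2 lborel" "(\<integral>x. (f x)\<^sup>2 \<partial>lborel) \<le> C"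
  shows "\<bar>op f x\<bar> \<le> B + C"
  using L2_inner_le[OF k_square(1)[of x] assms(1), of 1] k_square(2)[of x] assms(2) by (simp add: op_def)

lemma level_sets: "{x \<in> D. V x < ennreal r} \<in> sets borel" "{x \<in> D. \<not> V x < ennreal r} \<in> sets borel"
proof -
  note [measurable] = V_measurable
  have "{x \<in> space borel. x \<in> D \<and> indicator D x * V x < ennreal r} \<in> sets borel"
    "{x \<in> space borel. x \<in> D \<and> \<not> indicator D x * V x < ennreal r} \<in> sets borel" by measurable
  moreover have "{x \<in> space borel. x \<in> D \<and> indicator D x * V x < ennreal r} = {x \<in> D. V x < ennreal r}"
    "{x \<in> space borel. x \<in> D \<and> \<not> indicator D x * V x < ennreal r} = {x \<in> D. \<not> V x < ennreal r}" by auto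
  ultimately show "{x \<in> D. V x < ennreal r} \<in> sets borel" "{x \<in> D. \<not> V x < ennreal r} \<in> sets borel"
    by (simp_all only:)
qed

text \<open>A Chebyshev argument: on the set in question \<open>V\<close> is at least
  \<open>r\<close>. The bound for bounded functions is applied to the truncations \<open>G N\<close>
  of the absolute value of \<open>f\<close>, which increase with \<open>N\<close>, so monotone
  convergence gives the general case.\<close>

lemma op_tail:
  assumes f: "f \<in> L2 lborel" and r: "0 < r"
  shows "(\<integral>\<^sup>+ x. ennreal ((op f x)\<^sup>2) * indicator {x \<in> D. \<not> V x < ennreal r} x \<partial>lborel) \<le> ennreal (a / r * (\<integral>x. (f x)\<^sup>2 \<partial>lborel))"
proof -
  have [measurable]: "f \<in> borel_measurable borel" using f by (simp add: L2_def)
  note [measurable] = V_measurable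
  define G where "G N y = min (ennreal \<bar>f y\<bar>) (ennreal (real N)) * indicator D y" for N :: nat and y
  have [measurable]: "G N \<in> borel_measurable borel" for N unfolding G_def[abs_def] by measurable
  let ?g = "\<lambda>y. ennreal \<bar>f y\<bar> * indicator D y"
  have Ginc: "incseq (\<lambda>N. G N y)" for y
    unfolding incseq_def G_def by (intro allI impI mult_right_mono min.mono order_refl ennreal_leI) auto
  have Glim: "(\<lambda>N. G N y) \<longlonglongrightarrow> ?g y" for y
  proof (rule tendsto_eventually)
    obtain n :: nat where n: "\<bar>f y\<bar> \<le> real n" using real_arch_simple by blast
    show "\<forall>\<^sub>F N in sequentially. G N y = ?g y"
      using eventually_ge_at_top[of n]
    proof eventually_elim
      case (elim N)
      then have "ennreal \<bar>f y\<bar> \<le> ennreal (real N)" using n by (intro ennreal_leI) simp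
      then show ?case by (simp add: G_def min_absorb1)
    qed
  qed
  have G_le: "G N y \<le> ennreal \<bar>f y\<bar>" for N y by (simp add: G_def indicator_def)
  have f2: "(\<integral>\<^sup>+ x. ennreal ((f x)\<^sup>2) \<partial>lborel) = ennreal (\<integral>x. (f x)\<^sup>2 \<partial>lborel)"
    using f by (intro nn_integral_eq_integral) (auto simp: L2_def)
  have G2: "(\<integral>\<^sup>+ x. (G N x)\<^sup>2 \<partial>lborel) \<le> ennreal (\<integral>x. (f x)\<^sup>2 \<partial>lborel)" for N
    unfolding f2[symmetric]
  proof (rule nn_integral_mono)
    fix x show "(G N x)\<^sup>2 \<le> ennreal ((f x)\<^sup>2)"
      using power_mono[OF G_le[of N x], where n = 2] by (simp add: ennreal_power)
  qed
  let ?k = "\<lambda>g x. \<integral>\<^sup>+ y. ennreal (k x y) * g y \<partial>lborel"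
  have km: "?k g \<in> borel_measurable borel" if [measurable]: "g \<in> borel_measurable borel" for g
    by measurable
  have klim: "(\<lambda>N. ?k (G N) x) \<longlonglongrightarrow> ?k ?g x" for x
  proof (rule nn_integral_LIMSEQ)
    show "incseq (\<lambda>N y. ennreal (k x y) * G N y)"
      using Ginc by (auto simp: incseq_def le_fun_def intro!: mult_left_mono)
    show "(\<lambda>N. ennreal (k x y) * G N y) \<longlonglongrightarrow> ennreal (k x y) * ?g y" for y
      by (intro ennreal_tendsto_cmult Glim) simp
  qed measurable
  have kinc: "?k (G M) x \<le> ?k (G N) x" if "M \<le> N" for M N x
    using Ginc that by (intro nn_integral_mono mult_left_mono) (auto simp: incseq_def)
  let ?S = "{x \<in> D. \<not> V x < ennreal r}"
  note [measurable] = level_sets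
  let ?I = "\<lambda>N. \<integral>\<^sup>+ x. (?k (G N) x)\<^sup>2 * indicator ?S x \<partial>lborel"
  have bound: "?I N \<le> ennreal (a / r * (\<integral>x. (f x)\<^sup>2 \<partial>lborel))" for N
  proof -
    have "ennreal r * ?I N = (\<integral>\<^sup>+ x. ennreal r * ((?k (G N) x)\<^sup>2 * indicator ?S x) \<partial>lborel)"
      by (rule nn_integral_cmult[symmetric]) measurable
    also have "\<dots> \<le> (\<integral>\<^sup>+ x. indicator D x * (?k (G N) x)\<^sup>2 * V x \<partial>lborel)"
    proof (rule nn_integral_mono)
      fix x
      show "ennreal r * ((?k (G N) x)\<^sup>2 * indicator ?S x) \<le> indicator D x * (?k (G N) x)\<^sup>2 * V x"
        by (cases "x \<in> ?S") (auto simp: not_less mult.commute intro!: mult_right_mono)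
    qed
    also have "\<dots> \<le> ennreal a * (\<integral>\<^sup>+ x. (G N x)\<^sup>2 \<partial>lborel)"
    proof (rule tail_bounded)
      show "G N y \<le> ennreal (real N)" for y by (simp add: G_def indicator_def)
      show "(\<integral>\<^sup>+ x. (G N x)\<^sup>2 \<partial>lborel) < \<infinity>" using G2[of N] by (rule le_less_trans) simp
    qed (auto simp: G_def)
    also have "\<dots> \<le> ennreal a * ennreal (\<integral>x. (f x)\<^sup>2 \<partial>lborel)" by (intro mult_left_mono G2) simp
    finally have "ennreal r * ?I N \<le> ennreal a * ennreal (\<integral>x. (f x)\<^sup>2 \<partial>lborel)" .
    then have "ennreal (1 / r) * (ennreal r * ?I N) \<le> ennreal (1 / r) * (ennreal a * ennreal (\<integral>x. (f x)\<^sup>2 \<partial>lborel))"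
      by (rule mult_left_mono) simp
    also have "ennreal (1 / r) * (ennreal r * ?I N) = ?I N"
      using r by (subst mult.assoc[symmetric]) (simp add: ennreal_mult[symmetric])
    also have "ennreal (1 / r) * (ennreal a * ennreal (\<integral>x. (f x)\<^sup>2 \<partial>lborel)) = ennreal (a / r * (\<integral>x. (f x)\<^sup>2 \<partial>lborel))"
      using r a_nonneg by (simp add: ennreal_mult[symmetric])
    finally show ?thesis .
  qed
  have lim: "?I \<longlonglongrightarrow> (\<integral>\<^sup>+ x. (?k ?g x)\<^sup>2 * indicator ?S x \<partial>lborel)"
  proof (rule nn_integral_LIMSEQ)
    show "incseq (\<lambda>N x. (?k (G N) x)\<^sup>2 * indicator ?S x)"
      using kinc by (auto simp: incseq_def le_fun_def intro!: mult_right_mono power_mono)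
    have "(\<lambda>N. ?k (G N) x * ?k (G N) x) \<longlonglongrightarrow> ?k ?g x * ?k ?g x" for x
      by (rule tendsto_mult_ennreal[OF klim klim]) auto
    then show "(\<lambda>N. (?k (G N) x)\<^sup>2 * indicator ?S x) \<longlonglongrightarrow> (?k ?g x)\<^sup>2 * indicator ?S x" for x
      by (cases "x \<in> ?S") (simp_all add: power2_eq_square)
  qed measurable
  have "(\<integral>\<^sup>+ x. (?k ?g x)\<^sup>2 * indicator ?S x \<partial>lborel) \<le> ennreal (a / r * (\<integral>x. (f x)\<^sup>2 \<partial>lborel))"
    by (rule tendsto_upperbound[OF lim always_eventually[OF allI[OF bound]]]) simp
  moreover have "ennreal ((op f x)\<^sup>2) \<le> (?k ?g x)\<^sup>2" for x
  proof -
    have "ennreal (norm (op f x)) \<le> (\<integral>\<^sup>+ y. ennreal (norm (k x y * f y)) \<partial>lborel)"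
      unfolding op_def by (rule integral_norm_bound_ennreal[OF L2_prod_integrable[OF k_square(1) f]])
    also have "\<dots> = ?k ?g x"
    proof (rule nn_integral_cong)
      fix y show "ennreal (norm (k x y * f y)) = ennreal (k x y) * ?g y"
        by (cases "y \<in> D") (simp_all add: k_outside abs_mult k_nonneg ennreal_mult)
    qed
    finally have "(ennreal \<bar>op f x\<bar>)\<^sup>2 \<le> (?k ?g x)\<^sup>2" by (intro power_mono) auto
    then show ?thesis by (simp add: ennreal_power)
  qed
  then have "(\<integral>\<^sup>+ x. ennreal ((op f x)\<^sup>2) * indicator ?S x \<partial>lborel) \<le> (\<integral>\<^sup>+ x. (?k ?g x)\<^sup>2 * indicator ?S x \<partial>lborel)"
    by (intro nn_integral_mono mult_right_mono) auto
  ultimately show ?thesis by (rule order_trans[rotated])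
qed

lemma nn_integral_split_level:
  assumes [measurable]: "h \<in> borel_measurable borel" and out: "\<And>x. x \<notin> D \<Longrightarrow> h x = 0"
  shows "(\<integral>\<^sup>+ x. h x \<partial>lborel) = (\<integral>\<^sup>+ x. h x * indicator {x \<in> D. V x < ennreal r} x \<partial>lborel)
    + (\<integral>\<^sup>+ x. h x * indicator {x \<in> D. \<not> V x < ennreal r} x \<partial>lborel)"
proof -
  note [measurable] = level_sets
  have "(\<integral>\<^sup>+ x. h x \<partial>lborel) = (\<integral>\<^sup>+ x. h x * indicator {x \<in> D. V x < ennreal r} x + h x * indicator {x \<in> D. \<not> V x < ennreal r} x \<partial>lborel)"
    by (intro nn_integral_cong) (auto simp: indicator_def out)
  then show ?thesis by (subst (asm) nn_integral_add) auto
qed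

text \<open>Stated for a general \<open>h\<close> because it serves both the images under
  \<open>op\<close> and their pointwise limit: a bounded function is square integrable on a level
  set of finite measure, and the tail is given.\<close>

lemma op_L2_of_bounds:
  assumes [measurable]: "h \<in> borel_measurable borel" and out: "\<And>x. x \<notin> D \<Longrightarrow> h x = 0"
    and bd: "\<And>x. \<bar>h x\<bar> \<le> K"
    and tail: "(\<integral>\<^sup>+ x. ennreal ((h x)\<^sup>2) * indicator {x \<in> D. \<not> V x < ennreal 1} x \<partial>lborel) < \<infinity>"
  shows "h \<in> L2 lborel"
proof -
  let ?A = "{x \<in> D. V x < ennreal 1}"
  have "(\<integral>\<^sup>+ x. ennreal ((h x)\<^sup>2) * indicator ?A x \<partial>lborel) \<le> (\<integral>\<^sup>+ x. ennreal (K\<^sup>2) * indicator ?A x \<partial>lborel)"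
  proof (intro nn_integral_mono mult_right_mono ennreal_leI)
    fix x show "(h x)\<^sup>2 \<le> K\<^sup>2" using power_mono[OF bd[of x], of 2] by simp
  qed simp
  also have "\<dots> = ennreal (K\<^sup>2) * emeasure lborel ?A"
    by (rule nn_integral_cmult_indicator) (use level_sets(1)[of 1] in simp)
  also have "\<dots> < \<infinity>" using V_level[of 1] by (simp add: ennreal_mult_less_top)
  finally have "(\<integral>\<^sup>+ x. ennreal ((h x)\<^sup>2) \<partial>lborel) < \<infinity>"
    using tail by (subst nn_integral_split_level[where r = 1]) (auto simp: out)
  then have "integrable lborel (\<lambda>x. (h x)\<^sup>2)" by (intro integrableI_nonneg) auto
  then show ?thesis by (simp add: L2_def)
qed

lemma op_L2:
  assumes f: "f \<in> L2 lborel"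
  shows "op f \<in> L2 lborel"
proof (rule op_L2_of_bounds)
  have [measurable]: "f \<in> borel_measurable borel" using f by (simp add: L2_def)
  show "op f \<in> borel_measurable borel" by measurable
  show "\<bar>op f x\<bar> \<le> B + (\<integral>x. (f x)\<^sup>2 \<partial>lborel)" for x by (rule op_bound[OF f order_refl])
  show "(\<integral>\<^sup>+ x. ennreal ((op f x)\<^sup>2) * indicator {x \<in> D. \<not> V x < ennreal 1} x \<partial>lborel) < \<infinity>"
    by (rule le_less_trans[OF op_tail[OF f zero_less_one]]) simp
qed (rule op_outside)

text \<open>
  As \<open>k\<close> is bounded and continuous in \<open>x\<close>, the sections \<open>k x\<close> cut off to balls depend continuously on
  \<open>x\<close> in \<open>L\<^sup>2\<close>; hence it suffices to extract the subsequence for countably many cut-off sections.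
\<close>

lemma convergent_subsequence:
  assumes f: "\<And>n. f n \<in> L2 lborel" "\<And>n. (\<integral>x. (f n x)\<^sup>2 \<partial>lborel) \<le> C"
  obtains s where "strict_mono (s :: nat \<Rightarrow> nat)" "\<forall>x. convergent (\<lambda>n. op (f (s n)) x)"
proof -
  define kk where "kk m x y = k x y * indicator (cball 0 (real m)) y" for m :: nat and x y
  have [measurable]: "cball (0 :: 'a) q \<in> sets borel" for q by simp
  have [measurable]: "kk m x \<in> borel_measurable borel" for m x unfolding kk_def[abs_def] by measurable
  have k2: "integrable lborel (\<lambda>y. (k x y)\<^sup>2)" for x using k_square(1)[of x] by (simp add: L2_def)
  have kk_le: "(kk m x y)\<^sup>2 \<le> (k x y)\<^sup>2" for m x y by (simp add: kk_def indicator_def)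
  have kk2: "integrable lborel (\<lambda>y. (kk m x y)\<^sup>2)" for m x
    by (rule Bochner_Integration.integrable_bound[OF k2[of x]]) (use kk_le in auto)
  then have kkL2: "kk m x \<in> L2 lborel" for m x by (simp add: L2_def)
  have kkB: "(\<integral>y. (kk m x y)\<^sup>2 \<partial>lborel) \<le> B" for m x
    using integral_mono[OF kk2 k2 kk_le] k_square(2) by (rule order_trans)
  obtain Q :: "'a set" where Q: "countable Q" "\<And>V. open V \<Longrightarrow> V \<noteq> {} \<Longrightarrow> \<exists>q\<in>Q. q \<in> V"
    using countable_dense_setE by blast
  \<comment> \<open>Pairs of a cut-off radius and a point of a countable dense set. The inner
    products with these sections are bounded, so a diagonal argument makes all of them converge
    along one subsequence.\<close>
  have "countable (UNIV \<times> Q :: (nat \<times> 'a) set)" using Q(1) by auto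
  moreover have "norm (\<integral>y. kk (fst z) (snd z) y * f n y \<partial>lborel) \<le> B + C" for n z
    using L2_inner_le[OF kkL2[of "fst z" "snd z"] f(1)[of n], of 1] kkB[of "fst z" "snd z"] f(2)[of n] by simp
  ultimately obtain s where s: "strict_mono (s :: nat \<Rightarrow> nat)"
    "\<And>z. z \<in> UNIV \<times> Q \<Longrightarrow> \<exists>l. (\<lambda>n. \<integral>y. kk (fst z) (snd z) y * f (s n) y \<partial>lborel) \<longlonglongrightarrow> l"
    using function_convergent_subsequence[of "UNIV \<times> Q" "\<lambda>n z. \<integral>y. kk (fst z) (snd z) y * f n y \<partial>lborel" "B + C"] by blast
  have convQ: "convergent (\<lambda>n. \<integral>y. kk m q y * f (s n) y \<partial>lborel)" if "q \<in> Q" for m q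
    using s(2)[of "(m, q)"] that by (simp add: convergent_def)
  note fs = f(1)[of "s n" for n] f(2)[of "s n" for n]
  have conv_kk: "convergent (\<lambda>n. \<integral>y. kk m x y * f (s n) y \<partial>lborel)" if x: "x \<in> D" for m x
  proof (rule convergent_inner_approx[OF fs kkL2])
    fix e :: real assume e: "0 < e"
    have "\<exists>q\<in>Q. q \<in> D \<and> dist q x < inverse (real (Suc i))" for i
    proof -
      have "x \<in> D \<inter> ball x (inverse (real (Suc i)))" using x by simp
      then have "\<exists>q\<in>Q. q \<in> D \<inter> ball x (inverse (real (Suc i)))"
        using D by (intro Q(2)) (blast intro: open_Int open_ball)+
      then show ?thesis by (auto simp: dist_commute)
    qed
    then obtain q where q: "\<And>i. q i \<in> Q" "\<And>i. q i \<in> D" "\<And>i. dist (q i) x < inverse (real (Suc i))" by metis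
    have q_lim: "q \<longlonglongrightarrow> x"
    proof (rule tendsto_dist_iff[THEN iffD2], rule tendsto_sandwich[OF _ _ tendsto_const LIMSEQ_inverse_real_of_nat])
      show "\<forall>\<^sub>F i in sequentially. dist (q i) x \<le> inverse (real (Suc i))"
        by (rule always_eventually) (use q(3) less_imp_le in blast)
    qed simp
    have pt: "(\<lambda>i. kk m (q i) y) \<longlonglongrightarrow> kk m x y" for y
    proof (cases "y \<in> D")
      case True
      have "(\<lambda>i. k (q i) y) \<longlonglongrightarrow> k x y"
        using k_cont[OF True] q(2) q_lim x unfolding continuous_on_sequentially by (auto simp: comp_def)
      then show ?thesis unfolding kk_def by (intro tendsto_mult tendsto_const)
    qed (simp add: kk_def k_outside)
    \<comment> \<open>Continuity of the kernel in \<open>x\<close> is only pointwise in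
      \<open>y\<close>; the cut-off supplies the integrable majorant that turns it into convergence
      in L^2.\<close>
    have "(\<lambda>i. \<integral>y. (kk m x y - kk m (q i) y)\<^sup>2 \<partial>lborel) \<longlonglongrightarrow> (\<integral>y. 0 \<partial>(lborel :: 'a measure))"
    proof (rule integral_dominated_convergence[where w = "\<lambda>y. B\<^sup>2 * indicator (cball 0 (real m)) y"])
      show "integrable lborel (\<lambda>y :: 'a. B\<^sup>2 * indicator (cball 0 (real m)) y)"
        by (intro integrable_mult_right integrable_real_indicator) (use emeasure_bounded_finite[OF bounded_cball] in auto)
      show "AE y in lborel. (\<lambda>i. (kk m x y - kk m (q i) y)\<^sup>2) \<longlonglongrightarrow> 0"
        using pt by (intro AE_I2) (auto intro!: tendsto_eq_intros)
      show "AE y in lborel. norm ((kk m x y - kk m (q i) y)\<^sup>2) \<le> B\<^sup>2 * indicator (cball 0 (real m)) y" for i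
      proof (rule AE_I2)
        fix y
        have "\<bar>k x y - k (q i) y\<bar> \<le> B"
          using k_nonneg[of x y] k_le[of x y] k_nonneg[of "q i" y] k_le[of "q i" y] by linarith
        then have "\<bar>k x y - k (q i) y\<bar>\<^sup>2 \<le> B\<^sup>2" by (intro power_mono) auto
        then show "norm ((kk m x y - kk m (q i) y)\<^sup>2) \<le> B\<^sup>2 * indicator (cball 0 (real m)) y"
          by (simp add: kk_def indicator_def)
      qed
    qed measurable
    then have "\<forall>\<^sub>F i in sequentially. (\<integral>y. (kk m x y - kk m (q i) y)\<^sup>2 \<partial>lborel) < e"
      using e by (intro order_tendstoD) auto
    then obtain i where "(\<integral>y. (kk m x y - kk m (q i) y)\<^sup>2 \<partial>lborel) < e"
      using eventually_happens by force
    then show "\<exists>g'\<in>L2 lborel. (\<integral>y. (kk m x y - g' y)\<^sup>2 \<partial>lborel) \<le> e \<and> convergent (\<lambda>n. \<integral>y. g' y * f (s n) y \<partial>lborel)"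
      using kkL2[of m "q i"] convQ[OF q(1), of m i] by (intro bexI[of _ "kk m (q i)"]) auto
  qed
  have "convergent (\<lambda>n. op (f (s n)) x)" for x
  proof (cases "x \<in> D")
    case True
    show ?thesis
      unfolding op_def
    proof (rule convergent_inner_approx[OF fs k_square(1)])
      fix e :: real assume e: "0 < e"
      \<comment> \<open>The cut-off is removed with \<open>x\<close> fixed; the square of the
        section itself is the majorant.\<close>
      have "(\<lambda>m. \<integral>y. (k x y - kk m x y)\<^sup>2 \<partial>lborel) \<longlonglongrightarrow> (\<integral>y. 0 \<partial>(lborel :: 'a measure))"
      proof (rule integral_dominated_convergence[where w = "\<lambda>y. (k x y)\<^sup>2"])
        show "AE y in lborel. (\<lambda>m. (k x y - kk m x y)\<^sup>2) \<longlonglongrightarrow> 0"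
        proof (intro AE_I2 tendsto_eventually)
          fix y :: 'a
          obtain n :: nat where n: "norm y \<le> real n" using real_arch_simple by blast
          show "\<forall>\<^sub>F m in sequentially. (k x y - kk m x y)\<^sup>2 = 0"
            using eventually_ge_at_top[of n]
          proof eventually_elim
            case (elim m)
            then have "norm y \<le> real m" using n by simp
            then show ?case by (simp add: kk_def)
          qed
        qed
        show "AE y in lborel. norm ((k x y - kk m x y)\<^sup>2) \<le> (k x y)\<^sup>2" for m
          by (simp add: kk_def indicator_def)
      qed (use k2 in measurable)
      then have "\<forall>\<^sub>F m in sequentially. (\<integral>y. (k x y - kk m x y)\<^sup>2 \<partial>lborel) < e"
        using e by (intro order_tendstoD) auto
      then obtain m where "(\<integral>y. (k x y - kk m x y)\<^sup>2 \<partial>lborel) < e"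
        using eventually_happens by force
      then show "\<exists>g'\<in>L2 lborel. (\<integral>y. (k x y - g' y)\<^sup>2 \<partial>lborel) \<le> e \<and> convergent (\<lambda>n. \<integral>y. g' y * f (s n) y \<partial>lborel)"
        using kkL2[of m x] conv_kk[OF True, of m] by (intro bexI[of _ "kk m x"]) auto
    qed
  qed (simp add: op_outside convergent_const)
  then show ?thesis using s(1) that by blast
qed


text \<open>The pointwise limit is upgraded to convergence in L^2: on a level set of finite measure
  the uniform bound gives dominated convergence, and outside of it the tails are small uniformly in
  \<open>n\<close>.\<close>

lemma op_compact:
  assumes f: "\<And>n. f n \<in> L2 lborel" "\<And>n. (\<integral>x. (f n x)\<^sup>2 \<partial>lborel) \<le> C"
  obtains s g where "strict_mono (s :: nat \<Rightarrow> nat)" "g \<in> L2 lborel"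
    "(\<lambda>n. \<integral>\<^sup>+ x. ennreal ((op (f (s n)) x - g x)\<^sup>2) \<partial>lborel) \<longlonglongrightarrow> 0"
proof -
  obtain s where s: "strict_mono (s :: nat \<Rightarrow> nat)" "\<forall>x. convergent (\<lambda>n. op (f (s n)) x)"
    by (rule convergent_subsequence[OF f])
  define h where "h n = op (f (s n))" for n
  define g where "g x = lim (\<lambda>n. h n x)" for x
  have [measurable]: "f n \<in> borel_measurable borel" for n using f(1)[of n] by (simp add: L2_def)
  have [measurable]: "h n \<in> borel_measurable borel" for n unfolding h_def by measurable
  have hg: "(\<lambda>n. h n x) \<longlonglongrightarrow> g x" for x
    using s(2) unfolding g_def h_def by (simp add: convergent_LIMSEQ_iff)
  have [measurable]: "g \<in> borel_measurable borel"
    by (rule borel_measurable_LIMSEQ_metric[OF _ hg]) measurable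
  note [measurable] = level_sets
  have C0: "0 \<le> C" by (rule order_trans[OF _ f(2)[of 0]]) simp
  have h_bd: "\<bar>h n x\<bar> \<le> B + C" for n x unfolding h_def by (rule op_bound[OF f])
  have g_bd: "\<bar>g x\<bar> \<le> B + C" for x
    by (rule tendsto_upperbound[OF tendsto_rabs[OF hg] always_eventually[OF allI[OF h_bd]]]) simp
  have h_out: "h n x = 0" if "x \<notin> D" for n x unfolding h_def by (rule op_outside[OF that])
  have g_out: "g x = 0" if "x \<notin> D" for x
    using hg[of x] by (simp add: h_out[OF that] LIMSEQ_const_iff)
  have h_tail: "(\<integral>\<^sup>+ x. ennreal ((h n x)\<^sup>2) * indicator {x \<in> D. \<not> V x < ennreal r} x \<partial>lborel) \<le> ennreal (a / r * C)"
    if r: "0 < r" for n r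
    unfolding h_def
    by (rule order_trans[OF op_tail[OF f(1) r]], intro ennreal_leI mult_left_mono f(2)) (use a_nonneg r in simp)
  have g_tail: "(\<integral>\<^sup>+ x. ennreal ((g x)\<^sup>2) * indicator {x \<in> D. \<not> V x < ennreal r} x \<partial>lborel) \<le> ennreal (a / r * C)"
    if r: "0 < r" for r
  proof -
    let ?S = "{x \<in> D. \<not> V x < ennreal r}"
    have lim: "(\<lambda>n. ennreal ((h n x)\<^sup>2) * indicator ?S x) \<longlonglongrightarrow> ennreal ((g x)\<^sup>2) * indicator ?S x" for x
    proof (cases "x \<in> ?S")
      case True
      have "(\<lambda>n. ennreal ((h n x)\<^sup>2)) \<longlonglongrightarrow> ennreal ((g x)\<^sup>2)"
        by (intro tendsto_ennrealI tendsto_power hg)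
      then show ?thesis using True by simp
    next
      case False
      then have "indicator ?S x = (0 :: ennreal)" by (rule indicator_simps(2))
      then show ?thesis by simp
    qed
    \<comment> \<open>Fatou's lemma: the limit inherits the tail bound of the sequence.\<close>
    have "(\<integral>\<^sup>+ x. ennreal ((g x)\<^sup>2) * indicator ?S x \<partial>lborel) = (\<integral>\<^sup>+ x. liminf (\<lambda>n. ennreal ((h n x)\<^sup>2) * indicator ?S x) \<partial>lborel)"
      by (intro nn_integral_cong lim_imp_Liminf[OF _ lim, symmetric]) simp
    also have "\<dots> \<le> liminf (\<lambda>n. \<integral>\<^sup>+ x. ennreal ((h n x)\<^sup>2) * indicator ?S x \<partial>lborel)"
      by (rule nn_integral_liminf) measurable
    also have "\<dots> \<le> liminf (\<lambda>n. ennreal (a / r * C))"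
      by (rule Liminf_mono[OF always_eventually[OF allI[OF h_tail[OF r]]]])
    also have "\<dots> = ennreal (a / r * C)" by (rule Liminf_const) simp
    finally show ?thesis .
  qed
  have gL2: "g \<in> L2 lborel"
    by (rule op_L2_of_bounds[OF _ g_out g_bd le_less_trans[OF g_tail[OF zero_less_one]]]) auto
  have "(\<lambda>n. \<integral>\<^sup>+ x. ennreal ((h n x - g x)\<^sup>2) \<partial>lborel) \<longlonglongrightarrow> 0"
  proof (rule order_tendstoI)
    fix b :: ennreal assume "0 < b"
    \<comment> \<open>\<open>b\<close> may be infinite, in which case \<open>e = 1\<close>
      serves.\<close>
    then obtain e where e: "0 < e" "ennreal e \<le> b"
      by (cases b) (auto intro: that[of 1])
    \<comment> \<open>The squared difference is at most twice the sum of the squares, so the tail is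
      at most \<open>4 a C / r\<close>, and this \<open>r\<close> makes it at most
      \<open>e / 2\<close>. The added ones keep \<open>r\<close> positive if \<open>a\<close> or
      \<open>C\<close> is \<open>0\<close>.\<close>
    define r where "r = 8 * (a + 1) * (C + 1) / e"
    have r: "0 < r" using a_nonneg C0 e by (simp add: r_def add_nonneg_pos)
    let ?A = "{x \<in> D. V x < ennreal r}" and ?S = "{x \<in> D. \<not> V x < ennreal r}"
    let ?IA = "\<lambda>n. \<integral>\<^sup>+ x. ennreal ((h n x - g x)\<^sup>2) * indicator ?A x \<partial>lborel"
    let ?IS = "\<lambda>n. \<integral>\<^sup>+ x. ennreal ((h n x - g x)\<^sup>2) * indicator ?S x \<partial>lborel"
    have tail: "?IS n \<le> ennreal (e / 2)" for n
    proof -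
      have "?IS n
          \<le> (\<integral>\<^sup>+ x. 2 * (ennreal ((h n x)\<^sup>2) * indicator ?S x) + 2 * (ennreal ((g x)\<^sup>2) * indicator ?S x) \<partial>lborel)"
      proof (rule nn_integral_mono)
        fix x
        have "0 \<le> (h n x + g x)\<^sup>2" by simp
        then have "(h n x - g x)\<^sup>2 \<le> 2 * (h n x)\<^sup>2 + 2 * (g x)\<^sup>2"
          by (simp add: power2_sum power2_diff)
        then have "ennreal ((h n x - g x)\<^sup>2) \<le> ennreal (2 * (h n x)\<^sup>2 + 2 * (g x)\<^sup>2)" by (rule ennreal_leI)
        also have "\<dots> = 2 * ennreal ((h n x)\<^sup>2) + 2 * ennreal ((g x)\<^sup>2)" by (simp add: ennreal_mult)
        finally have "ennreal ((h n x - g x)\<^sup>2) * indicator ?S x \<le> (2 * ennreal ((h n x)\<^sup>2) + 2 * ennreal ((g x)\<^sup>2)) * indicator ?S x"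
          by (rule mult_right_mono) simp
        then show "ennreal ((h n x - g x)\<^sup>2) * indicator ?S x
            \<le> 2 * (ennreal ((h n x)\<^sup>2) * indicator ?S x) + 2 * (ennreal ((g x)\<^sup>2) * indicator ?S x)"
          by (simp only: distrib_right mult.assoc)
      qed
      also have "\<dots> = 2 * (\<integral>\<^sup>+ x. ennreal ((h n x)\<^sup>2) * indicator ?S x \<partial>lborel) + 2 * (\<integral>\<^sup>+ x. ennreal ((g x)\<^sup>2) * indicator ?S x \<partial>lborel)"
        by (subst nn_integral_add) (simp_all add: nn_integral_cmult)
      also have "\<dots> \<le> 2 * ennreal (a / r * C) + 2 * ennreal (a / r * C)"
        by (intro add_mono mult_left_mono h_tail[OF r] g_tail[OF r]) auto
      also have "\<dots> = ennreal (4 * (a / r * C))"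
      proof -
        have "0 \<le> a / r * C" using a_nonneg r C0 by simp
        then have "ennreal (4 * (a / r * C)) = 4 * ennreal (a / r * C)" by (subst ennreal_mult) simp_all
        also have "\<dots> = 2 * ennreal (a / r * C) + 2 * ennreal (a / r * C)" by (simp add: distrib_right[symmetric])
        finally show ?thesis by simp
      qed
      also have "\<dots> \<le> ennreal (e / 2)"
      proof (rule ennreal_leI)
        define q where "q = (a + 1) * (C + 1)"
        have aC: "a * C \<le> q" unfolding q_def using a_nonneg C0 by (intro mult_mono) auto
        have q: "0 < q" unfolding q_def using a_nonneg C0 by (intro mult_pos_pos) auto
        have rq: "r = 8 * q / e" by (simp add: r_def q_def mult.assoc)
        have "4 * (a / r * C) = e / 2 * (a * C / q)"
          unfolding rq using q e by (simp add: field_simps)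
        moreover have "e / 2 * (a * C / q) \<le> e / 2 * 1"
          using e aC q by (intro mult_left_mono) auto
        ultimately show "4 * (a / r * C) \<le> e / 2" by simp
      qed
      finally show ?thesis .
    qed
    have "?IA \<longlonglongrightarrow> (\<integral>\<^sup>+ x. 0 \<partial>(lborel :: 'a measure))"
    proof (rule nn_integral_dominated_convergence[where w = "\<lambda>x. ennreal ((2 * (B + C))\<^sup>2) * indicator ?A x"])
      show "AE x in lborel. ennreal ((h j x - g x)\<^sup>2) * indicator ?A x \<le> ennreal ((2 * (B + C))\<^sup>2) * indicator ?A x" for j
      proof (intro AE_I2 mult_right_mono ennreal_leI)
        fix x
        have "\<bar>h j x - g x\<bar> \<le> \<bar>h j x\<bar> + \<bar>g x\<bar>" by (rule abs_triangle_ineq4)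
        also have "\<dots> \<le> (B + C) + (B + C)" by (intro add_mono h_bd g_bd)
        also have "\<dots> = 2 * (B + C)" by simp
        finally have "\<bar>h j x - g x\<bar>\<^sup>2 \<le> (2 * (B + C))\<^sup>2" by (rule power_mono) simp
        then show "(h j x - g x)\<^sup>2 \<le> (2 * (B + C))\<^sup>2" by simp
      qed simp
      have "(\<integral>\<^sup>+ x. ennreal ((2 * (B + C))\<^sup>2) * indicator ?A x \<partial>lborel) = ennreal ((2 * (B + C))\<^sup>2) * emeasure lborel ?A"
        by (rule nn_integral_cmult_indicator) (use level_sets(1)[of r] in simp)
      also have "\<dots> < \<infinity>" using V_level[OF r] by (simp add: ennreal_mult_less_top)
      finally show "(\<integral>\<^sup>+ x. ennreal ((2 * (B + C))\<^sup>2) * indicator ?A x \<partial>lborel) < \<infinity>" .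
      show "AE x in lborel. (\<lambda>n. ennreal ((h n x - g x)\<^sup>2) * indicator ?A x) \<longlonglongrightarrow> 0"
      proof (rule AE_I2)
        fix x
        have "(\<lambda>n. (h n x - g x)\<^sup>2) \<longlonglongrightarrow> (g x - g x)\<^sup>2" by (intro tendsto_intros hg)
        from tendsto_ennrealI[OF this] have "(\<lambda>n. ennreal ((h n x - g x)\<^sup>2)) \<longlonglongrightarrow> 0" by simp
        then have "(\<lambda>n. indicator ?A x * ennreal ((h n x - g x)\<^sup>2)) \<longlonglongrightarrow> indicator ?A x * 0"
          by (rule ennreal_tendsto_cmult[rotated]) (simp add: indicator_def)
        then show "(\<lambda>n. ennreal ((h n x - g x)\<^sup>2) * indicator ?A x) \<longlonglongrightarrow> 0"
          by (simp only: mult.commute mult_zero_left mult_zero_right)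
      qed
    qed measurable
    then have "\<forall>\<^sub>F n in sequentially. ?IA n < ennreal (e / 2)"
      using e by (intro order_tendstoD) auto
    then show "\<forall>\<^sub>F n in sequentially. (\<integral>\<^sup>+ x. ennreal ((h n x - g x)\<^sup>2) \<partial>lborel) < b"
    proof eventually_elim
      case (elim n)
      have "(\<integral>\<^sup>+ x. ennreal ((h n x - g x)\<^sup>2) \<partial>lborel)
          = ?IA n + ?IS n"
        by (rule nn_integral_split_level) (auto simp: h_out g_out)
      also have "\<dots> \<le> ?IA n + ennreal (e / 2)"
        by (rule add_left_mono[OF tail])
      also have "\<dots> = ennreal (e / 2) + ?IA n"
        by (rule add.commute)
      also have "\<dots> < ennreal (e / 2) + ennreal (e / 2)"
        unfolding ennreal_add_left_cancel_less using elim by simp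
      also have "\<dots> = ennreal e" using e by (subst ennreal_plus[symmetric]) auto
      also note e(2)
      finally show ?case .
    qed
  qed simp
  then show ?thesis using s(1) gL2 that unfolding h_def by blast
qed

end

section \<open>Transfer to the open set and conclusion\<close>

lemma L2_restrict_space_iff:
  assumes D: "D \<in> sets borel"
  shows "f \<in> L2 (restrict_space lborel D) \<longleftrightarrow> (\<lambda>x. indicator D x * f x) \<in> L2 lborel"
proof -
  have "(indicator D x * f x)\<^sup>2 = indicator D x *\<^sub>R (f x)\<^sup>2" for x by (simp add: indicator_def)
  then show ?thesis
    using D by (simp add: L2_def borel_measurable_restrict_space_iff integrable_restrict_space)
qed

lemma L2_norm_restrict_space:
  fixes f :: "'a::euclidean_space \<Rightarrow> real"
  assumes D: "D \<in> sets borel"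
  shows "(\<integral>x. (f x)\<^sup>2 \<partial>restrict_space lborel D) = (\<integral>x. (indicator D x * f x)\<^sup>2 \<partial>lborel)"
proof -
  have "(indicator D x * f x)\<^sup>2 = indicator D x *\<^sub>R (f x)\<^sup>2" for x by (simp add: indicator_def)
  then show ?thesis using D by (simp add: integral_restrict_space)
qed

lemma (in tail_kernel) compact_operator_restrict_space:
  assumes T: "\<And>f x. x \<in> D \<Longrightarrow> T f x = op (\<lambda>y. indicator D y * f y) x"
  shows "compact_operator_L2 (restrict_space lborel D) T"
  unfolding compact_operator_L2_def
proof (intro conjI ballI allI impI)
  have ind: "indicator D x * T f x = op (\<lambda>y. indicator D y * f y) x" for f x
    by (cases "x \<in> D") (simp_all add: T op_outside)
  fix f assume "f \<in> L2 (restrict_space lborel D)"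
  then have "(\<lambda>y. indicator D y * f y) \<in> L2 lborel" by (simp add: L2_restrict_space_iff)
  then have "op (\<lambda>y. indicator D y * f y) \<in> L2 lborel" by (rule op_L2)
  then show "T f \<in> L2 (restrict_space lborel D)" by (simp add: L2_restrict_space_iff ind)
next
  have ind: "indicator D x * T f x = op (\<lambda>y. indicator D y * f y) x" for f x
    by (cases "x \<in> D") (simp_all add: T op_outside)
  fix f :: "nat \<Rightarrow> 'a \<Rightarrow> real" and C :: real
  assume f: "\<forall>n. f n \<in> L2 (restrict_space lborel D) \<and> (\<integral>x. (f n x)\<^sup>2 \<partial>restrict_space lborel D) \<le> C"
  have f1: "(\<lambda>y. indicator D y * f n y) \<in> L2 lborel" for n using f by (simp add: L2_restrict_space_iff)
  have f2: "(\<integral>y. (indicator D y * f n y)\<^sup>2 \<partial>lborel) \<le> C" for n using f by (simp add: L2_norm_restrict_space)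
  obtain s g where s: "strict_mono (s :: nat \<Rightarrow> nat)" and g: "g \<in> L2 lborel"
    and conv: "(\<lambda>n. \<integral>\<^sup>+ x. ennreal ((op (\<lambda>y. indicator D y * f (s n) y) x - g x)\<^sup>2) \<partial>lborel) \<longlonglongrightarrow> 0"
    by (rule op_compact[OF f1 f2])
  have [measurable]: "g \<in> borel_measurable borel" using g by (simp add: L2_def)
  have [measurable]: "op (\<lambda>y. indicator D y * f n y) \<in> borel_measurable borel" for n
    using op_L2[OF f1[of n]] by (simp add: L2_def)
  have "integrable lborel (\<lambda>x. (indicator D x * g x)\<^sup>2)"
    by (rule Bochner_Integration.integrable_bound[of lborel "\<lambda>x. (g x)\<^sup>2"])
       (use g in \<open>auto simp: L2_def indicator_def\<close>)
  then have "(\<lambda>x. indicator D x * g x) \<in> L2 lborel" by (simp add: L2_def)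
  then have gL2: "g \<in> L2 (restrict_space lborel D)" by (simp add: L2_restrict_space_iff)
  have "(\<lambda>n. \<integral>x. (T (f (s n)) x - g x)\<^sup>2 \<partial>restrict_space lborel D) \<longlonglongrightarrow> 0"
  proof (rule tendsto_sandwich[OF _ _ tendsto_const])
    let ?I = "\<lambda>n. \<integral>\<^sup>+ x. ennreal ((op (\<lambda>y. indicator D y * f (s n) y) x - g x)\<^sup>2) \<partial>lborel"
    show "(\<lambda>n. enn2real (?I n)) \<longlonglongrightarrow> 0"
      using tendsto_enn2real[of ?I 0 sequentially] conv by simp
    show "\<forall>\<^sub>F n in sequentially. (\<integral>x. (T (f (s n)) x - g x)\<^sup>2 \<partial>restrict_space lborel D) \<le> enn2real (?I n)"
    proof (rule always_eventually, rule allI)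
      fix n
      let ?d = "\<lambda>x. op (\<lambda>y. indicator D y * f (s n) y) x - g x"
      have d: "integrable lborel (\<lambda>x. (?d x)\<^sup>2)"
        using L2_diff[OF op_L2[OF f1[of "s n"]] g] by (simp add: L2_def)
      have "(\<integral>x. (T (f (s n)) x - g x)\<^sup>2 \<partial>restrict_space lborel D) = (\<integral>x. (indicator D x * (T (f (s n)) x - g x))\<^sup>2 \<partial>lborel)"
        by (simp add: L2_norm_restrict_space)
      also have "\<dots> = (\<integral>x. (indicator D x * ?d x)\<^sup>2 \<partial>lborel)"
        by (intro Bochner_Integration.integral_cong) (auto simp: T indicator_def)
      also have "\<dots> \<le> (\<integral>x. (?d x)\<^sup>2 \<partial>lborel)"
        by (rule integral_mono_AE'[OF d]) (auto simp: indicator_def)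
      also have "\<dots> = enn2real (?I n)" by (rule integral_eq_nn_integral) auto
      finally show "(\<integral>x. (T (f (s n)) x - g x)\<^sup>2 \<partial>restrict_space lborel D) \<le> enn2real (?I n)" .
    qed
  qed simp
  then show "\<exists>r g. strict_mono (r :: nat \<Rightarrow> nat) \<and> g \<in> L2 (restrict_space lborel D) \<and>
      (\<lambda>n. \<integral>x. (T (f (r n)) x - g x)\<^sup>2 \<partial>restrict_space lborel D) \<longlonglongrightarrow> 0"
    using s gL2 by blast
qed

text \<open>Extension by \<open>0\<close> turns the Dirichlet heat kernel into a kernel on the whole
  space. Joint measurability comes from continuity on the open set \<open>D \<times> D\<close>, and
  the mass bound from the domination by \<open>p\<close>, the subtracted exit term being
  nonnegative.\<close>

lemma (in symmetric_hunt_density) dirichlet_tail_kernel: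
  assumes J: "jump_kernel J" and assoc: "associated_with_form P X (energy J) (form_domain J)"
    and D: "open D" and t: "0 < t"
    and cont: "continuous_on (D \<times> D) (\<lambda>(x, y). dirichlet_heat_kernel P X p D t x y)"
    and nonneg: "\<And>x y. x \<in> D \<Longrightarrow> y \<in> D \<Longrightarrow> 0 \<le> dirichlet_heat_kernel P X p D t x y"
    and bound: "\<And>x y. x \<in> D \<Longrightarrow> y \<in> D \<Longrightarrow> dirichlet_heat_kernel P X p D t x y \<le> B"
    and level: "\<And>r::real. r > 0 \<Longrightarrow> emeasure lborel {x \<in> D. killing_rate J D x < ennreal r} < \<infinity>"
    and B: "0 \<le> B"
  shows "tail_kernel (\<lambda>x y. indicator D x * indicator D y * dirichlet_heat_kernel P X p D t x y) D (killing_rate J D) B (1 / (2 * t))"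
proof
  let ?k = "dirichlet_heat_kernel P X p D t"
  have Db [measurable]: "D \<in> sets borel" using D by simp
  show "open D" by (rule D)
  have "(\<lambda>z. indicator (D \<times> D) z *\<^sub>R (case z of (x, y) \<Rightarrow> ?k x y)) \<in> borel_measurable borel"
    by (rule borel_measurable_continuous_on_indicator[OF _ cont]) (simp add: D open_Times)
  moreover have "(\<lambda>z. indicator (D \<times> D) z *\<^sub>R (case z of (x, y) \<Rightarrow> ?k x y)) = (\<lambda>(x, y). indicator D x * indicator D y * ?k x y)"
    by (auto simp: fun_eq_iff indicator_def)
  ultimately show "(\<lambda>(x, y). indicator D x * indicator D y * ?k x y) \<in> borel_measurable (borel \<Otimes>\<^sub>M borel)"
    by (simp add: borel_prod)
  show "0 \<le> indicator D x * indicator D y * ?k x y" "indicator D x * indicator D y * ?k x y \<le> B" for x y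
    using nonneg[of x y] bound[of x y] B by (auto simp: indicator_def)
  show "x \<notin> D \<or> y \<notin> D \<Longrightarrow> indicator D x * indicator D y * ?k x y = 0" for x y by auto
  show "continuous_on D (\<lambda>x. indicator D x * indicator D y * ?k x y)" if "y \<in> D" for y
  proof -
    have "continuous_on D (\<lambda>x. case (x, y) of (x, y) \<Rightarrow> ?k x y)"
      by (rule continuous_on_compose2[OF cont]) (use that in \<open>auto intro!: continuous_intros\<close>)
    moreover have "continuous_on D (\<lambda>x. indicator D x * indicator D y * ?k x y) \<longleftrightarrow> continuous_on D (\<lambda>x. case (x, y) of (x, y) \<Rightarrow> ?k x y)"
      by (rule continuous_on_cong) (use that in auto)
    ultimately show ?thesis by blast
  qed
  obtain \<sigma> where \<sigma>: "stopping_time Fl \<sigma>" and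
    exit: "\<forall>x\<in>D. exits_at D \<sigma> x"
    by (rule exit_time_stopping[OF D])
  have le_p: "?k x y \<le> p t x y" if "x \<in> D" "y \<in> D" for x y
    using dirichlet_heat_kernel_eq[OF stopping_time_measurable[OF \<sigma>] t that bspec[OF exit that(1)]] by simp
  show "(\<integral>\<^sup>+ y. ennreal (indicator D x * indicator D y * ?k x y) \<partial>lborel) \<le> 1" for x
  proof -
    have "(\<integral>\<^sup>+ y. ennreal (indicator D x * indicator D y * ?k x y) \<partial>lborel) \<le> heat t (\<lambda>_. 1) x"
      unfolding heat_def using le_p p_nonneg[OF t]
      by (intro nn_integral_mono) (auto simp: indicator_def intro!: ennreal_leI)
    also have "\<dots> \<le> 1" by (rule heat_1_le[OF t])
    finally show ?thesis .
  qed
  show "(\<lambda>x. indicator D x * killing_rate J D x) \<in> borel_measurable borel"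
    by (rule killing_rate_measurable[OF J Db])
  show "emeasure lborel {x \<in> D. killing_rate J D x < ennreal r} < \<infinity>" if "0 < r" for r by (rule level[OF that])
  show "0 \<le> 1 / (2 * t)" using t by simp
  fix f :: "'a \<Rightarrow> ennreal" and c
  assume f: "f \<in> borel_measurable borel" "\<And>y. f y \<le> ennreal c" "\<And>y. y \<notin> D \<Longrightarrow> f y = 0"
    and fin: "(\<integral>\<^sup>+ x. (f x)\<^sup>2 \<partial>lborel) < \<infinity>"
  let ?u = "\<lambda>x. \<integral>\<^sup>+ y. ennreal (indicator D x * indicator D y * ?k x y) * f y \<partial>lborel"
  let ?v = "\<lambda>x. \<integral>\<^sup>+ y. ennreal (?k x y) * f y \<partial>lborel"
  have inner: "?u x = ?v x"
    if "x \<in> D" for x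
  proof (rule nn_integral_cong)
    fix y show "ennreal (indicator D x * indicator D y * ?k x y) * f y = ennreal (?k x y) * f y"
      using that f(3)[of y] by (cases "y \<in> D") auto
  qed
  have "(\<integral>\<^sup>+ x. indicator D x * (?u x)\<^sup>2 * killing_rate J D x \<partial>lborel)
      = (\<integral>\<^sup>+ x. indicator D x * (?v x)\<^sup>2 * killing_rate J D x \<partial>lborel)"
  proof (rule nn_integral_cong)
    fix x
    show "indicator D x * (?u x)\<^sup>2 * killing_rate J D x
      = indicator D x * (?v x)\<^sup>2 * killing_rate J D x"
      by (cases "x \<in> D") (simp only: inner, simp)
  qed
  also have "\<dots> \<le> ennreal (1 / (2 * t)) * (\<integral>\<^sup>+ x. (f x)\<^sup>2 \<partial>lborel)"
    by (rule killing_estimate_bounded[OF J assoc D t nonneg f fin])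
  finally show "(\<integral>\<^sup>+ x. indicator D x * (?u x)\<^sup>2 * killing_rate J D x \<partial>lborel)
      \<le> ennreal (1 / (2 * t)) * (\<integral>\<^sup>+ x. (f x)\<^sup>2 \<partial>lborel)" .
qed

theorem theorem2p5:
  fixes J :: "'a::euclidean_space \<Rightarrow> 'a \<Rightarrow> real"
    and M :: "'w measure" and Fl :: "ennreal \<Rightarrow> 'w measure"
    and X :: "ennreal \<Rightarrow> 'w \<Rightarrow> 'a option" and \<theta> :: "ennreal \<Rightarrow> 'w \<Rightarrow> 'w"
    and P :: "'a option \<Rightarrow> 'w measure"
    and p :: "real \<Rightarrow> 'a \<Rightarrow> 'a \<Rightarrow> real"
    and D :: "'a set" and \<Theta> :: "real \<Rightarrow> real"
  assumes "jump_kernel J"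
    and "hunt_process M Fl X \<theta> P"
    and "associated_with_form P X (energy J) (form_domain J)"
    and "transition_density P X p"
    and "open D"
    and "\<And>t. t > 0 \<Longrightarrow> bounded ((\<lambda>(x, y). dirichlet_heat_kernel P X p D t x y) ` (D \<times> D))"
    and "\<And>t. t > 0 \<Longrightarrow> continuous_on (D \<times> D) (\<lambda>(x, y). dirichlet_heat_kernel P X p D t x y)"
    and "\<And>t x y. t > 0 \<Longrightarrow> x \<in> D \<Longrightarrow> y \<in> D \<Longrightarrow> dirichlet_heat_kernel P X p D t x y > 0"
    and "\<And>s. s > 0 \<Longrightarrow> \<Theta> s > 0"
    and "antimono_on {0<..} \<Theta>"
    and "\<forall>\<^sub>F s in at_top. (\<integral>\<^sup>+ r\<in>{s..}. Theta_inv \<Theta> r / ennreal r \<partial>lborel) < \<infinity>"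
    and "\<And>t x y. t > 0 \<Longrightarrow> x \<in> D \<Longrightarrow> y \<in> D \<Longrightarrow> dirichlet_heat_kernel P X p D t x y \<le> \<Theta> t"
    and "\<And>r::real. r > 0 \<Longrightarrow> emeasure lborel {x \<in> D. killing_rate J D x < ennreal r} < \<infinity>"
  shows "\<forall>t>0. compact_operator_L2 (restrict_space lborel D) (dirichlet_semigroup P X p D t)"
proof (intro allI impI)
  fix t :: real assume t: "t > 0"
  have Db: "D \<in> sets borel" using assms(5) by simp
  interpret hunt_process M Fl X \<theta> P by (rule assms(2))
  interpret symmetric_hunt_density M Fl X \<theta> P p
  proof
    show "transition_density P X p" by (rule assms(4))
    show "(\<integral>x. semigroup P X t f x * g x \<partial>lborel) = (\<integral>x. f x * semigroup P X t g x \<partial>lborel)"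
      if "0 < t" "f \<in> L2 lborel" "g \<in> L2 lborel" for t f g
      using assms(3) that unfolding associated_with_form_def by blast
  qed
  \<comment> \<open>The time is fixed, so \<open>\<Theta> t\<close> is a uniform bound for the
    kernel; \<open>1 / (2 * t)\<close> is the constant of the energy estimate.\<close>
  interpret tail_kernel "\<lambda>x y. indicator D x * indicator D y * dirichlet_heat_kernel P X p D t x y" D "killing_rate J D" "\<Theta> t" "1 / (2 * t)"
    by (rule dirichlet_tail_kernel[OF assms(1,3,5) t assms(7)[OF t] less_imp_le[OF assms(8)[OF t]]
          assms(12)[OF t] assms(13) less_imp_le[OF assms(9)[OF t]]])
  show "compact_operator_L2 (restrict_space lborel D) (dirichlet_semigroup P X p D t)"
  proof (rule compact_operator_restrict_space)
    fix f :: "'a \<Rightarrow> real" and x assume x: "x \<in> D"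
    show "dirichlet_semigroup P X p D t f x = op (\<lambda>y. indicator D y * f y) x"
      unfolding dirichlet_semigroup_def op_def using x Db
      by (subst integral_restrict_space)
         (auto simp: indicator_def intro!: Bochner_Integration.integral_cong)
  qed
qed

end
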